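(* For every integer $M\ge 1$ there exists $\varphi_{0}>0$ (possibly depending on $M$) such that for every $\varphi$ with $\mathrm{dist}(\varphi,\pi\mathbb Z)\le\varphi_0$ the following hold for the strip operator $U^{(M)}_{\omega}(\varphi)$ on $\ell^{2}(\Lambda_{(\infty,M)})$: (1) $U^{(M)}_{\omega}(\varphi)$ has pure point spectrum for $\mathbb P$-almost every $\omega$; (2) for every $p\ge0$ and every $\psi\in\ell^{2}(\Lambda_{(\infty,M)})$ of finite support, for $\mathbb P$-almost every $\omega$, $\sup_{n\in\mathbb Z}\Vert |X|^{p}(U^{(M)}_{\omega}(\varphi))^{n}\psi\Vert<\infty$, where $|X|^{p}e_{\mu}=|\mu|^{p}e_{\mu}$, $|\mu|$ the Euclidean norm; (3) there exist $c,g>0$ such that for all $\mu,\nu\in\Lambda_{(\infty,M)}$, \[\mathbb E\Big[\sup_{f\in C(\mathbb T),\|f\|_\infty\le1}\big|\langle e_{\mu},f(U^{(M)}_{\omega}(\varphi))e_{\nu}\rangle\big|\Big]\le c\,e^{-g|\mu-\nu|}.\]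
   Context: Let $\{e_{\mu}\}_{\mu\in\mathbb Z^{2}}$ be the standard basis of $\ell^{2}(\mathbb Z^{2})$ and $\mathbb T=\{z\in\mathbb C:|z|=1\}$. Let $\Omega=\mathbb T^{\mathbb Z^{2}}$ with the product $\sigma$-algebra and probability $\mathbb P=\bigotimes_{\mu\in\mathbb Z^{2}}d\ell$, $d\ell$ normalized Lebesgue measure on $\mathbb T$; $\mathbb E$ denotes expectation. $D_{\omega}e_{\mu}=\omega_{\mu}e_{\mu}$. $S_{\circlearrowleft}$ is the unitary permuting cyclically $e_{(2j,2k)}\mapsto e_{(2j+1,2k)}\mapsto e_{(2j+1,2k+1)}\mapsto e_{(2j,2k+1)}\mapsto e_{(2j,2k)}$ for all $j,k\in\mathbb Z$; $S_{\circlearrowright}$ is the unitary permuting cyclically $e_{(2j,2k)}\mapsto e_{(2j,2k-1)}\mapsto e_{(2j-1,2k-1)}\mapsto e_{(2j-1,2k)}\mapsto e_{(2j,2k)}$ for all $j,k\in\mathbb Z$. $S(\varphi)=\cos\varphi\,S_{\circlearrowleft}+i\sin\varphi\,S_{\circlearrowright}$. For $M\in\mathbb N$ let $\Lambda_{(\infty,M)}=\mathbb Z\times([-2M+2,2M+1]\cap\mathbb Z)$, $\chi$ the orthogonal projection onto $\ell^{2}(\Lambda_{(\infty,M)})=\overline{\mathrm{span}}\{e_\mu:\mu\in\Lambda_{(\infty,M)}\}$, and for $\alpha,\beta\in\mathbb Z^2$ let $|\alpha\rangle\langle\beta|$ denote the operator $\psi\mapsto\langle e_\beta,\psi\rangle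 e_\alpha$. The strip restriction (with elastic boundary conditions: clockwise components fully transmitted along the walls) is \[U^{(M)}_{\omega}(\varphi)=\chi D_{\omega}\chi\,\big(\chi S(\varphi)\chi+T^{(M)}(\varphi)\big)\quad\text{on }\ell^2(\Lambda_{(\infty,M)}),\] \[T^{(M)}(\varphi)=(1-\cos\varphi)\sum_{j\in\mathbb Z}\Big(|(2j,2M+1)\rangle\langle(2j+1,2M+1)|+|(2j+1,-2M+2)\rangle\langle(2j,-2M+2)|\Big).\] *)

theory Defs
  imports "HOL-Probability.Probability"
begin

type_synonym site = "int \<times> int"
type_synonym vec = "site \<Rightarrow> complex"
type_synonym op = "vec \<Rightarrow> vec"

definition e :: "site \<Rightarrow> vec" where
  "e mu = (\<lambda>x. if x = mu then 1 else 0)"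

definition enorm :: "site \<Rightarrow> real" where
  "enorm mu = sqrt ((real_of_int (fst mu))\<^sup>2 + (real_of_int (snd mu))\<^sup>2)"

text \<open>Squared l2 norm, valued in [0,\<infinity>] (so no summability side conditions).\<close>
definition sqnorm :: "vec \<Rightarrow> ennreal" where
  "sqnorm psi = (\<integral>\<^sup>+ mu. ennreal ((cmod (psi mu))\<^sup>2) \<partial>count_space UNIV)"

definition strip :: "nat \<Rightarrow> site set" where
  "strip M = {mu. - 2 * int M + 2 \<le> snd mu \<and> snd mu \<le> 2 * int M + 1}"

definition in_l2 :: "site set \<Rightarrow> vec \<Rightarrow> bool" where
  "in_l2 L psi \<longleftrightarrow> (\<forall>mu. mu \<notin> L \<longrightarrow> psi mu = 0) \<and> sqnorm psi < \<infinity>"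

text \<open>Cyclic site permutations underlying S_ccw and S_cw (sigma maps mu to the
  site e_mu is sent to).\<close>
definition sigma_ccw :: "site \<Rightarrow> site" where
  "sigma_ccw mu = (case mu of (x, y) \<Rightarrow>
     if even x \<and> even y then (x + 1, y)
     else if odd x \<and> even y then (x, y + 1)
     else if odd x \<and> odd y then (x - 1, y)
     else (x, y - 1))"

definition sigma_cw :: "site \<Rightarrow> site" where
  "sigma_cw mu = (case mu of (x, y) \<Rightarrow>
     if even x \<and> even y then (x, y - 1)
     else if even x \<and> odd y then (x - 1, y)
     else if odd x \<and> odd y then (x, y + 1)
     else (x + 1, y))"

definition perm_op :: "(site \<Rightarrow> site) \<Rightarrow> op" where
  "perm_op s psi = (\<lambda>x. psi (inv s x))"

definition S_ccw :: op where "S_ccw = perm_op sigma_ccw"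
definition S_cw :: op where "S_cw = perm_op sigma_cw"

definition S_phi :: "real \<Rightarrow> op" where
  "S_phi phi psi = (\<lambda>x. complex_of_real (cos phi) * S_ccw psi x
                       + \<i> * complex_of_real (sin phi) * S_cw psi x)"

definition D_op :: "(site \<Rightarrow> complex) \<Rightarrow> op" where
  "D_op om psi = (\<lambda>mu. om mu * psi mu)"

definition chi :: "site set \<Rightarrow> op" where
  "chi L psi = (\<lambda>mu. if mu \<in> L then psi mu else 0)"

text \<open>Boundary term T^(M)(phi); the target sites of the rank-one pieces are pairwise distinct,
  so the sum over j is evaluated pointwise.\<close>
definition T_op :: "nat \<Rightarrow> real \<Rightarrow> op" where
  "T_op M phi psi = (\<lambda>mu. complex_of_real (1 - cos phi) *
     (if snd mu = 2 * int M + 1 \<and> even (fst mu) then psi (fst mu + 1, 2 * int M + 1)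
      else if snd mu = - 2 * int M + 2 \<and> odd (fst mu) then psi (fst mu - 1, - 2 * int M + 2)
      else 0))"

definition U_op :: "nat \<Rightarrow> (site \<Rightarrow> complex) \<Rightarrow> real \<Rightarrow> op" where
  "U_op M om phi psi =
     chi (strip M) (D_op om (chi (strip M)
        (\<lambda>mu. chi (strip M) (S_phi phi (chi (strip M) psi)) mu + T_op M phi psi mu)))"

text \<open>Adjoint of a (column-finite) operator given by its matrix entries
  U_{nu mu} = (U e_mu)(nu).\<close>
definition adj :: "op \<Rightarrow> op" where
  "adj U psi = (\<lambda>mu. infsum (\<lambda>nu. cnj (U (e mu) nu) * psi nu) UNIV)"

text \<open>Integer powers of a unitary: U^(-n) = (U^* )^n.\<close>
definition upow :: "op \<Rightarrow> int \<Rightarrow> op" where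
  "upow U n = (if n \<ge> 0 then U ^^ nat n else adj U ^^ nat (- n))"

definition eigvec :: "site set \<Rightarrow> op \<Rightarrow> vec \<Rightarrow> bool" where
  "eigvec L U v \<longleftrightarrow> in_l2 L v \<and> v \<noteq> (\<lambda>_. 0) \<and> (\<exists>lam. U v = (\<lambda>mu. lam * v mu))"

definition pure_point :: "site set \<Rightarrow> op \<Rightarrow> bool" where
  "pure_point L U \<longleftrightarrow>
     (\<forall>psi. in_l2 L psi \<longrightarrow> (\<forall>eps>0. \<exists>(n::nat) (c::nat \<Rightarrow> complex) v.
        (\<forall>i<n. eigvec L U (v i)) \<and>
        sqnorm (\<lambda>mu. psi mu - (\<Sum>i<n. c i * v i mu)) < ennreal eps))"

definition circle :: "complex set" where
  "circle = {z. cmod z = 1}"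

definition circle_measure :: "complex measure" where
  "circle_measure = distr (uniform_measure lborel {0..<2 * pi}) borel cis"

definition Prob :: "(site \<Rightarrow> complex) measure" where
  "Prob = PiM UNIV (\<lambda>_. circle_measure)"

text \<open>Continuous functional calculus f(U) for f in C(T): f(U) psi is the limit of
  the Fejer means sigma_N f (U) psi (Fejer means converge uniformly on T to f).\<close>
definition fourier_coeff :: "(complex \<Rightarrow> complex) \<Rightarrow> int \<Rightarrow> complex" where
  "fourier_coeff f k = complex_of_real (1 / (2 * pi)) *
     integral {0..2 * pi} (\<lambda>t. f (cis t) * cis (- (real_of_int k) * t))"

definition fejer_op :: "op \<Rightarrow> (complex \<Rightarrow> complex) \<Rightarrow> nat \<Rightarrow> op" where
  "fejer_op U f N psi = (\<lambda>mu. \<Sum>k\<in>{- int N..int N}.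
      complex_of_real (1 - real_of_int \<bar>k\<bar> / real (N + 1)) * fourier_coeff f k * upow U k psi mu)"

definition fcalc :: "op \<Rightarrow> (complex \<Rightarrow> complex) \<Rightarrow> op" where
  "fcalc U f psi = (\<lambda>mu. lim (\<lambda>N. fejer_op U f N psi mu))"

text \<open>Weight |X|^p, with |mu|^0 = 1 also at mu = 0.\<close>
definition absX_pow :: "real \<Rightarrow> op" where
  "absX_pow p psi = (\<lambda>mu. complex_of_real (if p = 0 then 1 else enorm mu powr p) * psi mu)"

end

theory Submission
  imports Defs "HOL-Computational_Algebra.Fundamental_Theorem_Algebra"
    "HOL-Real_Asymp.Real_Asymp" "HOL-Library.Diagonal_Subsequence"
begin

text \<open>Near \<open>\<pi>\<int>\<close> the counterclockwise plaquettes decouple, so the fractional moment method applies: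
  the square root of a resolvent entry of a finite box is integrable in the two phases at its endpoints,
  and removing the plaquette of one endpoint costs a factor \<open>O(sqrt |sin \<phi>|)\<close> by the resolvent identity
  while leaving a resolvent that is independent of the removed phases. Iterating gives exponential decay,
  uniformly in the box and in the spectral parameter \<open>|z| < 1\<close>. Averaging over the phase at the source
  and letting \<open>z\<close> tend to the unit circle turns this into decay of the eigenfunction correlator
  \<open>\<Sum>\<^sub>l |\<langle>e\<^sub>m, P\<^sub>l e\<^sub>k\<rangle>|\<close> of the unitary box operators. These agree locally with the strip operator,
  so the correlator dominates \<open>f(U)\<close> by Fejer approximation and Fatou's lemma, which gives (3) and then (2).
  For (1), decay of the correlator forces all but an arbitrarily small part of \<open>e\<^sub>k\<close> to be spanned by a number
  of box eigenvectors that does not depend on the box; by compactness these converge to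
  eigenvectors of the strip operator.\<close>

section \<open>Resolvents of partial networks\<close>

text \<open>A resolvent entry has a simple pole in a single phase, and \<open>1/|t|\<close> is not
  integrable on an arc while \<open>|t|\<close> to the power \<open>-1/2\<close> is; hence the
  square roots. The proof is shaped by the wish to make the dependence on one phase exact. For this
  \<open>stp A\<close> restricts only the sites that receive amplitude, so that a source outside
  \<open>A\<close> is allowed and \<open>res A\<close> involves no phase outside \<open>A\<close>.
  Adding a site then produces explicit fractional linear functions of the new phase, whose poles are
  governed by amplitudes of modulus at most 1; no spectral theory enters at this stage. The
  condition \<open>4 * C\<^sup>2 * sqrt s \<le> 1 / 4\<close> asks for more than mere decay: the
  moment bounds concern square roots of eigenfunction ratios, and the passage to first powers costs
  \<open>2 ^ n\<close> against \<open>(1/4) ^ n\<close>, where \<open>n\<close> is about a third of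
  the lattice distance.\<close>

definition ccw_pred :: "site \<Rightarrow> site" where
  "ccw_pred mu = (case mu of (x, y) \<Rightarrow>
     if even y then (if odd x then (x - 1, y) else (x, y + 1))
     else (if odd x then (x, y - 1) else (x + 1, y)))"

definition cw_pred :: "site \<Rightarrow> site" where
  "cw_pred mu = (case mu of (x, y) \<Rightarrow>
     if odd y then (if even x then (x, y + 1) else (x + 1, y))
     else (if odd x then (x, y - 1) else (x - 1, y)))"

text \<open>Written from the receiving site: \<open>x\<close> collects amplitude from its two
  predecessors. Site dependent coefficients absorb the walls, so that strip and boxes belong to one
  family.\<close>

definition hop :: "(site \<Rightarrow> complex) \<Rightarrow> (site \<Rightarrow> complex) \<Rightarrow> op" where
  "hop a b psi = (\<lambda>x. a x * psi (ccw_pred x) + b x * psi (cw_pred x))"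

lemma hop_lin: "hop a b (\<lambda>x. f x + c * g x) m = hop a b f m + c * hop a b g m"
  by (simp add: hop_def algebra_simps)

text \<open>Phases off the unit circle form a null set; normalizing them lets all bounds hold for every \<open>om\<close>.\<close>
definition unimod :: "complex \<Rightarrow> complex" where
  "unimod u = (if cmod u = 1 then u else 1)"

lemma cmod_unimod [simp]: "cmod (unimod u) = 1"
  by (simp add: unimod_def)

lemma unimod_cis [simp]: "unimod (cis t) = cis t"
  by (simp add: unimod_def)

definition nsq :: "site set \<Rightarrow> vec \<Rightarrow> real" where
  "nsq X psi = (\<Sum>x\<in>X. (cmod (psi x))\<^sup>2)"

lemma nsq_nonneg [simp]: "0 \<le> nsq X psi"
  by (simp add: nsq_def sum_nonneg)

lemma nsq_mono: "finite Y \<Longrightarrow> X \<subseteq> Y \<Longrightarrow> nsq X psi \<le> nsq Y psi"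
  unfolding nsq_def by (rule sum_mono2) auto

lemma nsq_supp:
  assumes "finite Y" "X \<subseteq> Y" "\<And>x. x \<notin> X \<Longrightarrow> psi x = 0"
  shows "nsq Y psi = nsq X psi"
  unfolding nsq_def by (rule sum.mono_neutral_right) (use assms in auto)

lemma cmod_le_nsq:
  assumes "finite X" "x \<in> X"
  shows "(cmod (psi x))\<^sup>2 \<le> nsq X psi"
  unfolding nsq_def using assms by (intro member_le_sum) auto

lemma nsq_e: "finite X \<Longrightarrow> k \<in> X \<Longrightarrow> nsq X (e k) = 1"
  by (simp add: nsq_def e_def if_distrib[of cmod] if_distrib[of "\<lambda>x. x\<^sup>2"] sum.delta cong: if_cong)

lemma e_same [simp]: "e k k = 1"
  by (simp add: e_def)

lemma e_diff: "x \<noteq> k \<Longrightarrow> e k x = 0"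
  by (simp add: e_def)

text \<open>\<open>hop a b\<close> has norm at most 1. Testing this on finitely supported vectors
  and finite target sets keeps all later estimates within finite sums.\<close>

locale scattering =
  fixes a b :: "site \<Rightarrow> complex"
  assumes contractive:
    "\<lbrakk>finite X; \<And>x. x \<notin> X \<Longrightarrow> psi x = 0; finite A\<rbrakk> \<Longrightarrow> nsq A (hop a b psi) \<le> nsq X psi"
begin

text \<open>The restriction to \<open>A\<close> concerns the target only: a source outside
  \<open>A\<close> feeds into \<open>A\<close>, but no amplitude returns to it.\<close>

definition stp :: "site set \<Rightarrow> complex \<Rightarrow> (site \<Rightarrow> complex) \<Rightarrow> op" where
  "stp A z om psi = (\<lambda>x. if x \<in> A then z * unimod (om x) * hop a b psi x else 0)"

text \<open>The Neumann series for the inverse of \<open>1 - stp A z om\<close>, applied to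
  \<open>e k\<close>; contractivity makes it converge for \<open>cmod z < 1\<close>.\<close>

definition res :: "site set \<Rightarrow> complex \<Rightarrow> (site \<Rightarrow> complex) \<Rightarrow> site \<Rightarrow> vec" where
  "res A z om k = (\<lambda>x. \<Sum>n. (stp A z om ^^ n) (e k) x)"

lemma stp_add: "stp A z om (\<lambda>x. f x + g x) = (\<lambda>x. stp A z om f x + stp A z om g x)"
  by (rule ext) (simp add: stp_def hop_def algebra_simps)

lemma stp_diff: "stp A z om (\<lambda>x. f x - g x) = (\<lambda>x. stp A z om f x - stp A z om g x)"
  by (rule ext) (simp add: stp_def hop_def algebra_simps)

lemma stp_cmult: "stp A z om (\<lambda>x. c * f x) = (\<lambda>x. c * stp A z om f x)"
  by (rule ext) (simp add: stp_def hop_def algebra_simps)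

lemma stp_sum: "stp A z om (\<lambda>x. \<Sum>i\<in>I. f i x) = (\<lambda>x. \<Sum>i\<in>I. stp A z om (f i) x)"
  by (rule ext) (simp add: stp_def hop_def sum.distrib sum_distrib_left distrib_left)

lemma nsq_stp:
  assumes "finite A" "finite X" "\<And>x. x \<notin> X \<Longrightarrow> psi x = 0"
  shows "nsq A (stp A z om psi) \<le> (cmod z)\<^sup>2 * nsq X psi"
proof -
  have "nsq A (stp A z om psi) = (cmod z)\<^sup>2 * nsq A (hop a b psi)"
    by (simp add: nsq_def stp_def norm_mult power_mult_distrib sum_distrib_left)
  also have "\<dots> \<le> (cmod z)\<^sup>2 * nsq X psi"
    using contractive[OF assms(2,3,1)] by (intro mult_left_mono) auto
  finally show ?thesis .
qed

lemma stp_pow_supp: "x \<notin> insert k A \<Longrightarrow> (stp A z om ^^ n) (e k) x = 0"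
  by (cases n) (auto simp: stp_def e_def)

lemma nsq_stp_pow:
  assumes "finite A"
  shows "nsq (insert k A) ((stp A z om ^^ n) (e k)) \<le> ((cmod z)\<^sup>2) ^ n"
proof (induction n)
  case 0
  then show ?case using assms by (simp add: nsq_e)
next
  case (Suc n)
  have "nsq (insert k A) ((stp A z om ^^ Suc n) (e k)) = nsq A ((stp A z om ^^ Suc n) (e k))"
    using assms by (intro nsq_supp) (auto simp: stp_def)
  also have "\<dots> \<le> (cmod z)\<^sup>2 * nsq (insert k A) ((stp A z om ^^ n) (e k))"
    using nsq_stp[OF assms, of "insert k A" "(stp A z om ^^ n) (e k)" z om] assms stp_pow_supp
    by auto
  also have "\<dots> \<le> (cmod z)\<^sup>2 * ((cmod z)\<^sup>2) ^ n"
    using Suc by (intro mult_left_mono) auto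
  finally show ?case by simp
qed

lemma stp_pow_bound:
  assumes "finite A"
  shows "cmod ((stp A z om ^^ n) (e k) x) \<le> cmod z ^ n"
proof (cases "x \<in> insert k A")
  case True
  have "(cmod ((stp A z om ^^ n) (e k) x))\<^sup>2 \<le> ((cmod z)\<^sup>2) ^ n"
    using cmod_le_nsq[of "insert k A" x] nsq_stp_pow[OF assms] assms True order_trans by blast
  then have "(cmod ((stp A z om ^^ n) (e k) x))\<^sup>2 \<le> (cmod z ^ n)\<^sup>2"
    by (simp add: power_mult[symmetric] mult.commute)
  then show ?thesis by (rule power2_le_imp_le) simp
qed (simp add: stp_pow_supp)

lemma summable_stp_pow:
  assumes "finite A" "cmod z < 1"
  shows "summable (\<lambda>n. (stp A z om ^^ n) (e k) x)"
  by (rule summable_comparison_test'[of "\<lambda>n. cmod z ^ n" 0])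
     (use assms stp_pow_bound summable_geometric in auto)

lemma res_supp: "x \<notin> insert k A \<Longrightarrow> res A z om k x = 0"
  using stp_pow_supp[of x k A] by (simp add: res_def)

lemma res_eq:
  assumes "finite A" "cmod z < 1"
  shows "res A z om k x = e k x + stp A z om (res A z om k) x"
proof -
  let ?f = "\<lambda>n. (stp A z om ^^ n) (e k)"
  note s = summable_stp_pow[OF assms]
  have "stp A z om (res A z om k) x = (\<Sum>n. stp A z om (?f n) x)"
  proof (cases "x \<in> A")
    case True
    have "(\<lambda>n. z * unimod (om x) * (a x * ?f n (ccw_pred x) + b x * ?f n (cw_pred x))) sums
       (z * unimod (om x) * (a x * res A z om k (ccw_pred x) + b x * res A z om k (cw_pred x)))"
      unfolding res_def by (intro sums_mult sums_add summable_sums s)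
    then show ?thesis using True by (simp add: stp_def hop_def sums_unique)
  qed (simp add: stp_def)
  also have "\<dots> = (\<Sum>n. ?f (Suc n) x)" by simp
  also have "\<dots> = res A z om k x - e k x"
    unfolding res_def using suminf_split_head[OF s[of om k x]] by simp
  finally show ?thesis by simp
qed

text \<open>A fixed point lives on \<open>A\<close>, where one step multiplies the squared norm by
  at most \<open>(cmod z)\<^sup>2 < 1\<close>.\<close>

lemma stp_fixpoint_zero:
  assumes "finite A" "cmod z < 1" "finite X" "\<And>x. x \<notin> X \<Longrightarrow> psi x = 0"
    and "\<And>x. psi x = stp A z om psi x"
  shows "psi x = 0"
proof -
  have fA: "psi x = 0" if "x \<notin> A" for x using assms(5)[of x] that by (simp add: stp_def)
  have "nsq A psi = nsq A (stp A z om psi)" using assms(5) by metis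
  also have "\<dots> \<le> (cmod z)\<^sup>2 * nsq A psi" by (rule nsq_stp[OF assms(1,1)]) (use fA in auto)
  finally have "(1 - (cmod z)\<^sup>2) * nsq A psi \<le> 0" by (simp add: algebra_simps)
  moreover have "1 - (cmod z)\<^sup>2 > 0" using assms(2) by (simp add: abs_square_less_1)
  ultimately have "nsq A psi \<le> 0" by (simp add: mult_le_0_iff)
  then have "(cmod (psi x))\<^sup>2 \<le> 0" if "x \<in> A"
    using cmod_le_nsq[OF assms(1) that, of psi] by linarith
  then show ?thesis using fA[of x] by (cases "x \<in> A") auto
qed

text \<open>This is how the exact formulas below are proved: a candidate assembled from smaller
  networks is identified by checking its fixed point equation.\<close>

lemma res_unique:
  assumes "finite A" "cmod z < 1" "finite X" "\<And>x. x \<notin> X \<Longrightarrow> psi x = 0"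
    and "\<And>x. psi x = e k x + stp A z om psi x"
  shows "psi = res A z om k"
proof
  fix x
  have "psi x - res A z om k x = 0"
  proof (rule stp_fixpoint_zero[OF assms(1,2), where psi = "\<lambda>x. psi x - res A z om k x"
        and X = "X \<union> insert k A" and om = om])
    show "psi x - res A z om k x = 0" if "x \<notin> X \<union> insert k A" for x
      using that assms(4) res_supp by auto
    show "psi x - res A z om k x = stp A z om (\<lambda>x. psi x - res A z om k x) x" for x
      using assms(5)[of x] res_eq[OF assms(1,2), of om k x] by (simp add: stp_diff)
  qed (use assms in auto)
  then show "psi x = res A z om k x" by simp
qed

lemma res_source:
  assumes "finite A" "cmod z < 1" "k \<notin> A"
  shows "res A z om k k = 1"
  using res_eq[OF assms(1,2), of om k k] assms(3) by (simp add: stp_def)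

lemma res_cong:
  assumes "\<And>x. x \<in> A \<Longrightarrow> om x = om' x"
  shows "res A z om k = res A z om' k"
proof -
  have "stp A z om = stp A z om'"
    using assms by (intro ext) (simp add: stp_def)
  then show ?thesis by (simp add: res_def)
qed

text \<open>Schur complement entries: the self-energy that the sites of \<open>A\<close> induce outside \<open>A\<close>.\<close>
definition amp :: "site set \<Rightarrow> complex \<Rightarrow> (site \<Rightarrow> complex) \<Rightarrow> site \<Rightarrow> site \<Rightarrow> complex" where
  "amp A z om mu k = hop a b (res A z om k) mu"

lemma amp_cong:
  assumes "\<And>x. x \<in> A \<Longrightarrow> om x = om' x"
  shows "amp A z om mu k = amp A z om' mu k"
  using res_cong[OF assms] by (simp add: amp_def)

text \<open>Energy balance. On \<open>A\<close> the fixed point equation gives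
  \<open>|res| \<le> |hop res|\<close> at every site, and contractivity on
  \<open>insert mu A\<close> bounds the outgoing energy by that of the source plus that stored in
  \<open>A\<close>. The stored part cancels and the unit energy of the source remains.\<close>

lemma amp_le_1:
  assumes "finite A" "cmod z < 1" "k \<notin> A" "mu \<notin> A"
  shows "cmod (amp A z om mu k) \<le> 1"
proof -
  let ?u = "res A z om k"
  have 1: "(cmod (?u x))\<^sup>2 \<le> (cmod (hop a b ?u x))\<^sup>2" if "x \<in> A" for x
  proof -
    have "?u x = z * unimod (om x) * hop a b ?u x"
      using res_eq[OF assms(1,2), of om k x] that assms(3) e_diff[of x k] by (auto simp: stp_def)
    then have "cmod (?u x) = cmod z * cmod (hop a b ?u x)"
      by (metis cmod_unimod mult.right_neutral norm_mult)
    then have "cmod (?u x) \<le> cmod (hop a b ?u x)"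
      using assms(2) by (simp add: mult_left_le_one_le)
    then show ?thesis by (simp add: power_mono)
  qed
  have "(cmod (amp A z om mu k))\<^sup>2 + nsq A ?u \<le> (cmod (amp A z om mu k))\<^sup>2 + nsq A (hop a b ?u)"
    unfolding nsq_def using 1 by (intro add_left_mono sum_mono) auto
  also have "\<dots> = nsq (insert mu A) (hop a b ?u)"
    using assms by (simp add: nsq_def amp_def)
  also have "\<dots> \<le> nsq (insert k A) ?u"
    using assms res_supp by (intro contractive) auto
  also have "\<dots> = 1 + nsq A ?u"
    using assms by (simp add: nsq_def res_source)
  finally have "(cmod (amp A z om mu k))\<^sup>2 \<le> 1\<^sup>2" by simp
  then show ?thesis by (rule power2_le_imp_le) simp
qed

section \<open>Exact formulas for enlarging the network\<close>

lemma stp_insert: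
  assumes "k \<notin> A"
  shows "stp (insert k A) z om psi x = stp A z om psi x + z * unimod (om k) * hop a b psi k * e k x"
  using assms by (auto simp: stp_def e_def)

lemma one_minus_nonzero:
  assumes "cmod z < 1" "cmod u = 1" "cmod w \<le> 1"
  shows "1 - z * u * w \<noteq> (0::complex)"
proof
  assume "1 - z * u * w = 0"
  then have "cmod (z * u * w) = 1" by simp
  then have "cmod z * cmod w = 1" using assms by (simp add: norm_mult)
  moreover have "cmod z * cmod w \<le> cmod z * 1" using assms by (intro mult_left_mono) auto
  ultimately show False using assms by simp
qed

text \<open>Activating the site \<open>k\<close> creates a loop from \<open>k\<close> to itself with
  weight \<open>z * unimod (om k) * amp A z om k k\<close>; the geometric series over its
  repetitions is the denominator. Neither \<open>res A\<close> nor \<open>amp A\<close> sees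
  \<open>om k\<close>.\<close>

lemma res_insert_source:
  assumes "finite A" "cmod z < 1" "k \<notin> A"
  shows "res (insert k A) z om k x = res A z om k x / (1 - z * unimod (om k) * amp A z om k k)"
proof -
  let ?c = "1 - z * unimod (om k) * amp A z om k k"
  have c: "?c \<noteq> 0" using one_minus_nonzero[OF assms(2)] amp_le_1[OF assms(1,2,3,3)] by simp
  have "(\<lambda>x. inverse ?c * res A z om k x) = res (insert k A) z om k"
  proof (rule res_unique[of "insert k A" z "insert k A"])
    fix x
    have "inverse ?c * res A z om k x = inverse ?c * (e k x + stp A z om (res A z om k) x)"
      using res_eq[OF assms(1,2), of om k x] by simp
    also have "\<dots> = e k x + inverse ?c * (stp A z om (res A z om k) x
          + z * unimod (om k) * hop a b (res A z om k) k * e k x)"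
      using c by (simp add: field_simps amp_def)
    also have "\<dots> = e k x + stp (insert k A) z om (\<lambda>x. inverse ?c * res A z om k x) x"
      using stp_insert[OF assms(3)] by (simp add: stp_cmult)
    finally show "inverse ?c * res A z om k x
        = e k x + stp (insert k A) z om (\<lambda>x. inverse ?c * res A z om k x) x" .
  qed (use assms res_supp in auto)
  from fun_cong[OF this, of x] show ?thesis by (simp add: divide_inverse mult.commute)
qed

text \<open>The numerator is the weight of the first arrival at \<open>m\<close>, of modulus at most
  1; the denominator sums the later loops at \<open>m\<close>.\<close>

lemma res_insert_other:
  assumes "finite A" "cmod z < 1" "k \<notin> A" "m \<notin> A" "m \<noteq> k"
  shows "res (insert m A) z om k m
    = z * unimod (om m) * amp A z om m k / (1 - z * unimod (om m) * amp A z om m m)"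
proof -
  let ?c = "1 - z * unimod (om m) * amp A z om m m"
  let ?d = "z * unimod (om m) * amp A z om m k / ?c"
  have c: "?c \<noteq> 0" using one_minus_nonzero[OF assms(2)] amp_le_1[OF assms(1,2,4,4)] by simp
  \<comment> \<open>Superposition: the wave of \<open>k\<close> in \<open>A\<close> plus a wave
    emitted at \<open>m\<close>, whose strength \<open>?d\<close> is fixed by the equation labelled
    \<open>3\<close>.\<close>
  have "(\<lambda>x. res A z om k x + ?d * res A z om m x) = res (insert m A) z om k"
  proof (rule res_unique[of "insert m A" z "insert k (insert m A)"])
    fix x
    have 1: "res A z om k x = e k x + stp A z om (res A z om k) x"
      "res A z om m x = e m x + stp A z om (res A z om m) x"
      using res_eq[OF assms(1,2)] by auto
    have 2: "hop a b (\<lambda>x. res A z om k x + ?d * res A z om m x) m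
        = amp A z om m k + ?d * amp A z om m m"
      unfolding amp_def by (rule hop_lin)
    have 3: "z * unimod (om m) * (amp A z om m k + ?d * amp A z om m m) = ?d"
      using c by (simp add: field_simps del: mult_eq_0_iff)
    show "res A z om k x + ?d * res A z om m x
        = e k x + stp (insert m A) z om (\<lambda>x. res A z om k x + ?d * res A z om m x) x"
      unfolding stp_insert[OF assms(4)] 2 3 unfolding stp_add stp_cmult
      by (subst 1(1), subst 1(2)) (simp only: distrib_left add_ac)
  qed (use assms res_supp in auto)
  then have "res (insert m A) z om k m = res A z om k m + ?d * res A z om m m"
    by (rule fun_cong[OF sym])
  moreover have "res A z om k m = 0" using assms by (intro res_supp) auto
  ultimately show ?thesis using res_source[OF assms(1,2,4)] by simp
qed

text \<open>Resolvent identity: run in \<open>C\<close> alone until a site \<open>j\<close> of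
  \<open>B\<close> is first entered, then restart at \<open>j\<close> in the full network.\<close>

lemma res_union:
  assumes "finite C" "finite B" "cmod z < 1" "C \<inter> B = {}"
  shows "res (C \<union> B) z om k x = res C z om k x
    + (\<Sum>j\<in>B. z * unimod (om j) * hop a b (res C z om k) j * res (C \<union> B) z om j x)"
proof -
  let ?g = "\<lambda>j. z * unimod (om j) * hop a b (res C z om k) j"
  let ?A = "C \<union> B"
  have fA: "finite ?A" using assms by simp
  have "(\<lambda>x. res C z om k x + (\<Sum>j\<in>B. ?g j * res ?A z om j x)) = res ?A z om k"
  proof (rule res_unique[of ?A z "insert k ?A"])
    fix x
    have 1: "stp ?A z om (res C z om k) x = stp C z om (res C z om k) x + (\<Sum>j\<in>B. ?g j * e j x)"
      using assms by (auto simp: stp_def e_def if_distrib[of "\<lambda>u. _ * u"] cong: if_cong)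
    have 2: "(\<Sum>j\<in>B. ?g j * res ?A z om j x)
      = (\<Sum>j\<in>B. ?g j * e j x) + stp ?A z om (\<lambda>x. \<Sum>j\<in>B. ?g j * res ?A z om j x) x"
      by (subst res_eq[OF fA assms(3)])
         (simp add: stp_sum stp_cmult sum.distrib distrib_left)
    show "res C z om k x + (\<Sum>j\<in>B. ?g j * res ?A z om j x) =
      e k x + stp ?A z om (\<lambda>x. res C z om k x + (\<Sum>j\<in>B. ?g j * res ?A z om j x)) x"
      unfolding stp_add 1
      using 2 res_eq[OF assms(1,3), of om k x] by simp
  next
    fix x assume x: "x \<notin> insert k ?A"
    have "res ?A z om j x = 0" if "j \<in> B" for j
      using that x by (intro res_supp) auto
    moreover have "res C z om k x = 0" using x by (intro res_supp) auto
    ultimately show "res C z om k x + (\<Sum>j\<in>B. ?g j * res ?A z om j x) = 0" by simp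
  qed (use assms in auto)
  then show ?thesis by (rule fun_cong[OF sym])
qed

end

section \<open>Random phases\<close>

lemma sets_circle_measure [measurable_cong, simp]: "sets circle_measure = sets borel"
  by (simp add: circle_measure_def)

lemma space_circle_measure [simp]: "space circle_measure = UNIV"
  by (simp add: circle_measure_def)

lemma measurable_cis [measurable]: "cis \<in> borel_measurable borel"
  by (intro borel_measurable_continuous_onI continuous_intros)

lemma prob_space_circle_measure: "prob_space circle_measure"
proof -
  show ?thesis
    unfolding circle_measure_def
    by (intro prob_space.prob_space_distr prob_space_uniform_measure) auto
qed

lemma nn_integral_circle_measure:
  assumes [measurable]: "f \<in> borel_measurable borel"
  shows "(\<integral>\<^sup>+ u. f u \<partial>circle_measure)
    = (\<integral>\<^sup>+ t. f (cis t) * indicator {0..<2*pi} t \<partial>lborel) / ennreal (2 * pi)"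
proof -
  show ?thesis
    unfolding circle_measure_def
    by (subst nn_integral_distr) (simp_all add: nn_integral_uniform_measure)
qed

lemma space_Prob [simp]: "space Prob = UNIV"
  by (simp add: Prob_def space_PiM)

lemma prob_space_Prob: "prob_space Prob"
  unfolding Prob_def by (intro prob_space_PiM prob_space_circle_measure)

lemma measurable_Prob_component: "(\<lambda>om. om x) \<in> borel_measurable Prob"
proof -
  have "(\<lambda>om. om x) \<in> measurable Prob circle_measure"
    unfolding Prob_def by (rule measurable_component_singleton) simp
  then show ?thesis by (simp cong: measurable_cong_sets)
qed

lemma measurable_Prob_upd [measurable]:
  "(\<lambda>(u, om). om(k := u)) \<in> measurable (circle_measure \<Otimes>\<^sub>M Prob) Prob"
proof -
  have "(\<lambda>x. (snd x)(k := fst x)) \<in> measurable (circle_measure \<Otimes>\<^sub>M Prob) (PiM UNIV (\<lambda>_. circle_measure))"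
    unfolding Prob_def by (rule measurable_fun_upd[where J = UNIV]) auto
  then show ?thesis by (simp add: Prob_def case_prod_beta')
qed

text \<open>The product structure in the form used below: resampling one phase preserves
  \<open>Prob\<close>, so the phase \<open>om k\<close> may be integrated first.\<close>

lemma nn_integral_Prob_upd:
  assumes [measurable]: "F \<in> borel_measurable Prob"
  shows "(\<integral>\<^sup>+ om. F om \<partial>Prob) = (\<integral>\<^sup>+ om. (\<integral>\<^sup>+ u. F (om(k := u)) \<partial>circle_measure) \<partial>Prob)"
proof -
  interpret C: prob_space circle_measure by (rule prob_space_circle_measure)
  interpret P: prob_space Prob by (rule prob_space_Prob)
  interpret pair_sigma_finite circle_measure Prob ..
  have d: "distr (circle_measure \<Otimes>\<^sub>M Prob) Prob (\<lambda>(u, om). om(k := u)) = Prob"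
    using distr_pair_PiM_eq_PiM[of UNIV "\<lambda>_. circle_measure" k] prob_space_circle_measure
    by (simp add: Prob_def)
  have "(\<integral>\<^sup>+ om. F om \<partial>Prob) = (\<integral>\<^sup>+ om. F om \<partial>distr (circle_measure \<Otimes>\<^sub>M Prob) Prob (\<lambda>(u, om). om(k := u)))"
    by (simp add: d)
  also have "\<dots> = (\<integral>\<^sup>+ x. F ((snd x)(k := fst x)) \<partial>(circle_measure \<Otimes>\<^sub>M Prob))"
    by (subst nn_integral_distr) (auto simp: case_prod_beta')
  also have "\<dots> = (\<integral>\<^sup>+ om. (\<integral>\<^sup>+ u. F (om(k := u)) \<partial>circle_measure) \<partial>Prob)"
    using nn_integral_snd[of "\<lambda>x. F ((snd x)(k := fst x))"]
    by (simp add: case_prod_beta')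
  finally show ?thesis .
qed

lemma AE_Prob_unit: "AE om in Prob. \<forall>x. cmod (om x) = 1"
proof -
  have "AE u in circle_measure. cmod u = 1"
    unfolding circle_measure_def by (subst AE_distr_iff) auto
  then have "AE om in Prob. cmod (om x) = 1" for x
    unfolding Prob_def by (intro AE_PiM_component prob_space_circle_measure) auto
  then show ?thesis by (simp add: AE_all_countable)
qed

lemma unimod_measurable [measurable]: "unimod \<in> borel_measurable borel"
  unfolding unimod_def by measurable

lemma AE_circle_unimod: "AE u in circle_measure. unimod u = u"
  unfolding circle_measure_def by (subst AE_distr_iff) auto

section \<open>Inverse square roots of poles, integrated over the circle\<close>

lemma abs_sin_ge:
  fixes x :: real
  assumes "\<bar>x\<bar> \<le> pi / 2"
  shows "\<bar>x\<bar> / 2 \<le> \<bar>sin x\<bar>"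
proof -
  have "\<bar>sin x - (\<Sum>m<3. sin_coeff m * x ^ m)\<bar> \<le> inverse (fact 3) * \<bar>x\<bar> ^ 3"
    by (rule Maclaurin_sin_bound)
  moreover have "(\<Sum>m<3. sin_coeff m * x ^ m) = x"
    by (simp add: sin_coeff_def eval_nat_numeral)
  moreover have "inverse (fact 3) * \<bar>x\<bar> ^ 3 \<le> \<bar>x\<bar> / 2"
  proof -
    \<comment> \<open>A rational bound for \<open>pi / 2\<close> whose square is below 3, as needed
      to compare the cubic remainder with \<open>|x| / 2\<close>.\<close>
    have "\<bar>x\<bar> \<le> 8/5" using assms pi_approx by (simp add: field_simps)
    then have "\<bar>x\<bar> * \<bar>x\<bar> \<le> (8/5) * (8/5)" by (intro mult_mono) auto
    then have "\<bar>x\<bar> * \<bar>x\<bar> \<le> 3" by simp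
    then have "\<bar>x\<bar> * \<bar>x\<bar> * \<bar>x\<bar> \<le> 3 * \<bar>x\<bar>" by (rule mult_right_mono) simp
    then show ?thesis by (simp add: fact_numeral power3_eq_cube)
  qed
  ultimately show ?thesis by linarith
qed

text \<open>\<open>cis t * b\<close> lies on the line through 0 with direction
  \<open>t + alpha\<close>, and \<open>|sin (t + alpha)|\<close> is the distance of 1 from this
  line. The bound is therefore uniform in \<open>rho\<close>.\<close>

lemma cmod_one_minus_ge_sin:
  assumes "b = complex_of_real rho * cis alpha"
  shows "\<bar>sin (t + alpha)\<bar> \<le> cmod (1 - cis t * b)"
proof -
  have "Re (cis t * b) = rho * cos (t + alpha)" "Im (cis t * b) = rho * sin (t + alpha)"
    by (simp_all add: assms cos_add sin_add algebra_simps)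
  then have "(cmod (1 - cis t * b))\<^sup>2 = (1 - rho * cos (t + alpha))\<^sup>2 + (rho * sin (t + alpha))\<^sup>2"
    by (simp add: cmod_power2)
  also have "\<dots> = 1 - 2 * rho * cos (t + alpha) + rho\<^sup>2 * ((sin (t + alpha))\<^sup>2 + (cos (t + alpha))\<^sup>2)"
    by algebra
  also have "\<dots> = 1 - 2 * rho * cos (t + alpha) + rho\<^sup>2" by simp
  also have "\<dots> = (rho - cos (t + alpha))\<^sup>2 + (sin (t + alpha))\<^sup>2"
    by (simp add: sin_squared_eq power2_diff)
  finally have "(sin (t + alpha))\<^sup>2 \<le> (cmod (1 - cis t * b))\<^sup>2" by simp
  then show ?thesis by (metis abs_le_square_iff abs_norm_cancel)
qed

text \<open>Translates of this function majorize the poles at the zeros of the sine. The cutoff 2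
  exceeds \<open>pi / 2\<close>, the largest distance to the nearest zero.\<close>

definition sing :: "real \<Rightarrow> ennreal" where
  "sing u = ennreal (\<bar>u\<bar> powr (-1/2)) * indicator {-2..2} u"

lemma sing_measurable [measurable]: "sing \<in> borel_measurable borel"
  unfolding sing_def by measurable

lemma nn_integral_sing_le: "(\<integral>\<^sup>+ u. sing u \<partial>lborel) \<le> ennreal 8"
proof -
  define h where "h = (\<lambda>u::real. ennreal (u powr (-1/2)) * indicator {0..2} u)"
  have [measurable]: "h \<in> borel_measurable borel" unfolding h_def by measurable
  have "((\<lambda>x. x powr (-1/2)) has_integral (2 powr (-1/2+1) / (-1/2+1))) {0..2::real}"
    by (rule has_integral_powr_from_0) auto
  then have "((\<lambda>x. if x \<in> {0..2} then x powr (-1/2) else 0) has_integral (2 powr (1/2) * 2)) (UNIV::real set)"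
    unfolding has_integral_restrict_UNIV by simp
  then have "(\<integral>\<^sup>+ u. ennreal (if u \<in> {0..2} then u powr (-1/2) else 0) \<partial>lborel) = ennreal (2 powr (1/2) * 2)"
    by (intro nn_integral_has_integral_lborel) auto
  moreover have "(\<lambda>u. ennreal (if u \<in> {0..2} then u powr (-1/2) else 0)) = h"
    by (auto simp: h_def indicator_def)
  ultimately have h1: "(\<integral>\<^sup>+ u. h u \<partial>lborel) = ennreal (2 powr (1/2) * 2)" by simp
  have h2: "(\<integral>\<^sup>+ u. h (- u) \<partial>lborel) = (\<integral>\<^sup>+ u. h u \<partial>lborel)"
    using nn_integral_real_affine[of h "-1" 0] by simp
  have "(\<integral>\<^sup>+ u. sing u \<partial>lborel) \<le> (\<integral>\<^sup>+ u. h u + h (- u) \<partial>lborel)"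
    by (intro nn_integral_mono) (auto simp: sing_def h_def indicator_def)
  also have "\<dots> = ennreal (2 powr (1/2) * 2) + ennreal (2 powr (1/2) * 2)"
    by (simp add: nn_integral_add h1 h2)
  also have "\<dots> = ennreal (4 * sqrt 2)"
    by (simp add: powr_half_sqrt flip: ennreal_plus)
  also have "\<dots> \<le> ennreal 8"
    by (intro ennreal_leI) (simp add: real_le_lsqrt)
  finally show ?thesis .
qed

text \<open>Only the multiple of \<open>pi\<close> nearest to \<open>t + alpha\<close> matters; as
  \<open>t + alpha\<close> lies between \<open>- pi\<close> and \<open>3 * pi\<close>, the five
  values of \<open>k\<close> cover all cases. Assumption \<open>nz\<close> excludes the points where
  \<open>powr\<close> has its default value 0 instead of a singularity.\<close>

lemma inverse_sqrt_le_sing: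
  assumes t: "t \<in> {0..<2*pi}" and al: "- pi < alpha" "alpha \<le> pi"
    and b: "b = complex_of_real rho * cis alpha"
    and nz: "\<forall>k\<in>{-1..3::int}. t + alpha - real_of_int k * pi \<noteq> 0"
  shows "ennreal (1 / sqrt (cmod (1 - cis t * b)))
    \<le> 2 * (\<Sum>k\<in>{-1..3::int}. sing (t + alpha - real_of_int k * pi))"
proof -
  define k where "k = round ((t + alpha) / pi)"
  define x where "x = t + alpha - real_of_int k * pi"
  have r: "\<bar>real_of_int k - (t + alpha) / pi\<bar> \<le> 1 / 2"
    unfolding k_def by (rule of_int_round_abs_le)
  have xb: "\<bar>x\<bar> \<le> pi / 2"
  proof -
    have "x = - (pi * (real_of_int k - (t + alpha) / pi))"
      by (simp add: x_def field_simps)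
    then have "\<bar>x\<bar> = pi * \<bar>real_of_int k - (t + alpha) / pi\<bar>"
      by (simp add: abs_mult)
    also have "\<dots> \<le> pi * (1 / 2)" using r by (intro mult_left_mono) auto
    finally show ?thesis by simp
  qed
  have "- pi < t + alpha" "t + alpha < 3 * pi" using t al by auto
  then have "-1 < (t + alpha) / pi" "(t + alpha) / pi < 3"
    by (simp_all add: field_simps)
  then have "real_of_int k > -2" "real_of_int k < 4" using r by linarith+
  then have kk: "k \<in> {-1..3}" by simp
  have x0: "x \<noteq> 0" using nz kk by (simp add: x_def)
  have "\<bar>sin x\<bar> = \<bar>sin (t + alpha)\<bar>"
  proof -
    have "sin x = sin (t + alpha) * cos (of_int k * pi) - cos (t + alpha) * sin (of_int k * pi)"
      by (simp add: x_def sin_diff)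
    moreover have "sin (real_of_int k * pi) = 0" by (simp add: sin_zero_iff_int2) 
    moreover have "\<bar>cos (real_of_int k * pi)\<bar> = 1"
      using \<open>sin (real_of_int k * pi) = 0\<close> sin_cos_squared_add[of "real_of_int k * pi"]
      by (simp add: abs_square_eq_1)
    ultimately show ?thesis by (simp add: abs_mult)
  qed
  then have ge: "\<bar>x\<bar> / 2 \<le> cmod (1 - cis t * b)"
    using abs_sin_ge[OF xb] cmod_one_minus_ge_sin[OF b, of t] by linarith
  have "1 / sqrt (cmod (1 - cis t * b)) \<le> 1 / sqrt (\<bar>x\<bar> / 2)"
    using ge x0 by (intro divide_left_mono mult_pos_pos real_sqrt_le_mono) auto
  also have "\<dots> = sqrt 2 * \<bar>x\<bar> powr (-1/2)"
    using x0 by (simp add: real_sqrt_divide powr_minus powr_half_sqrt field_simps)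
  also have "\<dots> \<le> 2 * \<bar>x\<bar> powr (-1/2)"
    by (intro mult_right_mono) (auto simp: real_le_lsqrt)
  finally have "ennreal (1 / sqrt (cmod (1 - cis t * b))) \<le> ennreal (2 * \<bar>x\<bar> powr (-1/2))"
    by (rule ennreal_leI)
  also have "\<dots> = 2 * sing x"
  proof -
    have "\<bar>x\<bar> \<le> 2" using xb pi_less_4 by linarith
    then have "x \<in> {-2..2}" by auto
    then show ?thesis by (simp add: sing_def ennreal_mult)
  qed
  also have "\<dots> \<le> 2 * (\<Sum>k\<in>{-1..3::int}. sing (t + alpha - real_of_int k * pi))"
    unfolding x_def using kk by (intro mult_left_mono member_le_sum) auto
  finally show ?thesis .
qed

lemma circle_inverse_sqrt:
  "\<exists>C\<ge>1. \<forall>b. cmod b \<le> 1 \<longrightarrow>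
    (\<integral>\<^sup>+ u. ennreal (1 / sqrt (cmod (1 - u * b))) \<partial>circle_measure) \<le> ennreal C"
\<comment> \<open>\<open>80 = 2 * 5 * 8\<close>: prefactor, number of translates, bound for the
  integral of \<open>sing\<close>.\<close>
proof (intro exI[of _ 80] conjI allI impI)
  fix b :: complex
  define alpha where "alpha = Arg b"
  have al: "- pi < alpha" "alpha \<le> pi" unfolding alpha_def using Arg_bounded by auto
  have b: "b = complex_of_real (cmod b) * cis alpha"
    unfolding alpha_def by (cases "b = 0") (auto simp: cis_Arg sgn_eq)
  have nz: "AE t in lborel. \<forall>k\<in>{-1..3::int}. t + alpha - real_of_int k * pi \<noteq> 0"
  proof (subst AE_ball_countable)
    show "\<forall>k\<in>{-1..3::int}. AE t in lborel. t + alpha - real_of_int k * pi \<noteq> 0"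
    proof
      fix k :: int
      have "AE t in lborel. t \<noteq> real_of_int k * pi - alpha"
        by (rule AE_lborel_singleton)
      then show "AE t in lborel. t + alpha - real_of_int k * pi \<noteq> 0"
        by eventually_elim auto
    qed
  qed auto
  have s: "(\<integral>\<^sup>+ t. sing (t + c) \<partial>lborel) \<le> 8" for c
    using nn_integral_real_affine[of sing 1 c] nn_integral_sing_le by (simp add: add.commute)
  have "(\<integral>\<^sup>+ t. ennreal (1 / sqrt (cmod (1 - cis t * b))) * indicator {0..<2*pi} t \<partial>lborel)
    \<le> (\<integral>\<^sup>+ t. 2 * (\<Sum>k\<in>{-1..3::int}. sing (t + (alpha - real_of_int k * pi))) \<partial>lborel)"
  proof (rule nn_integral_mono_AE)
    show "AE t in lborel. ennreal (1 / sqrt (cmod (1 - cis t * b))) * indicator {0..<2*pi} t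
      \<le> 2 * (\<Sum>k\<in>{-1..3::int}. sing (t + (alpha - real_of_int k * pi)))"
      using nz
    proof eventually_elim
      case (elim t)
      show ?case
        using inverse_sqrt_le_sing[OF _ al b elim] by (cases "t \<in> {0..<2*pi}") (simp_all add: add_diff_eq)
    qed
  qed
  also have "\<dots> = 2 * (\<Sum>k\<in>{-1..3::int}. (\<integral>\<^sup>+ t. sing (t + (alpha - real_of_int k * pi)) \<partial>lborel))"
    by (subst nn_integral_cmult) (auto simp: nn_integral_sum)
  also have "\<dots> \<le> 2 * (\<Sum>k\<in>{-1..3::int}. 8)"
    by (intro mult_left_mono sum_mono s) auto
  also have "\<dots> = ennreal 80" by simp
  finally have *: "(\<integral>\<^sup>+ t. ennreal (1 / sqrt (cmod (1 - cis t * b))) * indicator {0..<2*pi} t \<partial>lborel) \<le> ennreal 80" .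
  have "(\<integral>\<^sup>+ u. ennreal (1 / sqrt (cmod (1 - u * b))) \<partial>circle_measure)
     \<le> ennreal 80 / ennreal (2 * pi)"
    by (subst nn_integral_circle_measure) (use * in \<open>auto intro: divide_right_mono_ennreal\<close>)
  also have "\<dots> = ennreal (80 / (2 * pi))" by (rule divide_ennreal) auto
  also have "\<dots> \<le> ennreal 80"
    using pi_ge_two by (intro ennreal_leI) (simp add: field_simps)
  finally show "(\<integral>\<^sup>+ u. ennreal (1 / sqrt (cmod (1 - u * b))) \<partial>circle_measure) \<le> ennreal 80" .
qed auto

section \<open>Fractional moments\<close>

context scattering
begin

lemma stp_pow_Suc:
  "(stp A z om ^^ Suc n) f x = (if x \<in> A then z * unimod (om x) * (a x * (stp A z om ^^ n) f (ccw_pred x)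
      + b x * (stp A z om ^^ n) f (cw_pred x)) else 0)"
  by (simp only: funpow.simps comp_apply stp_def[of A z om "(stp A z om ^^ n) f"] hop_def)

lemma measurable_stp_pow:
  assumes zf: "zf \<in> borel_measurable N" and omf: "\<And>x. (\<lambda>y. omf y x) \<in> borel_measurable N"
  shows "(\<lambda>y. (stp A (zf y) (omf y) ^^ n) (e k) x) \<in> borel_measurable N"
proof (induction n arbitrary: x)
  case (Suc n)
  have "(\<lambda>y. zf y * unimod (omf y x) * (a x * (stp A (zf y) (omf y) ^^ n) (e k) (ccw_pred x)
      + b x * (stp A (zf y) (omf y) ^^ n) (e k) (cw_pred x))) \<in> borel_measurable N"
    by (intro borel_measurable_times borel_measurable_add borel_measurable_const zf
        measurable_compose[OF omf unimod_measurable] Suc)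
  then show ?case
    by (cases "x \<in> A") (simp_all only: stp_pow_Suc if_True if_False borel_measurable_const)
qed simp

lemma measurable_res:
  assumes "zf \<in> borel_measurable N" "\<And>x. (\<lambda>y. omf y x) \<in> borel_measurable N"
  shows "(\<lambda>y. res A (zf y) (omf y) k x) \<in> borel_measurable N"
  unfolding res_def by (intro borel_measurable_suminf measurable_stp_pow assms)

lemma measurable_res_Prob: "(\<lambda>om. res A z om k x) \<in> borel_measurable Prob"
  by (rule measurable_res) (auto intro: measurable_Prob_component)

lemma measurable_amp_Prob: "(\<lambda>om. amp A z om k x) \<in> borel_measurable Prob"
  unfolding amp_def hop_def
  by (intro borel_measurable_times borel_measurable_add borel_measurable_const measurable_res_Prob)

text \<open>Integrate over \<open>om k\<close> first: neither \<open>amp A\<close> nor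
  \<open>h\<close> depends on it. The factor \<open>h\<close> carries whatever is to be integrated
  afterwards.\<close>

lemma nn_integral_pole:
  assumes C: "\<And>b. cmod b \<le> 1 \<Longrightarrow>
      (\<integral>\<^sup>+ u. ennreal (1 / sqrt (cmod (1 - u * b))) \<partial>circle_measure) \<le> ennreal C"
    and A: "finite A" "cmod z < 1" "k \<notin> A"
    and [measurable]: "h \<in> borel_measurable Prob" and h: "\<And>om u. h (om(k := u)) = h om"
  shows "(\<integral>\<^sup>+ om. ennreal (1 / sqrt (cmod (1 - z * unimod (om k) * amp A z om k k))) * h om \<partial>Prob)
    \<le> ennreal C * (\<integral>\<^sup>+ om. h om \<partial>Prob)"
proof -
  have m: "(\<lambda>om. ennreal (1 / sqrt (cmod (1 - z * unimod (om k) * amp A z om k k))) * h om) \<in> borel_measurable Prob"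
    using measurable_amp_Prob[of A z k k, measurable] measurable_Prob_component[of k, measurable] by measurable
  have [measurable]: "(\<lambda>u. ennreal (1 / sqrt (cmod (1 - u * b)))) \<in> borel_measurable borel" for b
    by measurable
  have am: "amp A z (om(k := u)) k k = amp A z om k k" for om u
    using A(3) by (intro amp_cong) auto
  have "(\<integral>\<^sup>+ u. ennreal (1 / sqrt (cmod (1 - z * unimod u * amp A z om k k))) \<partial>circle_measure) \<le> ennreal C" for om
  proof -
    have "(\<integral>\<^sup>+ u. ennreal (1 / sqrt (cmod (1 - z * unimod u * amp A z om k k))) \<partial>circle_measure)
      = (\<integral>\<^sup>+ u. ennreal (1 / sqrt (cmod (1 - u * (z * amp A z om k k)))) \<partial>circle_measure)"
      by (rule nn_integral_cong_AE) (use AE_circle_unimod in eventually_elim, simp add: ac_simps)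
    also have "\<dots> \<le> ennreal C"
      using amp_le_1[OF A A(3)] A(2)
      by (intro C) (simp add: norm_mult mult_le_one)
    finally show ?thesis .
  qed
  then have "(\<integral>\<^sup>+ om. (\<integral>\<^sup>+ u. ennreal (1 / sqrt (cmod (1 - z * unimod u * amp A z om k k))) \<partial>circle_measure) * h om \<partial>Prob)
    \<le> (\<integral>\<^sup>+ om. ennreal C * h om \<partial>Prob)"
    by (intro nn_integral_mono mult_right_mono) auto
  moreover have "(\<integral>\<^sup>+ u. ennreal (1 / sqrt (cmod (1 - z * unimod u * w))) * c \<partial>circle_measure)
    = (\<integral>\<^sup>+ u. ennreal (1 / sqrt (cmod (1 - z * unimod u * w))) \<partial>circle_measure) * c" for w c
    by (rule nn_integral_multc) measurable
  ultimately show ?thesis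
    by (subst nn_integral_Prob_upd[OF m, of k]) (simp add: am h nn_integral_cmult)
qed

text \<open>A source outside \<open>A\<close> has no loop, so the only pole to integrate is the one
  in \<open>om m\<close>.\<close>

lemma nn_integral_res_outside:
  assumes C: "C \<ge> 1" "\<And>b. cmod b \<le> 1 \<Longrightarrow>
      (\<integral>\<^sup>+ u. ennreal (1 / sqrt (cmod (1 - u * b))) \<partial>circle_measure) \<le> ennreal C"
    and A: "finite A" "cmod z < 1" "k \<notin> A"
    and [measurable]: "h \<in> borel_measurable Prob" and h: "\<And>om u. h (om(m := u)) = h om"
  shows "(\<integral>\<^sup>+ om. ennreal (sqrt (cmod (res A z om k m))) * h om \<partial>Prob)
    \<le> ennreal C * (\<integral>\<^sup>+ om. h om \<partial>Prob)"
proof -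
  \<comment> \<open>Needed for \<open>m = k\<close>, where the entry equals 1 and no pole occurs;
    the factor \<open>C \<ge> 1\<close> absorbs it.\<close>
  have C1: "(\<integral>\<^sup>+ om. h om \<partial>Prob) \<le> ennreal C * (\<integral>\<^sup>+ om. h om \<partial>Prob)"
    using C(1) mult_right_mono[of 1 "ennreal C" "\<integral>\<^sup>+ om. h om \<partial>Prob"] ennreal_leI[of 1 C] by simp
  consider "m = k" | "m \<notin> insert k A" | "m \<noteq> k" "m \<in> A" by auto
  then show ?thesis
  proof cases
    case 1
    then show ?thesis using res_source[OF A] C1 by simp
  next
    case 2
    then show ?thesis by (simp add: res_supp)
  next
    case 3
    define A' where "A' = A - {m}"
    have A': "finite A'" "m \<notin> A'" "k \<notin> A'" "A = insert m A'" using A 3 by (auto simp: A'_def)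
    have b: "sqrt (cmod (res A z om k m))
      \<le> 1 / sqrt (cmod (1 - z * unimod (om m) * amp A' z om m m))" for om
    proof -
      have "cmod (z * unimod (om m) * amp A' z om m k) \<le> 1"
        using amp_le_1[OF A'(1) A(2) A'(3,2)] A(2) by (simp add: norm_mult mult_le_one)
      then have "cmod (res A z om k m) \<le> 1 / cmod (1 - z * unimod (om m) * amp A' z om m m)"
        unfolding A'(4) using res_insert_other[OF A'(1) A(2) A'(3,2) 3(1)]
        by (simp add: norm_divide divide_right_mono)
      from real_sqrt_le_mono[OF this] show ?thesis by (simp add: real_sqrt_divide)
    qed
    have "(\<integral>\<^sup>+ om. ennreal (sqrt (cmod (res A z om k m))) * h om \<partial>Prob)
      \<le> (\<integral>\<^sup>+ om. ennreal (1 / sqrt (cmod (1 - z * unimod (om m) * amp A' z om m m))) * h om \<partial>Prob)"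
      using b by (intro nn_integral_mono mult_right_mono ennreal_leI) auto
    also have "\<dots> \<le> ennreal C * (\<integral>\<^sup>+ om. h om \<partial>Prob)"
      using C(2) A'(1) A(2) A'(2) h by (intro nn_integral_pole) auto
    finally show ?thesis .
  qed
qed

text \<open>The phase of the source contributes a factor with a pole in \<open>om k\<close>, and
  what remains has its source outside the network. Each of the two integrations costs
  \<open>C\<close>, and \<open>h\<close> has to be independent of both endpoint phases.\<close>

lemma nn_integral_res:
  assumes C: "C \<ge> 1" "\<And>b. cmod b \<le> 1 \<Longrightarrow>
      (\<integral>\<^sup>+ u. ennreal (1 / sqrt (cmod (1 - u * b))) \<partial>circle_measure) \<le> ennreal C"
    and A: "finite A" "cmod z < 1"
    and [measurable]: "h \<in> borel_measurable Prob"
    and h: "\<And>om u. h (om(m := u)) = h om" "\<And>om u. h (om(k := u)) = h om"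
  shows "(\<integral>\<^sup>+ om. ennreal (sqrt (cmod (res A z om k m))) * h om \<partial>Prob)
    \<le> ennreal (C\<^sup>2) * (\<integral>\<^sup>+ om. h om \<partial>Prob)"
proof -
  define A' where "A' = A - {k}"
  have A': "finite A'" "k \<notin> A'" using A by (auto simp: A'_def)
  have C2: "ennreal (C\<^sup>2) = ennreal C * ennreal C"
    using C(1) by (simp add: power2_eq_square ennreal_mult)
  note out = nn_integral_res_outside[OF C A'(1) A(2) A'(2) assms(5) h(1)]
  show ?thesis
  proof (cases "k \<in> A")
    case True
    then have AA: "A = insert k A'" by (auto simp: A'_def)
    have r: "res A' z (om(k := u)) k m = res A' z om k m" for om u
      using A'(2) by (intro fun_cong[OF res_cong]) auto
    note [measurable] = measurable_res_Prob[of A' z k m]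
    have "(\<integral>\<^sup>+ om. ennreal (sqrt (cmod (res A z om k m))) * h om \<partial>Prob)
       = (\<integral>\<^sup>+ om. ennreal (1 / sqrt (cmod (1 - z * unimod (om k) * amp A' z om k k)))
            * (ennreal (sqrt (cmod (res A' z om k m))) * h om) \<partial>Prob)"
    proof (intro nn_integral_cong)
      fix om
      have "sqrt (cmod (res A z om k m)) = 1 / sqrt (cmod (1 - z * unimod (om k) * amp A' z om k k))
          * sqrt (cmod (res A' z om k m))"
        unfolding AA res_insert_source[OF A'(1) A(2) A'(2)] by (simp add: norm_divide real_sqrt_divide)
      moreover have "ennreal (p * q) = ennreal p * ennreal q" if "0 \<le> p" "0 \<le> q" for p q
        using that by (rule ennreal_mult)
      ultimately show "ennreal (sqrt (cmod (res A z om k m))) * h om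
        = ennreal (1 / sqrt (cmod (1 - z * unimod (om k) * amp A' z om k k)))
            * (ennreal (sqrt (cmod (res A' z om k m))) * h om)"
        by (simp only: mult.assoc) (simp only: mult.assoc[symmetric] real_sqrt_ge_0_iff norm_ge_zero zero_le_divide_1_iff)
    qed
    also have "\<dots> \<le> ennreal C * (\<integral>\<^sup>+ om. ennreal (sqrt (cmod (res A' z om k m))) * h om \<partial>Prob)"
      using C(2) A' A(2) h(2) r by (intro nn_integral_pole) auto
    also have "\<dots> \<le> ennreal C * (ennreal C * (\<integral>\<^sup>+ om. h om \<partial>Prob))"
      by (intro mult_left_mono out) auto
    finally show ?thesis by (simp add: C2 mult.assoc)
  next
    case False
    then have "A' = A" by (auto simp: A'_def)
    have "(\<integral>\<^sup>+ om. ennreal (sqrt (cmod (res A z om k m))) * h om \<partial>Prob) \<le> 1 * (ennreal C * (\<integral>\<^sup>+ om. h om \<partial>Prob))"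
      using out unfolding \<open>A' = A\<close> by simp
    also have "\<dots> \<le> ennreal C * (ennreal C * (\<integral>\<^sup>+ om. h om \<partial>Prob))"
      using ennreal_leI[OF C(1)] by (intro mult_right_mono) auto
    finally show ?thesis by (simp add: C2 mult.assoc)
  qed
qed

end

section \<open>Plaquettes and exponential decay of half moments\<close>

definition block :: "site \<Rightarrow> site set" where
  "block mu = {2 * (fst mu div 2)..2 * (fst mu div 2) + 1} \<times> {2 * (snd mu div 2)..2 * (snd mu div 2) + 1}"

definition ldist :: "site \<Rightarrow> site \<Rightarrow> nat" where
  "ldist mu nu = nat (\<bar>fst mu - fst nu\<bar> + \<bar>snd mu - snd nu\<bar>)"

lemma finite_block [simp]: "finite (block mu)"
  by (simp add: block_def)

lemma card_block: "card (block mu) = 4"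
  by (simp add: block_def card_cartesian_product)

lemma block_self: "mu \<in> block mu"
proof -
  have "2 * (i div 2) \<le> i \<and> i \<le> 2 * (i div 2) + 1" for i :: int by presburger
  then show ?thesis by (cases mu) (simp add: block_def)
qed

text \<open>Counterclockwise hops never leave a plaquette, so different plaquettes communicate only
  through the coefficient \<open>b\<close>.\<close>

lemma ccw_pred_block: "j \<in> block mu \<Longrightarrow> ccw_pred j \<in> block mu"
proof -
  assume j: "j \<in> block mu"
  obtain x y where xy: "j = (x, y)" by (cases j)
  define X Y where "X = fst mu div 2" "Y = snd mu div 2"
  have "x = 2 * X \<or> x = 2 * X + 1" "y = 2 * Y \<or> y = 2 * Y + 1"
    using j by (auto simp: block_def xy X_Y_def)
  then show ?thesis by (auto simp: block_def xy ccw_pred_def X_Y_def)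
qed

lemma ldist_block: "j \<in> block mu \<Longrightarrow> ldist mu j \<le> 2"
proof -
  assume j: "j \<in> block mu"
  have "\<bar>i - x\<bar> \<le> 1" if "2 * (i div 2) \<le> x" "x \<le> 2 * (i div 2) + 1" for i x :: int
    using that by presburger
  then have "\<bar>fst mu - fst j\<bar> \<le> 1" "\<bar>snd mu - snd j\<bar> \<le> 1"
    using j by (auto simp: block_def)
  then show ?thesis by (simp add: ldist_def)
qed

lemma ldist_cw_pred: "ldist j (cw_pred j) = 1"
  by (cases j) (simp add: ldist_def cw_pred_def)

lemma ldist_triangle: "ldist x z \<le> ldist x y + ldist y z"
  by (simp add: ldist_def)

lemma sqrt_sum_le:
  assumes "finite I" "\<And>i. i \<in> I \<Longrightarrow> 0 \<le> f i"
  shows "sqrt (\<Sum>i\<in>I. f i) \<le> (\<Sum>i\<in>I. sqrt (f i))"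
  using assms
proof (induction I rule: finite_induct)
  case (insert i I)
  have "sqrt (f i + sum f I) \<le> sqrt (f i) + sqrt (sum f I)"
    using insert by (intro sqrt_add_le_add_sqrt sum_nonneg) auto
  then show ?case using insert by auto
qed simp

text \<open>\<open>s\<close> bounds the coupling between plaquettes, and \<open>C\<close> is the
  constant for the inverse square root of a pole.\<close>

locale weak_scattering = scattering +
  fixes s C :: real
  assumes b_le: "cmod (b x) \<le> s"
    and C_ge: "C \<ge> 1"
    and C_pole: "\<And>b. cmod b \<le> 1 \<Longrightarrow>
      (\<integral>\<^sup>+ u. ennreal (1 / sqrt (cmod (1 - u * b))) \<partial>circle_measure) \<le> ennreal C"
begin

lemma s_nonneg: "0 \<le> s"
  by (rule order_trans[OF norm_ge_zero b_le])

text \<open>\<open>res_union\<close> with the plaquette of \<open>m\<close> cut out. The wave of the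
  remaining network vanishes on that plaquette because its source lies elsewhere, so the
  counterclockwise part of \<open>hop\<close> contributes nothing there and every entry carries a
  factor \<open>b\<close>. Subadditivity of the square root separates the at most four entry
  sites.\<close>

lemma sqrt_res_le:
  assumes A: "finite A" "cmod z < 1" and k: "k \<notin> block m" and m: "m \<in> A"
  shows "sqrt (cmod (res A z om k m)) \<le>
    (\<Sum>j\<in>A \<inter> block m. sqrt s * (sqrt (cmod (res A z om j m))
       * sqrt (cmod (res (A - block m) z om k (cw_pred j)))))"
proof -
  define B where "B = A \<inter> block m"
  define D where "D = A - block m"
  have AB: "A = D \<union> B" "finite D" "finite B" "D \<inter> B = {}" using A by (auto simp: B_def D_def)
  have outside: "res D z om k x = 0" if "x \<in> block m" for x
    using that k by (intro res_supp) (auto simp: D_def)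
  have t: "cmod (z * unimod (om j) * hop a b (res D z om k) j * res A z om j m)
     \<le> s * (cmod (res A z om j m) * cmod (res D z om k (cw_pred j)))" if "j \<in> B" for j
  proof -
    have "j \<in> block m" using that by (simp add: B_def)
    then have "res D z om k (ccw_pred j) = 0" by (intro outside ccw_pred_block)
    then have "hop a b (res D z om k) j = b j * res D z om k (cw_pred j)"
      by (simp add: hop_def)
    then have "cmod (z * unimod (om j) * hop a b (res D z om k) j * res A z om j m)
      = (cmod z * cmod (b j)) * (cmod (res A z om j m) * cmod (res D z om k (cw_pred j)))"
      by (simp add: norm_mult)
    also have "\<dots> \<le> (1 * s) * (cmod (res A z om j m) * cmod (res D z om k (cw_pred j)))"
      using A(2) b_le by (intro mult_right_mono mult_mono) auto
    finally show ?thesis by simp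
  qed
  have "res A z om k m = res D z om k m + (\<Sum>j\<in>B. z * unimod (om j) * hop a b (res D z om k) j * res A z om j m)"
    using res_union[OF AB(2,3) A(2) AB(4), of om k m] unfolding AB(1)[symmetric] .
  then have "res A z om k m = (\<Sum>j\<in>B. z * unimod (om j) * hop a b (res D z om k) j * res A z om j m)"
    by (simp only: outside[OF block_self] add_0)
  then have "cmod (res A z om k m) \<le> (\<Sum>j\<in>B. s * (cmod (res A z om j m) * cmod (res D z om k (cw_pred j))))"
    by (simp only:) (rule order_trans[OF norm_sum sum_mono[OF t]])
  then have "sqrt (cmod (res A z om k m)) \<le> sqrt (\<Sum>j\<in>B. s * (cmod (res A z om j m) * cmod (res D z om k (cw_pred j))))"
    by (rule real_sqrt_le_mono)
  also have "\<dots> \<le> (\<Sum>j\<in>B. sqrt (s * (cmod (res A z om j m) * cmod (res D z om k (cw_pred j)))))"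
    using AB(3) s_nonneg by (intro sqrt_sum_le) auto
  finally show ?thesis by (simp only: real_sqrt_mult B_def D_def)
qed

end

context weak_scattering
begin

text \<open>One step moves the target from \<open>m\<close> to the clockwise predecessor of a site
  of its plaquette, a distance of at most \<open>2 + 1\<close>; hence one factor per three lattice
  steps. The new resolvent ignores all phases of the plaquette, in particular those at
  \<open>j\<close> and \<open>m\<close>, so it can serve as \<open>h\<close> in
  \<open>nn_integral_res\<close>. The 4 in the rate counts the entry sites.\<close>

lemma nn_integral_res_decay:
  assumes "finite A" "cmod z < 1" "3 * n \<le> ldist m k"
  shows "(\<integral>\<^sup>+ om. ennreal (sqrt (cmod (res A z om k m))) \<partial>Prob)
    \<le> ennreal (C\<^sup>2 * (4 * C\<^sup>2 * sqrt s) ^ n)"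
  using assms
proof (induction n arbitrary: A m)
  case 0
  interpret P: prob_space Prob by (rule prob_space_Prob)
  have "(\<integral>\<^sup>+ om. ennreal (sqrt (cmod (res A z om k m))) * 1 \<partial>Prob)
    \<le> ennreal (C\<^sup>2) * (\<integral>\<^sup>+ om. 1 \<partial>Prob)"
    using 0 by (intro nn_integral_res[OF C_ge C_pole]) auto
  moreover have "emeasure Prob UNIV = 1" using P.emeasure_space_1 by simp
  ultimately show ?case by simp
next
  case (Suc n)
  define B where "B = A \<inter> block m"
  define D where "D = A - block m"
  have k: "k \<notin> block m" using ldist_block[of k m] Suc.prems(3) by auto
  have fin: "finite B" "finite D" using Suc.prems by (auto simp: B_def D_def)
  show ?case
  proof (cases "m \<in> A")
    case False
    moreover have "m \<noteq> k" using k block_self[of m] by auto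
    ultimately show ?thesis by (simp add: res_supp)
  next
    case True
    let ?h = "\<lambda>j om. ennreal (sqrt (cmod (res D z om k (cw_pred j))))"
    have IH: "(\<integral>\<^sup>+ om. ?h j om \<partial>Prob) \<le> ennreal (C\<^sup>2 * (4 * C\<^sup>2 * sqrt s) ^ n)" if "j \<in> B" for j
    proof (rule Suc.IH[OF fin(2) Suc.prems(2)])
      have "ldist m k \<le> ldist m j + (ldist j (cw_pred j) + ldist (cw_pred j) k)"
        using ldist_triangle[of m k j] ldist_triangle[of j k "cw_pred j"] by linarith
      then show "3 * n \<le> ldist (cw_pred j) k"
        using Suc.prems(3) ldist_block[of j m] that ldist_cw_pred[of j] by (auto simp: B_def)
    qed
    have inv: "?h j (om(x := u)) = ?h j om" if "x \<in> block m" for j om x u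
    proof -
      have "res D z (om(x := u)) k = res D z om k"
        using that by (intro res_cong) (auto simp: D_def)
      then show ?thesis by simp
    qed
    have hm[measurable]: "?h j \<in> borel_measurable Prob" for j
      using measurable_res_Prob[of D z k "cw_pred j", measurable] by measurable
    have [measurable]: "(\<lambda>om. ennreal (sqrt (cmod (res A z om j m)))) \<in> borel_measurable Prob" for j
      using measurable_res_Prob[of A z j m, measurable] by measurable
    have "(\<integral>\<^sup>+ om. ennreal (sqrt (cmod (res A z om k m))) \<partial>Prob)
      \<le> (\<integral>\<^sup>+ om. (\<Sum>j\<in>B. ennreal (sqrt s) * (ennreal (sqrt (cmod (res A z om j m))) * ?h j om)) \<partial>Prob)"
    proof (intro nn_integral_mono)
      fix om
      let ?t = "\<lambda>j. sqrt s * (sqrt (cmod (res A z om j m)) * sqrt (cmod (res D z om k (cw_pred j))))"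
      have "ennreal (sqrt (cmod (res A z om k m))) \<le> ennreal (\<Sum>j\<in>B. ?t j)"
        unfolding B_def D_def by (rule ennreal_leI[OF sqrt_res_le[OF Suc.prems(1,2) k True]])
      also have "\<dots> = (\<Sum>j\<in>B. ennreal (?t j))"
        using s_nonneg by (intro sum_ennreal[symmetric]) auto
      also have "\<dots> = (\<Sum>j\<in>B. ennreal (sqrt s) * (ennreal (sqrt (cmod (res A z om j m))) * ?h j om))"
        using s_nonneg by (intro sum.cong) (auto simp: ennreal_mult)
      finally show "ennreal (sqrt (cmod (res A z om k m)))
        \<le> (\<Sum>j\<in>B. ennreal (sqrt s) * (ennreal (sqrt (cmod (res A z om j m))) * ?h j om))" .
    qed
    also have "\<dots> = (\<Sum>j\<in>B. ennreal (sqrt s) * (\<integral>\<^sup>+ om. ennreal (sqrt (cmod (res A z om j m))) * ?h j om \<partial>Prob))"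
      by (simp add: nn_integral_sum nn_integral_cmult)
    also have "\<dots> \<le> (\<Sum>j\<in>B. ennreal (sqrt s) * (ennreal (C\<^sup>2) * (\<integral>\<^sup>+ om. ?h j om \<partial>Prob)))"
      by (intro sum_mono mult_left_mono nn_integral_res[OF C_ge C_pole Suc.prems(1,2)] hm inv block_self)
         (auto simp: B_def)
    also have "\<dots> \<le> (\<Sum>j\<in>B. ennreal (sqrt s) * (ennreal (C\<^sup>2) * ennreal (C\<^sup>2 * (4 * C\<^sup>2 * sqrt s) ^ n)))"
      by (intro sum_mono mult_left_mono IH) auto
    also have "\<dots> = ennreal (real (card B) * (sqrt s * (C\<^sup>2 * (C\<^sup>2 * (4 * C\<^sup>2 * sqrt s) ^ n))))"
      using s_nonneg by (simp add: ennreal_of_nat_eq_real_of_nat flip: ennreal_mult)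
    also have "\<dots> \<le> ennreal (4 * (sqrt s * (C\<^sup>2 * (C\<^sup>2 * (4 * C\<^sup>2 * sqrt s) ^ n))))"
    proof (intro ennreal_leI mult_right_mono)
      have "card B \<le> card (block m)" by (intro card_mono) (auto simp: B_def)
      then show "real (card B) \<le> 4" by (simp add: card_block)
    qed (use s_nonneg in auto)
    also have "\<dots> = ennreal (C\<^sup>2 * (4 * C\<^sup>2 * sqrt s) ^ Suc n)" by (simp add: ac_simps)
    finally show ?thesis .
  qed
qed

end

section \<open>Spectral decomposition in finite volume\<close>

declare split_paired_All [simp del] split_paired_Ex [simp del]

text \<open>Gaussian elimination: a vector not vanishing at \<open>x\<close> clears this coordinate
  from the others, leaving one vector and one coordinate fewer. The result yields the annihilating
  polynomial in \<open>spectral_sum_exists\<close>.\<close>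

lemma exists_linear_dependence:
  fixes v :: "'i \<Rightarrow> 'a \<Rightarrow> complex"
  assumes "finite L" "finite I" "card L < card I"
  shows "\<exists>c. (\<exists>i\<in>I. c i \<noteq> 0) \<and> (\<forall>x\<in>L. (\<Sum>i\<in>I. c i * v i x) = 0)"
  using assms
proof (induction L arbitrary: I v rule: finite_induct)
  case empty
  then obtain i where "i \<in> I" by fastforce
  then show ?case by (intro exI[of _ "\<lambda>_. 1"]) auto
next
  case (insert x L)
  show ?case
  proof (cases "\<forall>i\<in>I. v i x = 0")
    case True
    have "card L < card I" using insert by simp
    from insert.IH[OF insert.prems(1) this, of v] obtain c
      where "\<exists>i\<in>I. c i \<noteq> 0" "\<forall>x\<in>L. (\<Sum>i\<in>I. c i * v i x) = 0" by blast
    then show ?thesis using True by (intro exI[of _ c]) auto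
  next
    case False
    then obtain k where k: "k \<in> I" "v k x \<noteq> 0" by blast
    define J where "J = I - {k}"
    define v' where "v' = (\<lambda>i y. v i y - v i x / v k x * v k y)"
    have J: "finite J" "card L < card J" "k \<notin> J" "I = insert k J"
      using insert.prems insert.hyps k by (auto simp: J_def)
    from insert.IH[OF J(1,2), of v'] obtain c
      where c: "\<exists>i\<in>J. c i \<noteq> 0" "\<forall>y\<in>L. (\<Sum>i\<in>J. c i * v' i y) = 0" by blast
    define d where "d = c(k := - (\<Sum>i\<in>J. c i * v i x / v k x))"
    have sum_d: "(\<Sum>i\<in>I. d i * v i y) = (\<Sum>i\<in>J. c i * v' i y)" for y
    proof -
      have "(\<Sum>i\<in>I. d i * v i y) = d k * v k y + (\<Sum>i\<in>J. c i * v i y)"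
        unfolding J(4) using J(1,3) by (auto simp: d_def intro!: sum.cong)
      also have "d k * v k y = - (\<Sum>i\<in>J. c i * (v i x / v k x * v k y))"
        by (simp add: d_def sum_distrib_right sum_negf mult.assoc)
      also have "- (\<Sum>i\<in>J. c i * (v i x / v k x * v k y)) + (\<Sum>i\<in>J. c i * v i y) = (\<Sum>i\<in>J. c i * v' i y)"
        by (simp add: v'_def right_diff_distrib sum_subtractf)
      finally show ?thesis .
    qed
    have "(\<Sum>i\<in>J. c i * v' i x) = 0" using k(2) by (simp add: v'_def)
    then have "\<forall>y\<in>insert x L. (\<Sum>i\<in>I. d i * v i y) = 0" using c(2) sum_d by auto
    moreover have "\<exists>i\<in>I. d i \<noteq> 0" using c(1) J(3,4) by (auto simp: d_def)
    ultimately show ?thesis by blast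
  qed
qed

section \<open>Spectral theorem for an isometry on finitely many sites\<close>

definition inner_on :: "site set \<Rightarrow> vec \<Rightarrow> vec \<Rightarrow> complex" where
  "inner_on L f g = (\<Sum>x\<in>L. f x * cnj (g x))"

lemma inner_on_add: "inner_on L (\<lambda>x. f x + g x) h = inner_on L f h + inner_on L g h"
  by (simp add: inner_on_def distrib_right sum.distrib)

lemma inner_on_cmult: "inner_on L (\<lambda>x. c * f x) h = c * inner_on L f h"
  by (simp add: inner_on_def sum_distrib_left mult.assoc)

lemma inner_on_cmult_right: "inner_on L f (\<lambda>x. c * h x) = cnj c * inner_on L f h"
  by (simp add: inner_on_def sum_distrib_left mult_ac)

lemma inner_on_sum: "inner_on L (\<lambda>x. \<Sum>i\<in>I. f i x) h = (\<Sum>i\<in>I. inner_on L (f i) h)"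
  unfolding inner_on_def by (simp add: sum_distrib_right sum.swap[of _ I])

lemma inner_on_sum_right: "inner_on L h (\<lambda>x. \<Sum>i\<in>I. f i x) = (\<Sum>i\<in>I. inner_on L h (f i))"
  unfolding inner_on_def by (simp add: sum_distrib_left sum.swap[of _ I])

lemma inner_on_self: "inner_on L f f = complex_of_real (nsq L f)"
  by (simp add: inner_on_def nsq_def complex_norm_square of_real_sum del: of_real_power)

lemma inner_on_e_right: "finite L \<Longrightarrow> k \<in> L \<Longrightarrow> inner_on L f (e k) = f k"
  by (simp add: inner_on_def e_def if_distrib[of cnj] if_distrib[of "\<lambda>u. _ * u"] cong: if_cong)

lemma inner_on_e_left: "finite L \<Longrightarrow> k \<in> L \<Longrightarrow> inner_on L (e k) f = cnj (f k)"
  by (simp add: inner_on_def e_def if_distrib[of "\<lambda>u. u * _"] cong: if_cong)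

lemma nsq_eq_0_iff: "finite L \<Longrightarrow> nsq L f = 0 \<longleftrightarrow> (\<forall>x\<in>L. f x = 0)"
  by (simp add: nsq_def sum_nonneg_eq_0_iff)

locale finite_isometry =
  fixes L :: "site set" and U :: op
  assumes finL: "finite L"
    and U_add: "U (\<lambda>x. f x + g x) = (\<lambda>x. U f x + U g x)"
    and U_cmult: "U (\<lambda>x. c * f x) = (\<lambda>x. c * U f x)"
    and U_supp: "x \<notin> L \<Longrightarrow> U f x = 0"
    and U_inner: "inner_on L (U f) (U g) = inner_on L f g"
begin

lemma U_zero: "U (\<lambda>x. 0) = (\<lambda>x. 0)"
  using U_cmult[of 0 "\<lambda>x. 0"] by simp

lemma U_sum: "U (\<lambda>x. \<Sum>i\<in>I. f i x) = (\<lambda>x. \<Sum>i\<in>I. U (f i) x)"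
  by (induction I rule: infinite_finite_induct) (auto simp: U_zero U_add)

text \<open>Horner's scheme for a polynomial in \<open>U\<close>, applied to
  \<open>psi\<close>.\<close>

definition pop :: "complex poly \<Rightarrow> op" where
  "pop p psi = fold_coeffs (\<lambda>a f x. a * psi x + U f x) p (\<lambda>x. 0)"

lemma pop_0: "pop 0 psi = (\<lambda>x. 0)"
  by (simp add: pop_def)

lemma pop_pCons: "pop (pCons a p) psi = (\<lambda>x. a * psi x + U (pop p psi) x)"
  by (cases "p = 0 \<and> a = 0") (auto simp: pop_def U_zero)

lemma pop_add: "pop (p + q) psi = (\<lambda>x. pop p psi x + pop q psi x)"
proof (induction p arbitrary: q)
  case (pCons a p)
  show ?case by (cases q) (simp add: pop_pCons pCons.IH U_add distrib_right add.assoc add.left_commute)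
qed (simp add: pop_0)

lemma pop_sum: "pop (\<Sum>i\<in>I. p i) psi = (\<lambda>x. \<Sum>i\<in>I. pop (p i) psi x)"
  by (induction I rule: infinite_finite_induct) (auto simp: pop_0 pop_add)

lemma pop_smult: "pop (smult c p) psi = (\<lambda>x. c * pop p psi x)"
  by (induction p) (simp_all add: pop_0 pop_pCons U_cmult distrib_left mult.assoc)

lemma pop_monom: "pop (monom c n) psi = (\<lambda>x. c * (U ^^ n) psi x)"
  by (induction n) (simp_all add: monom_0 monom_Suc pop_pCons pop_0 U_zero U_cmult)

lemma pop_linear_factor:
  "pop ([:- l, 1:] * q) psi = pop q (\<lambda>x. U psi x - l * psi x)"
proof (induction q)
  case (pCons a q)
  have 1: "[:- l, 1:] * pCons a q = smult a [:- l, 1:] + pCons 0 ([:- l, 1:] * q)"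
    by (simp add: algebra_simps)
  show ?case
    unfolding 1 pop_add pop_smult pop_pCons pCons.IH pop_0 U_zero
    by (simp add: right_diff_distrib)
qed (simp add: pop_0)

text \<open>Components may vanish here as long as their index has modulus 1;
  \<open>spectral_rep\<close> discards them.\<close>

definition spectral_sum :: "vec \<Rightarrow> complex set \<Rightarrow> (complex \<Rightarrow> vec) \<Rightarrow> bool" where
  "spectral_sum psi E w \<longleftrightarrow> finite E \<and>
     (\<forall>l\<in>E. cmod l = 1 \<and> (\<forall>x. U (w l) x = l * w l x)) \<and>
     (\<forall>x. psi x = (\<Sum>l\<in>E. w l x))"

lemma eigenvalue_unit:
  assumes "\<And>x. U f x = l * f x" "\<And>x. x \<notin> L \<Longrightarrow> f x = 0" "f y \<noteq> 0"
  shows "cmod l = 1"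
proof -
  have "U f = (\<lambda>x. l * f x)" using assms(1) by blast
  then have "(l * cnj l) * inner_on L f f = inner_on L f f"
    using U_inner[of f f] by (simp add: inner_on_cmult inner_on_cmult_right mult.assoc mult.left_commute)
  moreover have "y \<in> L" using assms(2,3) by blast
  then have "inner_on L f f \<noteq> 0"
    using assms(3) finL by (auto simp: inner_on_self nsq_eq_0_iff)
  ultimately have "l * cnj l = 1" by simp
  then have "(cmod l)\<^sup>2 = 1" by (metis complex_norm_square of_real_eq_1_iff)
  then show ?thesis using abs_square_eq_1[of "cmod l"] by simp
qed

text \<open>As \<open>l * cnj l = 1\<close>, such a block would give \<open>\<langle>U phi, U
  y\<rangle> = \<langle>phi, y\<rangle> + cnj l * \<langle>y, y\<rangle>\<close>, and comparison
  with \<open>U_inner\<close> leaves \<open>\<langle>y, y\<rangle> = 0\<close>.\<close>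

lemma jordan_block_trivial:
  assumes l: "cmod l = 1" and phi: "\<And>x. U phi x = l * phi x + y x"
    and y: "\<And>x. U y x = l * y x"
  shows "inner_on L y y = 0"
proof -
  have ll: "l * cnj l = 1" using l by (simp add: complex_norm_square[symmetric])
  have 1: "U phi = (\<lambda>x. l * phi x + y x)" "U y = (\<lambda>x. l * y x)" using phi y by blast+
  have "inner_on L (U phi) (U y) = inner_on L phi y + cnj l * inner_on L y y"
    using ll by (simp add: 1 inner_on_add inner_on_cmult inner_on_cmult_right mult.assoc[symmetric] mult.commute[of "cnj l" l])
  then have "cnj l * inner_on L y y = 0" using U_inner[of phi y] by simp
  moreover have "cnj l \<noteq> 0" using ll by auto
  ultimately show ?thesis by simp
qed

text \<open>Induction over the linear factors. The vector \<open>y = (U - a) psi\<close> is already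
  decomposed; its components with \<open>l \<noteq> a\<close>, divided by \<open>l - a\<close>, are
  subtracted from \<open>psi\<close>. The remainder \<open>phi\<close> satisfies
  \<open>U phi = a * phi + y0\<close> with \<open>y0\<close> the component of \<open>y\<close> at
  \<open>a\<close>, and \<open>y0 = 0\<close> because there are no Jordan blocks. Repeated roots
  thus do no harm.\<close>

lemma spectral_sum_of_product:
  assumes "\<And>x. x \<notin> L \<Longrightarrow> psi x = 0" "pop (\<Prod>l\<in>#A. [:- l, 1:]) psi = (\<lambda>x. 0)"
  shows "\<exists>E w. spectral_sum psi E w"
  using assms
proof (induction A arbitrary: psi)
  case empty
  have "pop 1 psi = (\<lambda>x. psi x)"
    using pop_monom[of 1 0 psi] by simp
  then have "\<forall>x. psi x = 0" using empty.prems(2) by (metis image_mset_empty prod_mset_empty)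
  then show ?case by (intro exI[of _ "{}"]) (simp add: spectral_sum_def)
next
  case (add a A)
  define y where "y = (\<lambda>x. U psi x - a * psi x)"
  have "pop (\<Prod>l\<in>#A. [:- l, 1:]) y = (\<lambda>x. 0)"
    using add.prems(2) unfolding y_def pop_linear_factor[symmetric] by simp
  moreover have "y x = 0" if "x \<notin> L" for x
    using that add.prems(1) U_supp by (simp add: y_def)
  ultimately obtain E w where Ew: "spectral_sum y E w" using add.IH by blast
  then have fE: "finite E" and w: "\<And>l. l \<in> E \<Longrightarrow> U (w l) = (\<lambda>x. l * w l x)"
    and E1: "\<And>l. l \<in> E \<Longrightarrow> cmod l = 1" and ysum: "\<And>x. y x = (\<Sum>l\<in>E. w l x)"
    by (auto simp: spectral_sum_def fun_eq_iff)
  have wsupp: "w l x = 0" if "l \<in> E" "x \<notin> L" for l x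
    using fun_cong[OF w[OF that(1)], of x] U_supp[OF that(2), of "w l"] E1[OF that(1)] by auto
  define E' where "E' = E - {a}"
  define y0 where "y0 = (\<lambda>x. if a \<in> E then w a x else 0)"
  define phi where "phi = (\<lambda>x. psi x + (\<Sum>l\<in>E'. - inverse (l - a) * w l x))"
  have y_split: "y x = y0 x + (\<Sum>l\<in>E'. w l x)" for x
    unfolding ysum y0_def E'_def using fE by (auto simp: sum.remove)
  have "U phi x = a * phi x + y0 x" for x
  proof -
    have "U phi x = U psi x + (\<Sum>l\<in>E'. - inverse (l - a) * (l * w l x))"
    proof -
      have "U phi = (\<lambda>x. U psi x + U (\<lambda>x. \<Sum>l\<in>E'. - inverse (l - a) * w l x) x)"
        unfolding phi_def by (rule U_add)
      also have "U (\<lambda>x. \<Sum>l\<in>E'. - inverse (l - a) * w l x) = (\<lambda>x. \<Sum>l\<in>E'. - inverse (l - a) * (l * w l x))"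
        unfolding U_sum U_cmult by (intro ext sum.cong) (auto simp: w E'_def)
      finally show ?thesis by simp
    qed
    also have "U psi x = a * psi x + y x" by (simp add: y_def)
    also have "(\<Sum>l\<in>E'. - inverse (l - a) * (l * w l x))
      = (\<Sum>l\<in>E'. a * (- inverse (l - a) * w l x) - w l x)"
    proof (intro sum.cong refl)
      fix l assume "l \<in> E'"
      then have "l - a \<noteq> 0" by (auto simp: E'_def)
      then have "inverse (l - a) * (l - a) = 1" by simp
      then have il: "inverse (l - a) * l = 1 + inverse (l - a) * a" by (simp add: algebra_simps)
      have "- inverse (l - a) * (l * w l x) = - ((inverse (l - a) * l) * w l x)" by simp
      also have "\<dots> = a * (- inverse (l - a) * w l x) - w l x"
        unfolding il by (simp add: algebra_simps)
      finally show "- inverse (l - a) * (l * w l x) = a * (- inverse (l - a) * w l x) - w l x" .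
    qed
    finally show ?thesis
      by (simp add: y_split phi_def sum_subtractf sum_distrib_left distrib_left)
  qed
  note Uphi = this
  have y0: "y0 = (\<lambda>x. 0)"
  proof (cases "a \<in> E")
    case True
    then have "U y0 x = a * y0 x" for x by (simp add: y0_def w)
    then have "inner_on L y0 y0 = 0" by (rule jordan_block_trivial[OF E1[OF True] Uphi])
    then have "y0 x = 0" if "x \<in> L" for x using that finL by (simp add: inner_on_self nsq_eq_0_iff)
    moreover have "y0 x = 0" if "x \<notin> L" for x using that wsupp True by (simp add: y0_def)
    ultimately show ?thesis by blast
  qed (simp add: y0_def)
  have phisupp: "phi x = 0" if "x \<notin> L" for x
    using that add.prems(1) wsupp by (simp add: phi_def E'_def)
  define w' where "w' = (\<lambda>l. if l = a then phi else (\<lambda>x. inverse (l - a) * w l x))"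
  have w'E: "\<forall>x. U (w' l) x = l * w' l x" if "l \<in> E'" for l
    using that by (auto simp: w'_def E'_def U_cmult w)
  have psi: "psi x = phi x + (\<Sum>l\<in>E'. w' l x)" for x
  proof -
    have "(\<Sum>l\<in>E'. w' l x) = (\<Sum>l\<in>E'. inverse (l - a) * w l x)"
      by (intro sum.cong) (auto simp: w'_def E'_def)
    then show ?thesis by (simp add: phi_def sum_negf)
  qed
  have E': "finite E'" "a \<notin> E'" "\<And>l. l \<in> E' \<Longrightarrow> cmod l = 1" and w'a: "w' a = phi"
    using fE E1 by (auto simp: E'_def w'_def)
  show ?case
  \<comment> \<open>If \<open>phi\<close> vanishes, the root \<open>a\<close> may have any modulus
    and is left out of the index set.\<close>
  proof (cases "\<exists>y. phi y \<noteq> 0")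
    case True
    then have "cmod a = 1" using eigenvalue_unit[of phi a] Uphi y0 phisupp by auto
    then have "spectral_sum psi (insert a E') w'"
      unfolding spectral_sum_def using E' w'E Uphi y0 psi
      by (auto simp: w'a)
    then show ?thesis by blast
  next
    case False
    then have "spectral_sum psi E' w'"
      unfolding spectral_sum_def using E' w'E psi by auto
    then show ?thesis by blast
  qed
qed

text \<open>The \<open>card L + 1\<close> vectors \<open>(U ^^ i) psi\<close> are dependent on
  \<open>card L\<close> sites, and the polynomial recording this splits into linear factors.\<close>

lemma spectral_sum_exists:
  assumes "\<And>x. x \<notin> L \<Longrightarrow> psi x = 0"
  shows "\<exists>E w. spectral_sum psi E w"
proof -
  let ?I = "{..card L}"
  obtain c where c: "\<exists>i\<in>?I. c i \<noteq> 0" "\<forall>x\<in>L. (\<Sum>i\<in>?I. c i * (U ^^ i) psi x) = 0"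
    using exists_linear_dependence[OF finL, of ?I "\<lambda>i. (U ^^ i) psi"] by auto
  define p where "p = (\<Sum>i\<in>?I. monom (c i) i)"
  have "(U ^^ i) psi x = 0" if "x \<notin> L" for i x
    using that assms U_supp by (cases i) auto
  then have pop0: "pop p psi = (\<lambda>x. 0)"
    unfolding p_def pop_sum pop_monom using c(2) by (intro ext) (metis (no_types, lifting) mult_zero_right sum.neutral)
  obtain i where i: "i \<le> card L" "c i \<noteq> 0" using c(1) by auto
  have "coeff p i = c i" using i(1) by (simp add: p_def coeff_sum)
  then have p0: "p \<noteq> 0" using i(2) by auto
  obtain A where A: "p = smult (lead_coeff p) (\<Prod>x\<in>#A. [:- x, 1:])"
    using alg_closed_imp_factorization[OF p0] by blast
  have "pop (\<Prod>l\<in>#A. [:- l, 1:]) psi x = 0" for x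
  proof -
    have "lead_coeff p * pop (\<Prod>l\<in>#A. [:- l, 1:]) psi x = pop p psi x"
      using fun_cong[OF pop_smult[of "lead_coeff p" "\<Prod>l\<in>#A. [:- l, 1:]" psi], of x] A by simp
    then show ?thesis using pop0 p0 by simp
  qed
  then have "pop (\<Prod>l\<in>#A. [:- l, 1:]) psi = (\<lambda>x. 0)" by blast
  then show ?thesis by (rule spectral_sum_of_product[OF assms, rotated])
qed

text \<open>\<open>w l\<close> is the spectral projection of \<open>e k\<close> at \<open>l\<close>,
  and \<open>nsq L (w l)\<close> the mass of the spectral measure there. Nonvanishing components
  make division by this mass possible.\<close>

definition spectral_rep :: "site \<Rightarrow> complex set \<Rightarrow> (complex \<Rightarrow> vec) \<Rightarrow> bool" where
  "spectral_rep k E w \<longleftrightarrow> spectral_sum (e k) E w \<and> (\<forall>l\<in>E. \<exists>x. w l x \<noteq> 0)"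

lemma spectral_rep_exists:
  assumes "k \<in> L"
  shows "\<exists>E w. spectral_rep k E w"
proof -
  obtain E w where Ew: "spectral_sum (e k) E w"
    using spectral_sum_exists[of "e k"] assms by (metis e_diff)
  define E' where "E' = {l\<in>E. \<exists>x. w l x \<noteq> 0}"
  have "(\<Sum>l\<in>E. w l x) = (\<Sum>l\<in>E'. w l x)" for x
    using Ew by (intro sum.mono_neutral_right) (auto simp: E'_def spectral_sum_def)
  then have "spectral_rep k E' w"
    using Ew by (auto simp: spectral_rep_def spectral_sum_def E'_def)
  then show ?thesis by blast
qed

context
  fixes k E w
  assumes k: "k \<in> L" and rep: "spectral_rep k E w"
begin

lemma rep_finite: "finite E"
  and rep_unit: "l \<in> E \<Longrightarrow> cmod l = 1"
  and rep_eig: "l \<in> E \<Longrightarrow> U (w l) = (\<lambda>x. l * w l x)"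
  and rep_sum: "e k x = (\<Sum>l\<in>E. w l x)"
  and rep_nonzero: "l \<in> E \<Longrightarrow> \<exists>x. w l x \<noteq> 0"
  using rep by (auto simp: spectral_rep_def spectral_sum_def fun_eq_iff)

lemma rep_supp: "l \<in> E \<Longrightarrow> x \<notin> L \<Longrightarrow> w l x = 0"
  using fun_cong[OF rep_eig, of l x] U_supp[of x "w l"] rep_unit[of l] by auto

lemma rep_orthogonal:
  assumes "l \<in> E" "l' \<in> E" "l \<noteq> l'"
  shows "inner_on L (w l) (w l') = 0"
proof -
  have "(l * cnj l') * inner_on L (w l) (w l') = inner_on L (w l) (w l')"
    using U_inner[of "w l" "w l'"] rep_eig assms(1,2)
    by (simp add: inner_on_cmult inner_on_cmult_right mult_ac)
  moreover have "l * cnj l' \<noteq> 1"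
  proof
    assume 1: "l * cnj l' = 1"
    have "l' * cnj l' = 1" using rep_unit[OF assms(2)] by (simp add: complex_norm_square[symmetric])
    then have "(l - l') * cnj l' = 0" using 1 by (simp add: left_diff_distrib)
    then show False using assms(3) 1 by auto
  qed
  ultimately show ?thesis by simp
qed

text \<open>Expand \<open>e k\<close> in \<open>\<langle>w l, e k\<rangle>\<close>; orthogonality
  leaves the squared norm of \<open>w l\<close>.\<close>

lemma rep_mass: "l \<in> E \<Longrightarrow> w l k = complex_of_real (nsq L (w l))"
proof -
  assume l: "l \<in> E"
  have ek: "e k = (\<lambda>x. \<Sum>l\<in>E. w l x)" using rep_sum by blast
  have "w l k = inner_on L (w l) (e k)" using inner_on_e_right[OF finL k] by simp
  also have "\<dots> = (\<Sum>l'\<in>E. inner_on L (w l) (w l'))"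
    unfolding ek by (rule inner_on_sum_right)
  also have "\<dots> = inner_on L (w l) (w l)"
    using l rep_finite rep_orthogonal by (subst sum.remove[OF rep_finite l]) (auto intro!: sum.neutral)
  finally show ?thesis by (simp add: inner_on_self)
qed

lemma rep_mass_pos: "l \<in> E \<Longrightarrow> nsq L (w l) > 0"
  using rep_nonzero[of l] rep_supp[of l] finL nsq_eq_0_iff[of L "w l"] nsq_nonneg[of L "w l"]
  by (metis less_eq_real_def)

lemma rep_mass_sum: "(\<Sum>l\<in>E. nsq L (w l)) = 1"
proof -
  have "complex_of_real (\<Sum>l\<in>E. nsq L (w l)) = (\<Sum>l\<in>E. w l k)"
    by (simp add: rep_mass)
  also have "\<dots> = 1" using rep_sum[of k] by simp
  finally show ?thesis by (simp only: of_real_eq_1_iff)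
qed

text \<open>Bessel's inequality for \<open>e x\<close> and the orthonormal system
  \<open>w l / sqrt (nsq L (w l))\<close>. The vector \<open>u\<close> is the projection of
  \<open>e x\<close> onto its span, so both \<open>u x\<close> and the squared norm of
  \<open>u\<close> equal the sum \<open>?B\<close>, whence
  \<open>?B\<^sup>2 \<le> ?B\<close>.\<close>

lemma rep_bessel:
  assumes "x \<in> L"
  shows "(\<Sum>l\<in>E. (cmod (w l x))\<^sup>2 / nsq L (w l)) \<le> 1"
proof -
  let ?B = "\<Sum>l\<in>E. (cmod (w l x))\<^sup>2 / nsq L (w l)"
  define c where "c = (\<lambda>l. cnj (w l x) / complex_of_real (nsq L (w l)))"
  define u where "u = (\<lambda>y. \<Sum>l\<in>E. c l * w l y)"
  have ux: "u x = complex_of_real ?B"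
    unfolding u_def c_def of_real_sum by (intro sum.cong refl) (simp only: of_real_divide complex_norm_square times_divide_eq_left mult.commute[of "cnj _"])
  have "inner_on L u u = (\<Sum>l\<in>E. \<Sum>l'\<in>E. c l * (cnj (c l') * inner_on L (w l) (w l')))"
    unfolding u_def inner_on_sum inner_on_cmult inner_on_sum_right inner_on_cmult_right
    by (simp add: sum_distrib_left)
  also have "\<dots> = (\<Sum>l\<in>E. c l * (cnj (c l) * inner_on L (w l) (w l)))"
  proof (intro sum.cong refl)
    fix l assume l: "l \<in> E"
    have "inner_on L (w l) (w l') = 0" if "l' \<in> E - {l}" for l'
      using that by (intro rep_orthogonal[OF l]) auto
    then show "(\<Sum>l'\<in>E. c l * (cnj (c l') * inner_on L (w l) (w l')))
      = c l * (cnj (c l) * inner_on L (w l) (w l))"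
      by (simp add: sum.remove[OF rep_finite l])
  qed
  also have "\<dots> = complex_of_real ?B"
    unfolding of_real_sum
  proof (intro sum.cong refl)
    fix l assume l: "l \<in> E"
    have "c l * (cnj (c l) * inner_on L (w l) (w l))
      = (w l x * cnj (w l x)) * (complex_of_real (nsq L (w l)) / (complex_of_real (nsq L (w l)) * complex_of_real (nsq L (w l))))"
      by (simp add: c_def inner_on_self)
    also have "\<dots> = complex_of_real ((cmod (w l x))\<^sup>2 / nsq L (w l))"
      using rep_mass_pos[OF l] by (simp add: complex_norm_square[symmetric] del: of_real_power)
    finally show "c l * (cnj (c l) * inner_on L (w l) (w l)) = complex_of_real ((cmod (w l x))\<^sup>2 / nsq L (w l))" .
  qed
  finally have n: "nsq L u = ?B" by (simp only: inner_on_self of_real_eq_iff)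
  have B0: "0 \<le> ?B" by (intro sum_nonneg) auto
  have "(cmod (u x))\<^sup>2 \<le> nsq L u" by (rule cmod_le_nsq[OF finL assms])
  moreover have "cmod (u x) = ?B" unfolding ux norm_of_real using B0 by (rule abs_of_nonneg)
  ultimately have "?B\<^sup>2 \<le> ?B" by (simp only: n)
  moreover have "B \<le> 1" if "B\<^sup>2 \<le> B" for B :: real
  proof (rule ccontr)
    assume "\<not> B \<le> 1"
    then have "B * 1 < B * B" by (intro mult_strict_left_mono) auto
    then show False using that by (simp add: power2_eq_square)
  qed
  ultimately show ?thesis by blast
qed

lemma rep_pow: "(U ^^ n) (e k) x = (\<Sum>l\<in>E. l ^ n * w l x)"
proof -
  have "(U ^^ n) (e k) = (\<lambda>x. \<Sum>l\<in>E. l ^ n * w l x)"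
  proof (induction n)
    case 0
    then show ?case using rep_sum by (auto simp: fun_eq_iff)
  next
    case (Suc n)
    have "(U ^^ Suc n) (e k) = U (\<lambda>x. \<Sum>l\<in>E. l ^ n * w l x)" using Suc by simp
    also have "\<dots> = (\<lambda>x. \<Sum>l\<in>E. l ^ n * (l * w l x))"
      unfolding U_sum U_cmult by (intro ext sum.cong) (auto simp: rep_eig)
    finally show ?case by (simp add: mult_ac)
  qed
  then show ?thesis by simp
qed

lemma U_inner_pow: "inner_on L ((U ^^ n) f) ((U ^^ n) g) = inner_on L f g"
  by (induction n) (auto simp: U_inner)

text \<open>The spectral formula defines a candidate \<open>chi\<close> for the power
  \<open>-n\<close> of \<open>U\<close> at \<open>e k\<close>. Applying \<open>U ^^ n\<close> to it
  returns \<open>e k\<close>, and the isometry property shifts these powers to \<open>e m\<close>,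
  so no inverse has to be constructed.\<close>

lemma rep_pow_neg:
  assumes "m \<in> L"
  shows "cnj ((U ^^ n) (e m) k) = (\<Sum>l\<in>E. l powi (- int n) * w l m)"
proof -
  define chi where "chi = (\<lambda>x. \<Sum>l\<in>E. l powi (- int n) * w l x)"
  have "(U ^^ j) chi = (\<lambda>x. \<Sum>l\<in>E. l powi (int j - int n) * w l x)" for j
  proof (induction j)
    case (Suc j)
    have "(U ^^ Suc j) chi = U (\<lambda>x. \<Sum>l\<in>E. l powi (int j - int n) * w l x)" using Suc by simp
    also have "\<dots> = (\<lambda>x. \<Sum>l\<in>E. l powi (int j - int n) * (l * w l x))"
      unfolding U_sum U_cmult by (intro ext sum.cong) (auto simp: rep_eig)
    also have "\<dots> = (\<lambda>x. \<Sum>l\<in>E. l powi (int (Suc j) - int n) * w l x)"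
    proof (intro ext sum.cong refl)
      fix x l assume "l \<in> E"
      then have "l \<noteq> 0" using rep_unit[of l] by auto
      then have "l powi (int (Suc j) - int n) = l powi (int j - int n) * l"
        using power_int_add_1[of l "int j - int n"] by (simp add: algebra_simps)
      then show "l powi (int j - int n) * (l * w l x) = l powi (int (Suc j) - int n) * w l x" by simp
    qed
    finally show ?case .
  qed (simp add: chi_def)
  from this[of n] have Un: "(U ^^ n) chi = e k" using rep_sum by (auto simp: fun_eq_iff)
  have "chi m = inner_on L chi (e m)" using inner_on_e_right[OF finL assms] by simp
  also have "\<dots> = inner_on L (e k) ((U ^^ n) (e m))" using U_inner_pow[of n chi "e m"] Un by simp
  also have "\<dots> = cnj ((U ^^ n) (e m) k)" by (rule inner_on_e_left[OF finL k])
  finally show ?thesis by (simp add: chi_def)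
qed

end

end

section \<open>Spectral averaging\<close>

text \<open>\<open>(1 + u) / (1 - u)\<close> is the Herglotz kernel, and its real part is the
  Poisson kernel.\<close>

lemma Re_two_div:
  assumes "u \<noteq> 1"
  shows "Re (2 / (1 - u) - 1) = (1 - (cmod u)\<^sup>2) / (cmod (1 - u))\<^sup>2"
proof -
  have n: "(cmod (1 - u))\<^sup>2 \<noteq> 0" using assms by simp
  have "2 / (1 - u) - 1 = (1 + u) / (1 - u)" using assms by (simp add: field_simps)
  also have "\<dots> = (1 + u) * cnj (1 - u) / complex_of_real ((cmod (1 - u))\<^sup>2)"
    by (rule complex_div_cnj)
  also have "Re \<dots> = Re ((1 + u) * cnj (1 - u)) / (cmod (1 - u))\<^sup>2"
    by (rule Re_divide_of_real)
  also have "Re ((1 + u) * cnj (1 - u)) = 1 - (cmod u)\<^sup>2"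
    unfolding cmod_power2 by (simp add: power2_eq_square algebra_simps)
  finally show ?thesis .
qed

text \<open>\<open>1 - c * cis t\<close> stays in the right half plane, so the principal logarithm
  is smooth along the whole circle and returns to its initial value. Only the term \<open>t\<close>
  grows over a period, which gives the mean 1 below.\<close>

lemma poisson_primitive:
  assumes "cmod c < 1"
  shows "((\<lambda>t. t - 2 * Im (Ln (1 - c * cis t))) has_real_derivative Re (2 / (1 - cis t * c) - 1)) (at t)"
proof -
  have "Re (c * cis t) \<le> cmod (c * cis t)" by (rule complex_Re_le_cmod)
  also have "\<dots> < 1" using assms by (simp add: norm_mult)
  finally have re: "Re (1 - c * cis t) > 0" by simp
  then have nr: "1 - c * cis t \<notin> \<real>\<^sub>\<le>\<^sub>0" by (auto simp: complex_nonpos_Reals_iff)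
  have nz: "1 - c * cis t \<noteq> 0" using re by (metis less_irrefl zero_complex.sel(1))
  have "((\<lambda>t. 1 - c * cis t) has_vector_derivative - (c * (\<i> * cis t))) (at t)"
    unfolding has_vector_derivative_def
    by (auto intro!: derivative_eq_intros simp: scaleR_conv_of_real)
  from field_vector_diff_chain_at[OF this has_field_derivative_Ln[OF nr]]
  have "((\<lambda>t. Ln (1 - c * cis t)) has_vector_derivative - (c * (\<i> * cis t)) * inverse (1 - c * cis t)) (at t)"
    by (simp add: o_def)
  from bounded_linear.has_vector_derivative[OF bounded_linear_Im this]
  have "((\<lambda>t. Im (Ln (1 - c * cis t))) has_real_derivative Im (- (c * (\<i> * cis t)) * inverse (1 - c * cis t))) (at t)"
    by (simp add: has_real_derivative_iff_has_vector_derivative)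
  then have "((\<lambda>t. t - 2 * Im (Ln (1 - c * cis t))) has_real_derivative
      1 - 2 * Im (- (c * (\<i> * cis t)) * inverse (1 - c * cis t))) (at t)"
    by (intro DERIV_diff DERIV_ident DERIV_cmult)
  moreover have "1 - 2 * Im (- (c * (\<i> * cis t)) * inverse (1 - c * cis t)) = Re (2 / (1 - cis t * c) - 1)"
  proof -
    define q where "q = c * cis t / (1 - c * cis t)"
    have "- (c * (\<i> * cis t)) * inverse (1 - c * cis t) = - (\<i> * q)"
      by (simp add: q_def divide_inverse mult_ac)
    then have 1: "Im (- (c * (\<i> * cis t)) * inverse (1 - c * cis t)) = - Re q"
      by (simp only: uminus_complex.sel Im_i_times)
    have 2: "2 / (1 - cis t * c) - 1 = 1 + 2 * q"
      using nz by (simp add: q_def field_simps)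
    show ?thesis unfolding 1 2 by simp
  qed
  ultimately show ?thesis by (simp only:)
qed

lemma nn_integral_poisson:
  assumes "cmod c < 1"
  shows "(\<integral>\<^sup>+ u. ennreal (Re (2 / (1 - u * c) - 1)) \<partial>circle_measure) = 1"
proof -
  let ?G = "\<lambda>t. t - 2 * Im (Ln (1 - c * cis t))"
  let ?f = "\<lambda>t. Re (2 / (1 - cis t * c) - 1)"
  have [measurable]: "(\<lambda>u. Re (2 / (1 - u * c) - 1)) \<in> borel_measurable borel"
    by measurable
  have [measurable]: "?f \<in> borel_measurable borel"
    by measurable
  have lt: "cmod (cis t * c) < 1" for t using assms by (simp add: norm_mult)
  have pos: "0 \<le> ?f t" for t
  proof -
    have ne: "cis t * c \<noteq> 1" using lt[of t] by auto
    show ?thesis unfolding Re_two_div[OF ne] using lt[of t] by (simp add: abs_square_le_1)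
  qed
  have "(\<integral>\<^sup>+ t. ennreal (?f t) * indicator {0..2*pi} t \<partial>lborel) = ennreal (?G (2*pi) - ?G 0)"
    using poisson_primitive[OF assms] pos by (intro nn_integral_FTC_Icc) auto
  moreover have "(\<integral>\<^sup>+ t. ennreal (?f t) * indicator {0..<2*pi} t \<partial>lborel)
    = (\<integral>\<^sup>+ t. ennreal (?f t) * indicator {0..2*pi} t \<partial>lborel)"
    by (rule nn_integral_cong_AE)
       (use AE_lborel_singleton[of "2*pi"] in eventually_elim, auto simp: indicator_def)
  ultimately have "(\<integral>\<^sup>+ t. ennreal (?f t) * indicator {0..<2*pi} t \<partial>lborel) = ennreal (2 * pi)"
    by simp
  then show ?thesis
    by (subst nn_integral_circle_measure) (auto simp: ennreal_divide_self)
qed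

section \<open>Eigenfunction correlator of a unitary box\<close>

locale unitary_box = weak_scattering +
  fixes L :: "site set"
  assumes finL: "finite L"
    and hop_inner: "inner_on L (hop a b f) (hop a b g) = inner_on L f g"
    and C_s: "4 * C\<^sup>2 * sqrt s \<le> 1 / 4"
begin

abbreviation U :: "(site \<Rightarrow> complex) \<Rightarrow> op" where "U om \<equiv> stp L 1 om"

lemma finite_isometry_U: "finite_isometry L (U om)"
proof
  show "inner_on L (U om f) (U om g) = inner_on L f g" for f g
  proof -
    have "unimod v * p * cnj (unimod v * q) = p * cnj q" for v p q
    proof -
      have "unimod v * cnj (unimod v) = 1" by (simp add: complex_norm_square[symmetric])
      then show ?thesis by (simp add: mult.assoc mult.left_commute)
    qed
    then have "inner_on L (U om f) (U om g) = inner_on L (hop a b f) (hop a b g)"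
      unfolding inner_on_def by (intro sum.cong) (auto simp: stp_def)
    then show ?thesis by (simp add: hop_inner)
  qed
qed (auto simp: finL stp_add stp_cmult stp_def)

sublocale FI: finite_isometry L "U om" for om by (rule finite_isometry_U)

lemma stp_U: "stp L z om f x = z * U om f x"
  by (simp add: stp_def)

lemma res_spectral:
  assumes z: "cmod z < 1" and k: "k \<in> L" and rep: "FI.spectral_rep om k E w"
  shows "res L z om k x = (\<Sum>l\<in>E. w l x / (1 - z * l))"
proof -
  note r = FI.rep_unit[OF k rep] FI.rep_eig[OF k rep] FI.rep_sum[OF k rep] FI.rep_supp[OF k rep]
  have nz: "1 - z * l \<noteq> 0" if "l \<in> E" for l
    using one_minus_nonzero[OF z, of l 1] r(1)[OF that] by simp
  have "(\<lambda>x. \<Sum>l\<in>E. inverse (1 - z * l) * w l x) = res L z om k"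
  proof (rule res_unique[OF finL z finL])
    fix x
    have "stp L z om (\<lambda>x. \<Sum>l\<in>E. inverse (1 - z * l) * w l x) x
      = (\<Sum>l\<in>E. inverse (1 - z * l) * (z * (l * w l x)))"
      unfolding stp_sum stp_cmult by (intro sum.cong) (auto simp: stp_U r(2))
    moreover have "inverse (1 - z * l) * w l x = w l x + inverse (1 - z * l) * (z * (l * w l x))"
      if "l \<in> E" for l using nz[OF that] by (simp add: field_simps)
    then have "(\<Sum>l\<in>E. inverse (1 - z * l) * w l x)
      = (\<Sum>l\<in>E. w l x + inverse (1 - z * l) * (z * (l * w l x)))"
      by (rule sum.cong[OF refl])
    ultimately show "(\<Sum>l\<in>E. inverse (1 - z * l) * w l x)
      = e k x + stp L z om (\<lambda>x. \<Sum>l\<in>E. inverse (1 - z * l) * w l x) x"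
      by (simp add: r(3) sum.distrib)
  qed (auto simp: r(4))
  from fun_cong[OF this, of x] show ?thesis by (simp add: divide_inverse mult.commute)
qed

text \<open>The Poisson smoothing at \<open>z\<close> of the spectral measure of \<open>e k\<close>,
  expressed by the resolvent to make the dependence on \<open>om k\<close> explicit.\<close>

definition weight :: "complex \<Rightarrow> (site \<Rightarrow> complex) \<Rightarrow> site \<Rightarrow> real" where
  "weight z om k = Re (2 * res L z om k k - 1)"

lemma weight_spectral:
  assumes z: "cmod z < 1" and k: "k \<in> L" and rep: "FI.spectral_rep om k E w"
  shows "weight z om k = (\<Sum>l\<in>E. nsq L (w l) * ((1 - (cmod z)\<^sup>2) / (cmod (1 - z * l))\<^sup>2))"
proof -
  have "2 * res L z om k k - 1 = 2 * (\<Sum>l\<in>E. w l k / (1 - z * l)) - (\<Sum>l\<in>E. w l k)"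
    using FI.rep_sum[OF k rep, of k] by (simp add: res_spectral[OF assms])
  also have "\<dots> = (\<Sum>l\<in>E. complex_of_real (nsq L (w l)) * (2 / (1 - z * l) - 1))"
    unfolding sum_distrib_left sum_subtractf[symmetric]
    by (intro sum.cong) (auto simp: FI.rep_mass[OF k rep] algebra_simps)
  finally have "weight z om k = (\<Sum>l\<in>E. nsq L (w l) * Re (2 / (1 - z * l) - 1))"
    unfolding weight_def by (simp only: Re_sum Re_complex_of_real times_complex.sel Im_complex_of_real mult_zero_left diff_zero)
  also have "\<dots> = (\<Sum>l\<in>E. nsq L (w l) * ((1 - (cmod z)\<^sup>2) / (cmod (1 - z * l))\<^sup>2))"
  proof (intro sum.cong refl)
    fix l assume l: "l \<in> E"
    have zl: "cmod (z * l) = cmod z" using FI.rep_unit[OF k rep l] by (simp add: norm_mult)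
    then have ne: "z * l \<noteq> 1" using z by auto
    show "nsq L (w l) * Re (2 / (1 - z * l) - 1) = nsq L (w l) * ((1 - (cmod z)\<^sup>2) / (cmod (1 - z * l))\<^sup>2)"
      by (simp only: Re_two_div[OF ne] zl)
  qed
  finally show ?thesis .
qed

lemma measurable_weight: "(\<lambda>om. weight z om k) \<in> borel_measurable Prob"
  unfolding weight_def using measurable_res_Prob[of L z k k, measurable] by measurable

text \<open>As a function of \<open>om k\<close> alone the weight is a Poisson kernel with parameter
  \<open>z * amp (L - {k}) z om k k\<close> inside the disc, and its mean over the circle is 1.
  Averaging over one phase thus turns the random spectral measure into Lebesgue measure.\<close>

lemma nn_integral_weight:
  assumes z: "cmod z < 1" and k: "k \<in> L"
    and [measurable]: "h \<in> borel_measurable Prob" and h: "\<And>om u. h (om(k := u)) = h om"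
  shows "(\<integral>\<^sup>+ om. ennreal (weight z om k) * h om \<partial>Prob) = (\<integral>\<^sup>+ om. h om \<partial>Prob)"
proof -
  define A where "A = L - {k}"
  have A: "finite A" "k \<notin> A" "L = insert k A" using finL k by (auto simp: A_def)
  have am: "amp A z (om(k := u)) k k = amp A z om k k" for om u
    using A(2) by (intro amp_cong) auto
  have w: "weight z om k = Re (2 / (1 - unimod (om k) * (z * amp A z om k k)) - 1)" for om
  proof -
    have "res L z om k k = 1 / (1 - unimod (om k) * (z * amp A z om k k))"
      using res_insert_source[OF A(1) z A(2), of om k] res_source[OF A(1) z A(2), of om]
      unfolding A(3)[symmetric] by (simp add: mult_ac)
    then show ?thesis by (simp add: weight_def)
  qed
  have wm: "(\<lambda>om. ennreal (weight z om k) * h om) \<in> borel_measurable Prob"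
    using measurable_weight[of z k, measurable] by measurable
  have "(\<integral>\<^sup>+ u. ennreal (weight z (om(k := u)) k) \<partial>circle_measure) = 1" for om
  proof -
    have "(\<integral>\<^sup>+ u. ennreal (weight z (om(k := u)) k) \<partial>circle_measure)
      = (\<integral>\<^sup>+ u. ennreal (Re (2 / (1 - u * (z * amp A z om k k)) - 1)) \<partial>circle_measure)"
      unfolding w am by (rule nn_integral_cong_AE) (use AE_circle_unimod in eventually_elim, simp)
    also have "\<dots> = 1"
    proof (rule nn_integral_poisson)
      have "cmod (z * amp A z om k k) \<le> cmod z * 1"
        unfolding norm_mult using amp_le_1[OF A(1) z A(2,2)] by (intro mult_left_mono) auto
      then show "cmod (z * amp A z om k k) < 1" using z by simp
    qed
    finally show ?thesis .
  qed
  moreover have "(\<integral>\<^sup>+ u. ennreal (weight z (om(k := u)) k) * c \<partial>circle_measure)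
     = (\<integral>\<^sup>+ u. ennreal (weight z (om(k := u)) k) \<partial>circle_measure) * c" for om c
    unfolding w am fun_upd_same by (rule nn_integral_multc) measurable
  ultimately show ?thesis
    by (subst nn_integral_Prob_upd[OF wm, of k]) (simp add: h)
qed

text \<open>Averaged over \<open>om k\<close> the weight is 1, while the quotient of resolvent entries
  \<open>res L z om k m / res L z om k k = res (L - {k}) z om k m\<close> does not depend on \<open>om k\<close>.\<close>
definition avg :: "real \<Rightarrow> site \<Rightarrow> site \<Rightarrow> (site \<Rightarrow> complex) \<Rightarrow> ennreal" where
  "avg r m k om = (\<integral>\<^sup>+ t. ennreal (weight (complex_of_real r * cis t) om k)
      * ennreal (sqrt (cmod (res (L - {k}) (complex_of_real r * cis t) om k m)))
      * indicator {0..2*pi} t \<partial>lborel)"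

lemma measurable_avg_integrand:
  "(\<lambda>(om, t). ennreal (weight (complex_of_real r * cis t) om k)
      * ennreal (sqrt (cmod (res (L - {k}) (complex_of_real r * cis t) om k m)))
      * indicator {0..2*pi} t) \<in> borel_measurable (Prob \<Otimes>\<^sub>M lborel)"
proof -
  have z: "(\<lambda>p. complex_of_real r * cis (snd p)) \<in> borel_measurable (Prob \<Otimes>\<^sub>M lborel)"
    by measurable
  have om: "(\<lambda>p. fst p x) \<in> borel_measurable (Prob \<Otimes>\<^sub>M lborel)" for x
    by (rule measurable_compose[OF measurable_fst measurable_Prob_component])
  have r: "(\<lambda>p. res A (complex_of_real r * cis (snd p)) (fst p) k m) \<in> borel_measurable (Prob \<Otimes>\<^sub>M lborel)" for A m
    by (rule measurable_res[OF z om])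
  note [measurable] = r[of L k] r[of "L - {k}" m]
  show ?thesis unfolding weight_def case_prod_beta' by measurable
qed

lemma measurable_avg: "avg r m k \<in> borel_measurable Prob"
  using lborel.borel_measurable_nn_integral[OF measurable_avg_integrand[of r k m]]
  by (simp add: avg_def[abs_def])

text \<open>For each \<open>t\<close> the weight integrates out, as the other factor does not
  involve \<open>om k\<close>; the decay estimate for the network without \<open>k\<close> does the
  rest, uniformly in \<open>r\<close>.\<close>

lemma nn_integral_avg:
  assumes r: "0 \<le> r" "r < 1" and k: "k \<in> L" and n: "3 * n \<le> ldist m k"
  shows "(\<integral>\<^sup>+ om. avg r m k om \<partial>Prob) \<le> ennreal (2 * pi * C\<^sup>2 * (1/4) ^ n)"
proof -
  interpret P: prob_space Prob by (rule prob_space_Prob)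
  interpret pair_sigma_finite Prob lborel ..
  let ?z = "\<lambda>t. complex_of_real r * cis t"
  let ?g = "\<lambda>t om. ennreal (weight (?z t) om k) * ennreal (sqrt (cmod (res (L - {k}) (?z t) om k m)))"
  have z: "cmod (?z t) < 1" for t using r by (simp add: norm_mult)
  have g: "(\<integral>\<^sup>+ om. ?g t om \<partial>Prob) \<le> ennreal (C\<^sup>2 * (1/4) ^ n)" for t
  proof -
    have "(\<integral>\<^sup>+ om. ?g t om \<partial>Prob) = (\<integral>\<^sup>+ om. ennreal (sqrt (cmod (res (L - {k}) (?z t) om k m))) \<partial>Prob)"
    proof (rule nn_integral_weight[OF z k])
      show "(\<lambda>om. ennreal (sqrt (cmod (res (L - {k}) (?z t) om k m)))) \<in> borel_measurable Prob"
        using measurable_res_Prob[of "L - {k}" "?z t" k m, measurable] by measurable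
      have "res (L - {k}) (?z t) (om(k := u)) k = res (L - {k}) (?z t) om k" for om u
        by (rule res_cong) auto
      then show "ennreal (sqrt (cmod (res (L - {k}) (?z t) (om(k := u)) k m)))
        = ennreal (sqrt (cmod (res (L - {k}) (?z t) om k m)))" for om u by simp
    qed
    also have "\<dots> \<le> ennreal (C\<^sup>2 * (4 * C\<^sup>2 * sqrt s) ^ n)"
      using finL z n by (intro nn_integral_res_decay) auto
    also have "\<dots> \<le> ennreal (C\<^sup>2 * (1/4) ^ n)"
      using C_s s_nonneg by (intro ennreal_leI mult_left_mono power_mono) auto
    finally show ?thesis .
  qed
  have "(\<integral>\<^sup>+ om. avg r m k om \<partial>Prob) = (\<integral>\<^sup>+ t. \<integral>\<^sup>+ om. ?g t om * indicator {0..2*pi} t \<partial>Prob \<partial>lborel)"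
    unfolding avg_def
    using Fubini'[of "\<lambda>om t. ?g t om * indicator {0..2*pi} t"] measurable_avg_integrand[of r k m] by simp
  also have "\<dots> \<le> (\<integral>\<^sup>+ t. ennreal (C\<^sup>2 * (1/4) ^ n) * indicator {0..2*pi} t \<partial>lborel)"
    using g by (intro nn_integral_mono) (auto simp: indicator_def)
  also have "\<dots> = ennreal (C\<^sup>2 * (1/4) ^ n) * ennreal (2 * pi)"
    by (subst nn_integral_cmult_indicator) auto
  also have "\<dots> = ennreal (2 * pi * C\<^sup>2 * (1/4) ^ n)"
    by (simp add: mult_ac flip: ennreal_mult)
  finally show ?thesis .
qed

lemma res_quotient:
  assumes z: "cmod z < 1" and k: "k \<in> L"
  shows "cmod (res (L - {k}) z om k m) = cmod (res L z om k m) / cmod (res L z om k k)"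
proof -
  define A where "A = L - {k}"
  have A: "finite A" "k \<notin> A" "L = insert k A" using finL k by (auto simp: A_def)
  have c: "1 - z * unimod (om k) * amp A z om k k \<noteq> 0"
    using one_minus_nonzero[OF z] amp_le_1[OF A(1) z A(2,2)] by simp
  have "res L z om k x = res A z om k x / (1 - z * unimod (om k) * amp A z om k k)" for x
    using res_insert_source[OF A(1) z A(2)] unfolding A(3)[symmetric] by simp
  then show ?thesis
    using c res_source[OF A(1) z A(2), of om] by (simp add: norm_divide flip: A_def)
qed

text \<open>At \<open>z = cnj l\<close> the entries \<open>res L z om k x\<close> blow up like
  \<open>w l x / (1 - z * l)\<close>. The poles cancel in the quotient of two entries, which tends
  to \<open>w l m / w l k\<close> with \<open>w l k\<close> equal to the mass.\<close>

lemma res_near_eigenvalue: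
  assumes k: "k \<in> L" and rep: "FI.spectral_rep om k E w" and l: "l \<in> E" and eta: "eta > 0"
  shows "\<exists>d>0. \<forall>z. cmod z < 1 \<longrightarrow> cmod (1 - z * l) < d \<longrightarrow>
    sqrt (cmod (w l m) / nsq L (w l)) - eta \<le> sqrt (cmod (res (L - {k}) z om k m))"
proof -
  have fE: "finite E" by (rule FI.rep_finite[OF k rep])
  have l1: "cmod l = 1" by (rule FI.rep_unit[OF k rep l])
  have ll: "l * cnj l = 1" "cnj l * l = 1" using l1 by (simp_all add: complex_norm_square[symmetric] mult.commute)
  have mpos: "nsq L (w l) > 0" by (rule FI.rep_mass_pos[OF k rep l])
  \<comment> \<open>\<open>(1 - z * l) * res L z om k x\<close> with the removable singularity at
    \<open>cnj l\<close> filled in.\<close>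
  define f where "f = (\<lambda>x z. w l x + (1 - z * l) * (\<Sum>j\<in>E - {l}. w j x / (1 - z * j)))"
  have nz: "1 - cnj l * j \<noteq> 0" if "j \<in> E - {l}" for j
  proof
    assume "1 - cnj l * j = 0"
    then have "l * (cnj l * j) = l" by simp
    then have "j = l" using ll by (simp add: mult.assoc[symmetric])
    then show False using that by simp
  qed
  have cf: "isCont (f x) (cnj l)" for x
    unfolding f_def using nz by (intro continuous_intros) auto
  have f0: "f x (cnj l) = w l x" for x by (simp add: f_def ll)
  define g where "g = (\<lambda>z. sqrt (cmod (f m z) / cmod (f k z)))"
  have "f k (cnj l) \<noteq> 0" using mpos by (simp add: f0 FI.rep_mass[OF k rep l])
  then have "isCont g (cnj l)"
    unfolding g_def by (intro continuous_intros cf) auto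
  moreover have "g (cnj l) = sqrt (cmod (w l m) / nsq L (w l))"
    by (simp add: g_def f0 FI.rep_mass[OF k rep l])
  ultimately obtain d where d: "d > 0" "\<And>z. dist z (cnj l) < d \<Longrightarrow>
      dist (g z) (sqrt (cmod (w l m) / nsq L (w l))) < eta"
    using eta unfolding continuous_at_eps_delta by metis
  have "sqrt (cmod (w l m) / nsq L (w l)) - eta \<le> sqrt (cmod (res (L - {k}) z om k m))"
    if z: "cmod z < 1" and zd: "cmod (1 - z * l) < d" for z
  proof -
    have "z - cnj l = (z * l - 1) * cnj l" using ll by (simp add: algebra_simps)
    then have "dist z (cnj l) = cmod (1 - z * l)"
      using l1 by (simp add: dist_norm norm_mult norm_minus_commute)
    then have gd: "sqrt (cmod (w l m) / nsq L (w l)) - eta \<le> g z"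
      using d(2)[of z] zd by (simp add: dist_real_def)
    have nzl: "1 - z * l \<noteq> 0" using one_minus_nonzero[OF z, of l 1] l1 by simp
    have fr: "f x z = (1 - z * l) * res L z om k x" for x
      unfolding res_spectral[OF z k rep] f_def using nzl
      by (simp add: sum.remove[OF fE l] distrib_left)
    have "g z = sqrt (cmod (res (L - {k}) z om k m))"
      unfolding g_def fr res_quotient[OF z k] using nzl by (simp add: norm_mult)
    then show ?thesis using gd by simp
  qed
  then show ?thesis using d(1) by blast
qed

end

context unitary_box
begin

text \<open>For \<open>r\<close> near 1 the weight concentrates at the eigenvalues, where the
  quotient is close to its limit. For each \<open>l\<close> only the arc of length
  \<open>1 - r\<close> starting at the angle \<open>t0 l\<close> of \<open>cnj l\<close> is kept:
  the Poisson kernel is at least \<open>1 / (4 * (1 - r))\<close> there, so a quarter of the mass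
  survives. Overlapping arcs are harmless because every eigenvalue has its own summand in the
  weight.\<close>

lemma avg_lower_bound:
  assumes k: "k \<in> L" and rep: "FI.spectral_rep om k E w" and eta: "eta > 0"
  shows "\<exists>d>0. \<forall>r. 1 - d < r \<longrightarrow> r < 1 \<longrightarrow>
    ennreal (((\<Sum>l\<in>E. nsq L (w l) * sqrt (cmod (w l m) / nsq L (w l))) - eta) / 4) \<le> avg r m k om"
proof -
  have fE: "finite E" by (rule FI.rep_finite[OF k rep])
  have mpos: "nsq L (w l) > 0" if "l \<in> E" for l by (rule FI.rep_mass_pos[OF k rep that])
  let ?v = "\<lambda>l. sqrt (cmod (w l m) / nsq L (w l)) - eta"
  define t0 where "t0 = (\<lambda>l::complex. Arg2pi (cnj l))"
  have t0: "0 \<le> t0 l" "t0 l < 2 * pi" for l using Arg2pi[of "cnj l"] by (auto simp: t0_def)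
  have t0l: "cis (t0 l) * l = 1" if "l \<in> E" for l
  proof -
    have l1: "cmod l = 1" by (rule FI.rep_unit[OF k rep that])
    have "cis (t0 l) = cnj l"
      using Arg2pi_eq[of "cnj l"] l1 by (simp add: t0_def cis_conv_exp)
    then show ?thesis using l1 by (simp add: complex_norm_square[symmetric] mult.commute)
  qed
  obtain dl where dl: "\<And>l. l \<in> E \<Longrightarrow> dl l > 0"
    "\<And>l z. l \<in> E \<Longrightarrow> cmod z < 1 \<Longrightarrow> cmod (1 - z * l) < dl l \<Longrightarrow> ?v l \<le> sqrt (cmod (res (L - {k}) z om k m))"
    using res_near_eigenvalue[OF k rep _ eta, of _ m] by metis
  \<comment> \<open>\<open>dl l / 2\<close> since \<open>cmod (1 - z * l) \<le> 2 * (1 - r)\<close>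
    on the arc, \<open>2 * pi - t0 l\<close> to keep the arc inside the interval of integration, and
    1 to keep \<open>r\<close> positive.\<close>
  define d where "d = Min (insert 1 ((\<lambda>l. min (dl l / 2) (2 * pi - t0 l)) ` E))"
  have d0: "d > 0" unfolding d_def using fE dl(1) t0(2) by (subst Min_gr_iff) auto
  have d1: "d \<le> 1" unfolding d_def using fE by (intro Min_le) auto
  have dE: "d \<le> dl l / 2" "d \<le> 2 * pi - t0 l" if "l \<in> E" for l
  proof -
    have "d \<le> min (dl l / 2) (2 * pi - t0 l)" unfolding d_def using fE that by (intro Min_le) auto
    then show "d \<le> dl l / 2" "d \<le> 2 * pi - t0 l" by auto
  qed
  have "ennreal (((\<Sum>l\<in>E. nsq L (w l) * sqrt (cmod (w l m) / nsq L (w l))) - eta) / 4) \<le> avg r m k om"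
    if r: "1 - d < r" "r < 1" for r
  proof -
    have r0: "0 < r" using r d1 by simp
    let ?z = "\<lambda>t. complex_of_real r * cis t"
    let ?R = "\<lambda>t. sqrt (cmod (res (L - {k}) (?z t) om k m))"
    let ?P = "\<lambda>l t. nsq L (w l) * ((1 - (cmod (?z t))\<^sup>2) / (cmod (1 - ?z t * l))\<^sup>2)"
    have z1: "cmod (?z t) < 1" "cmod (?z t) = r" for t using r0 r by (simp_all add: norm_mult)
    have P0: "0 \<le> ?P l t" for l t
      using z1[of t] r0 r by (simp add: abs_square_le_1)
    have [measurable]: "?R \<in> borel_measurable lborel"
    proof -
      have "?z \<in> borel_measurable lborel" by measurable
      then have [measurable]: "(\<lambda>t. res (L - {k}) (?z t) om k m) \<in> borel_measurable lborel"
        by (rule measurable_res) auto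
      show ?thesis by measurable
    qed
    have [measurable]: "?P l \<in> borel_measurable lborel" for l by measurable
    have low: "ennreal (nsq L (w l) * ?v l / 4)
      \<le> (\<integral>\<^sup>+ t. ennreal (?P l t) * ennreal (?R t) * indicator {0..2*pi} t \<partial>lborel)" if l: "l \<in> E" for l
    \<comment> \<open>A negative lower value is truncated to 0 by \<open>ennreal\<close>.\<close>
    proof (cases "?v l \<ge> 0")
      case False
      then have "nsq L (w l) * ?v l / 4 \<le> 0" using mpos[OF l] by (simp add: mult_le_0_iff)
      then show ?thesis by (simp add: ennreal_neg)
    next
      case True
      have l1: "cmod l = 1" by (rule FI.rep_unit[OF k rep l])
      let ?c = "nsq L (w l) * (1 / (4 * (1 - r))) * ?v l"
      have "x * v / 4 = x * (1 / (4 * (1 - r))) * v * (1 - r)" for x v :: real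
        using r by (simp add: divide_simps)
      then have "ennreal (nsq L (w l) * ?v l / 4) = ennreal (?c * (1 - r))" by (rule arg_cong)
      also have "\<dots> = ennreal ?c * ennreal (1 - r)"
        using True mpos[OF l] r by (intro ennreal_mult mult_nonneg_nonneg) auto
      finally have "ennreal (nsq L (w l) * ?v l / 4) = ennreal ?c * ennreal (1 - r)" .
      also have "\<dots> = (\<integral>\<^sup>+ t. ennreal ?c * indicator {t0 l..t0 l + (1 - r)} t \<partial>lborel)"
        using r by (subst nn_integral_cmult_indicator) auto
      also have "\<dots> \<le> (\<integral>\<^sup>+ t. ennreal (?P l t) * ennreal (?R t) * indicator {0..2*pi} t \<partial>lborel)"
      proof (rule nn_integral_mono)
        fix t
        show "ennreal ?c * indicator {t0 l..t0 l + (1 - r)} t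
          \<le> ennreal (?P l t) * ennreal (?R t) * indicator {0..2*pi} t"
        proof (cases "t \<in> {t0 l..t0 l + (1 - r)}")
          case t: True
          define tau where "tau = t - t0 l"
          have tau: "0 \<le> tau" "tau \<le> 1 - r" using t by (auto simp: tau_def)
          have "?z t * l = complex_of_real r * cis tau * (cis (t0 l) * l)"
            by (simp add: tau_def cis_mult[symmetric] mult_ac flip: cis_divide)
          then have zl: "?z t * l = complex_of_real r * cis tau" by (simp add: t0l[OF l])
          have "cmod (1 - ?z t * l) \<le> 2 * (1 - r)"
          proof -
            have "1 - ?z t * l = complex_of_real (1 - r) + complex_of_real r * (1 - cis tau)"
              unfolding zl by (simp add: algebra_simps)
            then have "cmod (1 - ?z t * l) \<le> (1 - r) + r * cmod (1 - cis tau)"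
              using norm_triangle_ineq[of "complex_of_real (1 - r)" "complex_of_real r * (1 - cis tau)"] r r0
              by (simp add: norm_mult del: of_real_diff)
            also have "\<dots> \<le> (1 - r) + 1 * tau"
            proof (intro add_left_mono mult_mono)
              have "cmod (cis tau - 1) \<le> \<bar>tau\<bar>"
                using dist_exp_i_1[of tau] abs_sin_x_le_abs_x[of "tau / 2"] by (simp add: cis_conv_exp)
              then show "cmod (1 - cis tau) \<le> tau" using tau by (simp add: norm_minus_commute)
            qed (use r r0 in auto)
            finally show ?thesis using tau by simp
          qed
          note dz = this
          have "2 * d \<le> dl l" using dE(1)[OF l] by simp
          moreover have "1 - r < d" using r by simp
          ultimately have "2 * (1 - r) < dl l" by simp
          with dz have "cmod (1 - ?z t * l) < dl l" by (rule order.strict_trans1)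
          then have vR: "?v l \<le> ?R t" using dl(2)[OF l z1(1)] by blast
          have nz: "cmod (1 - ?z t * l) > 0"
            using one_minus_nonzero[OF z1(1), of l 1 t] l1 by simp
          have "1 / (4 * (1 - r)) \<le> (1 + r) / (4 * (1 - r))"
            using r r0 by (intro divide_right_mono) auto
          also have "\<dots> = (1 + r) * (1 - r) / (2 * (1 - r))\<^sup>2"
          proof -
            have "x / (4 * q) = x * q / (2 * q)\<^sup>2" if "q > 0" for x q :: real
              using that by (simp add: power2_eq_square)
            from this[of "1 - r" "1 + r"] show ?thesis using r(2) by argo
          qed
          also have "\<dots> \<le> (1 + r) * (1 - r) / (cmod (1 - ?z t * l))\<^sup>2"
            using dz nz r r0 by (intro divide_left_mono power_mono) auto
          also have "\<dots> = (1 - (cmod (?z t))\<^sup>2) / (cmod (1 - ?z t * l))\<^sup>2"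
            unfolding z1(2) by (simp add: power2_eq_square algebra_simps)
          finally have "nsq L (w l) * (1 / (4 * (1 - r))) \<le> ?P l t"
            by (rule mult_left_mono) simp
          then have "?c \<le> ?P l t * ?R t" by (rule mult_mono[OF _ vR P0 True])
          then have "ennreal ?c \<le> ennreal (?P l t) * ennreal (?R t)"
            using P0 by (simp add: ennreal_leI flip: ennreal_mult)
          moreover have "t \<in> {0..2*pi}" using t t0[of l] dE(2)[OF l] r by auto
          ultimately show ?thesis using t by simp
        qed simp
      qed
      finally show ?thesis .
    qed
    have msum: "(\<Sum>l\<in>E. nsq L (w l)) = 1" by (rule FI.rep_mass_sum[OF k rep])
    have "((\<Sum>l\<in>E. nsq L (w l) * sqrt (cmod (w l m) / nsq L (w l))) - eta) / 4
      = (\<Sum>l\<in>E. nsq L (w l) * ?v l / 4)"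
    proof -
      have "(\<Sum>l\<in>E. nsq L (w l) * ?v l) = (\<Sum>l\<in>E. nsq L (w l) * sqrt (cmod (w l m) / nsq L (w l))) - (\<Sum>l\<in>E. nsq L (w l)) * eta"
        by (simp add: right_diff_distrib sum_subtractf sum_distrib_right)
      then show ?thesis using msum by (simp add: sum_divide_distrib[symmetric])
    qed
    also have "ennreal (\<Sum>l\<in>E. nsq L (w l) * ?v l / 4) \<le> ennreal (\<Sum>l\<in>E. max 0 (nsq L (w l) * ?v l / 4))"
      by (intro ennreal_leI sum_mono) auto
    also have "\<dots> = (\<Sum>l\<in>E. ennreal (max 0 (nsq L (w l) * ?v l / 4)))"
      by (intro sum_ennreal[symmetric]) auto
    also have "\<dots> = (\<Sum>l\<in>E. ennreal (nsq L (w l) * ?v l / 4))"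
      by (intro sum.cong) (auto simp: max_def ennreal_neg)
    also have "\<dots> \<le> (\<Sum>l\<in>E. (\<integral>\<^sup>+ t. ennreal (?P l t) * ennreal (?R t) * indicator {0..2*pi} t \<partial>lborel))"
      by (intro sum_mono low)
    also have "\<dots> = (\<integral>\<^sup>+ t. (\<Sum>l\<in>E. ennreal (?P l t) * ennreal (?R t) * indicator {0..2*pi} t) \<partial>lborel)"
      by (rule nn_integral_sum[symmetric]) measurable
    also have "\<dots> = avg r m k om"
      unfolding avg_def
    proof (intro nn_integral_cong)
      fix t
      have "ennreal (weight (?z t) om k) = (\<Sum>l\<in>E. ennreal (?P l t))"
        unfolding weight_spectral[OF z1(1) k rep] using P0 by (intro sum_ennreal[symmetric])
      then show "(\<Sum>l\<in>E. ennreal (?P l t) * ennreal (?R t) * indicator {0..2*pi} t)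
        = ennreal (weight (?z t) om k) * ennreal (?R t) * indicator {0..2*pi} t"
        by (simp add: sum_distrib_right)
    qed
    finally show ?thesis .
  qed
  then show ?thesis using d0 by blast
qed

text \<open>A fixed sequence tending to 1 makes the boundary limit a countable
  \<open>liminf\<close>, which stays measurable.\<close>

definition radius :: "nat \<Rightarrow> real" where
  "radius j = 1 - 1 / (real j + 2)"

lemma radius: "0 \<le> radius j" "radius j < 1"
  by (simp_all add: radius_def field_simps)

lemma radius_eventually: "d > 0 \<Longrightarrow> eventually (\<lambda>j. 1 - d < radius j) sequentially"
proof -
  assume d: "d > 0"
  have "radius \<longlonglongrightarrow> 1" unfolding radius_def by real_asymp
  then show ?thesis using d by (intro order_tendstoD) auto
qed

text \<open>The shape comes from \<open>rho \<le> a * sqrt rho + rho\<^sup>2 / a\<^sup>2\<close>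
  with \<open>a = 2 ^ (ldist m k div 3)\<close>: \<open>avg\<close> controls the first term, the
  factor 4 undoing the loss in \<open>avg_lower_bound\<close>, and Bessel's inequality the second.
  Built from resolvents instead of eigenvectors, it is visibly measurable.\<close>

definition majorant :: "site \<Rightarrow> site \<Rightarrow> (site \<Rightarrow> complex) \<Rightarrow> ennreal" where
  "majorant m k om = ennreal (4 * 2 ^ (ldist m k div 3)) * liminf (\<lambda>j. avg (radius j) m k om)
     + ennreal ((1/4) ^ (ldist m k div 3))"

lemma measurable_majorant: "majorant m k \<in> borel_measurable Prob"
proof -
  have "majorant m k = (\<lambda>om. ennreal (4 * 2 ^ (ldist m k div 3)) * liminf (\<lambda>j. avg (radius j) m k om)
     + ennreal ((1/4) ^ (ldist m k div 3)))"
    by (rule ext) (simp add: majorant_def)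
  moreover have "(\<lambda>om. liminf (\<lambda>j. avg (radius j) m k om)) \<in> borel_measurable Prob"
    by (intro borel_measurable_liminf) (rule measurable_avg)
  ultimately show ?thesis by simp
qed

text \<open>Fatou's lemma in the radius; the factor \<open>2 ^ ?n\<close> reduces the decay
  \<open>(1/4) ^ ?n\<close> to \<open>(1/2) ^ ?n\<close>.\<close>

lemma nn_integral_majorant:
  assumes "k \<in> L"
  shows "(\<integral>\<^sup>+ om. majorant m k om \<partial>Prob) \<le> ennreal ((8 * pi * C\<^sup>2 + 1) * (1/2) ^ (ldist m k div 3))"
proof -
  interpret P: prob_space Prob by (rule prob_space_Prob)
  let ?n = "ldist m k div 3"
  have meas: "(\<lambda>om. liminf (\<lambda>j. avg (radius j) m k om)) \<in> borel_measurable Prob"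
    by (intro borel_measurable_liminf) (rule measurable_avg)
  have "(\<integral>\<^sup>+ om. liminf (\<lambda>j. avg (radius j) m k om) \<partial>Prob)
    \<le> liminf (\<lambda>j. \<integral>\<^sup>+ om. avg (radius j) m k om \<partial>Prob)"
    by (rule nn_integral_liminf) (rule measurable_avg)
  also have "\<dots> \<le> liminf (\<lambda>j::nat. ennreal (2 * pi * C\<^sup>2 * (1/4) ^ ?n))"
    using nn_integral_avg[OF radius assms, of ?n m] by (intro Liminf_mono always_eventually) auto
  also have "\<dots> = ennreal (2 * pi * C\<^sup>2 * (1/4) ^ ?n)"
    by (rule Liminf_const) simp
  finally have 1: "(\<integral>\<^sup>+ om. liminf (\<lambda>j. avg (radius j) m k om) \<partial>Prob) \<le> ennreal (2 * pi * C\<^sup>2 * (1/4) ^ ?n)" .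
  have "(\<integral>\<^sup>+ om. majorant m k om \<partial>Prob)
    = ennreal (4 * 2 ^ ?n) * (\<integral>\<^sup>+ om. liminf (\<lambda>j. avg (radius j) m k om) \<partial>Prob) + ennreal ((1/4) ^ ?n) * emeasure Prob (space Prob)"
    unfolding majorant_def using meas by (simp add: nn_integral_add nn_integral_cmult)
  also have "\<dots> \<le> ennreal (4 * 2 ^ ?n) * ennreal (2 * pi * C\<^sup>2 * (1/4) ^ ?n) + ennreal ((1/4) ^ ?n)"
    using 1 by (intro add_mono mult_left_mono) (auto simp: P.emeasure_space_1[simplified])
  also have "\<dots> = ennreal ((4 * 2 ^ ?n) * (2 * pi * C\<^sup>2 * (1/4) ^ ?n) + (1/4) ^ ?n)"
    by (subst ennreal_mult[symmetric], simp, simp, subst ennreal_plus) auto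
  also have "\<dots> \<le> ennreal ((8 * pi * C\<^sup>2 + 1) * (1/2) ^ ?n)"
  proof (rule ennreal_leI)
    have "(2::real) ^ ?n * (1/4) ^ ?n = (1/2) ^ ?n"
      by (simp add: power_mult_distrib[symmetric])
    moreover have "(1/4::real) ^ ?n \<le> (1/2) ^ ?n" by (rule power_mono) auto
    ultimately show "(4 * 2 ^ ?n) * (2 * pi * C\<^sup>2 * (1/4) ^ ?n) + (1/4) ^ ?n \<le> (8 * pi * C\<^sup>2 + 1) * (1/2) ^ ?n"
      by (simp add: algebra_simps)
  qed
  finally show ?thesis .
qed

text \<open>Let \<open>rho\<close> be the ratio \<open>cmod (w l m) / nsq L (w l)\<close>. The
  correlator is the mean of \<open>rho\<close> with respect to the spectral masses, the averages
  control the mean of \<open>sqrt rho\<close>, and Bessel's inequality bounds the mean of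
  \<open>rho\<^sup>2\<close> by 1. The first moment follows by interpolation.\<close>

lemma spectral_correlator_le:
  assumes k: "k \<in> L" and m: "m \<in> L" and rep: "FI.spectral_rep om k E w"
  shows "ennreal (\<Sum>l\<in>E. cmod (w l m)) \<le> majorant m k om"
proof -
  let ?n = "ldist m k div 3"
  let ?rho = "\<lambda>l. cmod (w l m) / nsq L (w l)"
  define V where "V = (\<Sum>l\<in>E. nsq L (w l) * sqrt (?rho l))"
  have mpos: "nsq L (w l) > 0" if "l \<in> E" for l by (rule FI.rep_mass_pos[OF k rep that])
  have V0: "V \<ge> 0" unfolding V_def by (intro sum_nonneg) auto
  have lim: "ennreal (V / 4) \<le> liminf (\<lambda>j. avg (radius j) m k om)"
  proof (rule ennreal_le_epsilon)
    fix eta :: real assume eta: "0 < eta"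
    obtain d where d: "d > 0" "\<And>r. 1 - d < r \<Longrightarrow> r < 1 \<Longrightarrow> ennreal ((V - eta) / 4) \<le> avg r m k om"
      using avg_lower_bound[OF k rep eta, of m] unfolding V_def by blast
    have "ennreal ((V - eta) / 4) \<le> liminf (\<lambda>j. avg (radius j) m k om)"
      by (rule Liminf_bounded) (use radius_eventually[OF d(1)] in eventually_elim, simp add: d(2) radius)
    then have "ennreal ((V - eta) / 4) + ennreal (eta / 4) \<le> liminf (\<lambda>j. avg (radius j) m k om) + ennreal eta"
      using eta by (intro add_mono ennreal_leI) auto
    moreover have "ennreal (V / 4) \<le> ennreal ((V - eta) / 4) + ennreal (eta / 4)"
    proof (cases "V \<ge> eta")
      case True
      then show ?thesis using eta by (simp add: diff_divide_distrib flip: ennreal_plus)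
    next
      case False
      then have "ennreal (V / 4) \<le> ennreal (eta / 4)" by (intro ennreal_leI) auto
      then show ?thesis by (simp add: add_increasing)
    qed
    ultimately show "ennreal (V / 4) \<le> liminf (\<lambda>j. avg (radius j) m k om) + ennreal eta"
      by (rule order_trans[rotated])
  qed
  have tm: "cmod (w l m) \<le> 2 ^ ?n * (nsq L (w l) * sqrt (?rho l)) + (1/4) ^ ?n * ((cmod (w l m))\<^sup>2 / nsq L (w l))"
    if l: "l \<in> E" for l
  proof -
    define a :: real where "a = 2 ^ ?n"
    have a: "a \<ge> 1" by (simp add: a_def)
    have a2: "(1/4) ^ ?n = 1 / a\<^sup>2"
      by (simp add: a_def power_divide power_mult[symmetric] mult.commute[of _ 2])
         (simp add: power_mult)
    have r0: "0 \<le> ?rho l" by simp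
    have "?rho l \<le> a * sqrt (?rho l) + (?rho l)\<^sup>2 / a\<^sup>2"
    \<comment> \<open>If the root is at most \<open>a\<close>, one of the two roots in
      \<open>?rho l\<close> is replaced by \<open>a\<close>; otherwise
      \<open>?rho l \<ge> a\<^sup>2\<close>, so multiplication by \<open>?rho l / a\<^sup>2\<close>
      only enlarges.\<close>
    proof (cases "sqrt (?rho l) \<le> a")
      case True
      have "?rho l = sqrt (?rho l) * sqrt (?rho l)" by (metis r0 real_sqrt_mult_self abs_of_nonneg)
      also have "\<dots> \<le> a * sqrt (?rho l)" using True r0 by (intro mult_right_mono) auto
      also have "\<dots> \<le> a * sqrt (?rho l) + (?rho l)\<^sup>2 / a\<^sup>2" by simp
      finally show ?thesis .
    next
      case False
      then have "a * a \<le> sqrt (?rho l) * sqrt (?rho l)" using a by (intro mult_mono) auto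
      then have "a\<^sup>2 \<le> ?rho l" using r0 by (metis abs_of_nonneg power2_eq_square real_sqrt_mult_self)
      then have "?rho l * a\<^sup>2 \<le> ?rho l * ?rho l" using r0 by (intro mult_left_mono) auto
      then have "?rho l \<le> (?rho l)\<^sup>2 / a\<^sup>2" using a
        by (subst pos_le_divide_eq) (auto simp: power2_eq_square)
      moreover have "0 \<le> a * sqrt (?rho l)" using a r0 by auto
      ultimately show ?thesis by linarith
    qed
    then have "nsq L (w l) * ?rho l \<le> nsq L (w l) * (a * sqrt (?rho l) + (?rho l)\<^sup>2 / a\<^sup>2)"
      by (intro mult_left_mono) auto
    then show ?thesis unfolding a2 a_def[symmetric] using mpos[OF l]
      by (simp add: power2_eq_square field_simps)
  qed
  have "(\<Sum>l\<in>E. cmod (w l m)) \<le> 2 ^ ?n * V + (1/4) ^ ?n * (\<Sum>l\<in>E. (cmod (w l m))\<^sup>2 / nsq L (w l))"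
    unfolding V_def sum_distrib_left sum.distrib[symmetric] by (rule sum_mono) (rule tm)
  also have "\<dots> \<le> 2 ^ ?n * V + (1/4) ^ ?n * 1"
    by (intro add_left_mono mult_left_mono FI.rep_bessel[OF k rep m]) auto
  finally have "ennreal (\<Sum>l\<in>E. cmod (w l m)) \<le> ennreal (2 ^ ?n * V + (1/4) ^ ?n)"
    by (intro ennreal_leI) simp
  also have "\<dots> = ennreal (4 * 2 ^ ?n) * ennreal (V / 4) + ennreal ((1/4) ^ ?n)"
    using V0 by (simp flip: ennreal_mult ennreal_plus)
  also have "\<dots> \<le> majorant m k om"
    unfolding majorant_def by (intro add_right_mono mult_left_mono lim) auto
  finally show ?thesis .
qed

end

section \<open>Fejer means\<close>

definition fejer_kernel :: "nat \<Rightarrow> complex \<Rightarrow> real" where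
  "fejer_kernel N v = (cmod (\<Sum>j\<le>N. v ^ j))\<^sup>2 / real (N + 1)"

lemma fejer_kernel_nonneg: "0 \<le> fejer_kernel N v"
  by (simp add: fejer_kernel_def)

lemma int_symmetric_interval_Suc:
  "{- int (Suc N)..int (Suc N)} = insert (- int (Suc N)) (insert (int (Suc N)) {- int N..int N})"
  by auto

text \<open>Passing from \<open>N\<close> to \<open>Suc N\<close> raises every coefficient by 1,
  which adds the Dirichlet sum \<open>D\<close>; on the left this sum arises from the products with
  the new power \<open>v ^ Suc N\<close> and its conjugate.\<close>

lemma cmod_sum_powers:
  assumes v: "cmod v = 1"
  shows "complex_of_real ((cmod (\<Sum>j\<le>N. v ^ j))\<^sup>2)
    = (\<Sum>k\<in>{- int N..int N}. (of_nat (N + 1) - of_int \<bar>k\<bar>) * v powi k)"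
proof (induction N)
  case 0
  then show ?case by simp
next
  case (Suc N)
  let ?S = "\<Sum>j\<le>N. v ^ j"
  have v0: "v \<noteq> 0" and vc: "v * cnj v = 1"
    using v by (auto simp: complex_norm_square[symmetric])
  have ci: "cnj v = inverse v" using vc v0 by (simp add: field_simps)
  have D: "(\<Sum>k\<in>{- int M..int M}. v powi k) = 1 + (\<Sum>j<M. v ^ Suc j) + (\<Sum>j<M. inverse v ^ Suc j)" for M
  proof (induction M)
    case (Suc M)
    have p: "v powi (- int (Suc M)) = inverse v ^ Suc M" "v powi int (Suc M) = v ^ Suc M"
      by (simp_all only: power_int_minus power_int_of_nat power_inverse)
    have "(\<Sum>k\<in>{- int (Suc M)..int (Suc M)}. v powi k)
      = v powi (- int (Suc M)) + (v powi int (Suc M) + (\<Sum>k\<in>{- int M..int M}. v powi k))"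
      unfolding int_symmetric_interval_Suc by (subst sum.insert, simp, simp, subst sum.insert) simp_all
    then show ?case unfolding p Suc.IH by simp
  qed simp
  have "complex_of_real ((cmod (\<Sum>j\<le>Suc N. v ^ j))\<^sup>2) = (?S + v ^ Suc N) * (cnj ?S + cnj v ^ Suc N)"
    unfolding complex_norm_square by simp
  also have "\<dots> = ?S * cnj ?S + ?S * inverse v ^ Suc N + v ^ Suc N * cnj ?S + 1"
    using v0 by (simp add: ci algebra_simps power_inverse)
  also have "?S * inverse v ^ Suc N = (\<Sum>j<Suc N. inverse v ^ Suc j)"
  proof -
    have "?S * inverse v ^ Suc N = (\<Sum>j<Suc N. v ^ j * inverse v ^ Suc N)"
      by (simp add: sum_distrib_right lessThan_Suc_atMost)
    also have "\<dots> = (\<Sum>j<Suc N. inverse v ^ Suc (Suc N - Suc j))"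
    proof (intro sum.cong refl)
      fix j assume "j \<in> {..<Suc N}"
      then have "inverse v ^ Suc N = inverse v ^ j * inverse v ^ Suc (Suc N - Suc j)"
        by (simp flip: power_add power_Suc)
      then show "v ^ j * inverse v ^ Suc N = inverse v ^ Suc (Suc N - Suc j)"
        using v0 by (simp add: power_mult_distrib[symmetric] mult.assoc[symmetric])
    qed
    also have "\<dots> = (\<Sum>j<Suc N. inverse v ^ Suc j)"
      by (rule sum.nat_diff_reindex)
    finally show ?thesis .
  qed
  also have "v ^ Suc N * cnj ?S = (\<Sum>j<Suc N. v ^ Suc j)"
  proof -
    have "v ^ Suc N * cnj ?S = (\<Sum>j<Suc N. v ^ Suc N * inverse v ^ j)"
      by (simp add: sum_distrib_left lessThan_Suc_atMost ci)
    also have "\<dots> = (\<Sum>j<Suc N. v ^ Suc (Suc N - Suc j))"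
    proof (intro sum.cong refl)
      fix j assume "j \<in> {..<Suc N}"
      then have "v ^ Suc N = v ^ Suc (Suc N - Suc j) * v ^ j"
        by (simp flip: power_add power_Suc)
      then show "v ^ Suc N * inverse v ^ j = v ^ Suc (Suc N - Suc j)"
        using v0 by (simp add: power_mult_distrib[symmetric] mult.assoc)
    qed
    also have "\<dots> = (\<Sum>j<Suc N. v ^ Suc j)" by (rule sum.nat_diff_reindex)
    finally show ?thesis .
  qed
  finally have "complex_of_real ((cmod (\<Sum>j\<le>Suc N. v ^ j))\<^sup>2)
    = complex_of_real ((cmod ?S)\<^sup>2) + (\<Sum>k\<in>{- int (Suc N)..int (Suc N)}. v powi k)"
    unfolding D complex_norm_square by simp
  also have "\<dots> = (\<Sum>k\<in>{- int N..int N}. (of_nat (N + 1) - of_int \<bar>k\<bar>) * v powi k)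
      + (\<Sum>k\<in>{- int (Suc N)..int (Suc N)}. v powi k)" by (simp only: Suc.IH)
  also have "(\<Sum>k\<in>{- int N..int N}. (of_nat (N + 1) - of_int \<bar>k\<bar>) * v powi k)
    = (\<Sum>k\<in>{- int (Suc N)..int (Suc N)}. (of_nat (N + 1) - of_int \<bar>k\<bar>) * v powi k)"
    unfolding int_symmetric_interval_Suc by simp
  also have "\<dots> + (\<Sum>k\<in>{- int (Suc N)..int (Suc N)}. v powi k)
    = (\<Sum>k\<in>{- int (Suc N)..int (Suc N)}. (of_nat (Suc N + 1) - of_int \<bar>k\<bar>) * v powi k)"
    by (simp add: sum.distrib[symmetric] algebra_simps)
  finally show ?case .
qed

lemma fejer_kernel_sum:
  assumes "cmod v = 1"
  shows "complex_of_real (fejer_kernel N v)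
    = (\<Sum>k\<in>{- int N..int N}. complex_of_real (1 - real_of_int \<bar>k\<bar> / real (N + 1)) * v powi k)"
proof -
  have "complex_of_real (fejer_kernel N v)
    = (\<Sum>k\<in>{- int N..int N}. (of_nat (N + 1) - of_int \<bar>k\<bar>) * v powi k) / of_nat (N + 1)"
    by (simp only: fejer_kernel_def of_real_divide cmod_sum_powers[OF assms] of_real_of_nat_eq)
  also have "\<dots> = (\<Sum>k\<in>{- int N..int N}. complex_of_real (1 - real_of_int \<bar>k\<bar> / real (N + 1)) * v powi k)"
    unfolding sum_divide_distrib
  proof (intro sum.cong refl)
    fix k
    have "(of_nat (N + 1) - of_int \<bar>k\<bar>) / (of_nat (N + 1) :: complex) = complex_of_real (1 - real_of_int \<bar>k\<bar> / real (N + 1))"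
      by (simp add: diff_divide_distrib del: of_nat_Suc of_nat_add flip: of_int_abs)
    then show "(of_nat (N + 1) - of_int \<bar>k\<bar>) * v powi k / of_nat (N + 1)
      = complex_of_real (1 - real_of_int \<bar>k\<bar> / real (N + 1)) * v powi k"
      by (metis times_divide_eq_left)
  qed
  finally show ?thesis .
qed

text \<open>Away from 1 the geometric sum stays bounded while the normalization divides by
  \<open>N + 1\<close>.\<close>

lemma fejer_kernel_far:
  assumes "cmod v = 1" "d > 0" "d \<le> cmod (1 - v)"
  shows "fejer_kernel N v \<le> 4 / (real (N + 1) * d\<^sup>2)"
proof -
  have v1: "v \<noteq> 1" using assms by auto
  have "(\<Sum>j\<le>N. v ^ j) = (1 - v ^ Suc N) / (1 - v)"
    using sum_gp0[of v N] v1 by simp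
  then have "cmod (\<Sum>j\<le>N. v ^ j) \<le> 2 / cmod (1 - v)"
    using norm_triangle_ineq4[of 1 "v ^ Suc N"] assms(1)
    by (simp add: norm_divide norm_power divide_right_mono del: power_Suc)
  also have "\<dots> \<le> 2 / d" using assms v1 by (intro divide_left_mono) auto
  finally have "(cmod (\<Sum>j\<le>N. v ^ j))\<^sup>2 \<le> (2 / d)\<^sup>2" by (intro power_mono) auto
  then have "fejer_kernel N v \<le> (2 / d)\<^sup>2 / real (N + 1)"
    unfolding fejer_kernel_def by (intro divide_right_mono) auto
  also have "\<dots> = 4 / (real (N + 1) * d\<^sup>2)" by (simp add: power_divide mult.commute)
  finally show ?thesis .
qed

text \<open>The symbol of \<open>fejer_op\<close>: the same coefficients, with powers of a number in
  place of powers of the operator.\<close>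

definition fejer_mean :: "(complex \<Rightarrow> complex) \<Rightarrow> nat \<Rightarrow> complex \<Rightarrow> complex" where
  "fejer_mean f N z = (\<Sum>k\<in>{- int N..int N}.
     complex_of_real (1 - real_of_int \<bar>k\<bar> / real (N + 1)) * fourier_coeff f k * z powi k)"

lemma continuous_on_comp_cis:
  assumes "continuous_on circle f"
  shows "continuous_on S (\<lambda>t::real. f (cis t))"
  by (rule continuous_on_compose2[OF assms]) (auto intro!: continuous_intros simp: circle_def)

lemma cis_neg_powi:
  assumes "cmod z = 1"
  shows "(z * cis (- t)) powi k = z powi k * cis (- (real_of_int k) * t)"
  using cis_power_int[of "- t" k] by (simp add: power_int_mult_distrib mult.commute)

lemma fejer_mean_integral:
  assumes f: "continuous_on circle f" and z: "cmod z = 1"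
  shows "fejer_mean f N z = complex_of_real (1 / (2 * pi)) *
    integral {0..2*pi} (\<lambda>t. f (cis t) * complex_of_real (fejer_kernel N (z * cis (- t))))"
proof -
  let ?c = "\<lambda>k. complex_of_real (1 - real_of_int \<bar>k\<bar> / real (N + 1))"
  have i: "(\<lambda>t. f (cis t) * cis (- (real_of_int k) * t)) integrable_on {0..2*pi}" for k
    by (intro integrable_continuous_interval continuous_intros continuous_on_comp_cis[OF f])
  have "(\<lambda>t. f (cis t) * complex_of_real (fejer_kernel N (z * cis (- t))))
    = (\<lambda>t. \<Sum>k\<in>{- int N..int N}. ?c k * z powi k * (f (cis t) * cis (- (real_of_int k) * t)))"
    using z by (simp add: fejer_kernel_sum norm_mult cis_neg_powi sum_distrib_left mult_ac)
  then have "integral {0..2*pi} (\<lambda>t. f (cis t) * complex_of_real (fejer_kernel N (z * cis (- t))))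
    = (\<Sum>k\<in>{- int N..int N}. ?c k * z powi k * integral {0..2*pi} (\<lambda>t. f (cis t) * cis (- (real_of_int k) * t)))"
    by (simp only:) (intro integral_unique has_integral_sum has_integral_mult_right integrable_integral i finite_atLeastAtMost_int)
  then show ?thesis
    by (simp add: fejer_mean_def fourier_coeff_def sum_distrib_left mult_ac)
qed

lemma fourier_coeff_1: "fourier_coeff (\<lambda>_. 1) k = (if k = 0 then 1 else 0)"
proof (cases "k = 0")
  case False
  let ?F = "\<lambda>t::real. cis (- (real_of_int k) * t) / (- \<i> * of_int k)"
  have "((\<lambda>t. cis (- (real_of_int k) * t)) has_integral ?F (2*pi) - ?F 0) {0..2*pi}"
  proof (rule fundamental_theorem_of_calculus)
    show "(?F has_vector_derivative cis (- (real_of_int k) * t)) (at t within {0..2*pi})" for t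
      unfolding has_vector_derivative_def using False
      by (auto intro!: derivative_eq_intros simp: scaleR_conv_of_real field_simps)
  qed simp
  moreover have "cis (- (real_of_int k) * (2 * pi)) = 1"
    using cis_multiple_2pi[of "- real_of_int k"] by (simp add: mult_ac)
  ultimately have "((\<lambda>t. cis (- (real_of_int k) * t)) has_integral 0) {0..2*pi}" by simp
  then show ?thesis using False by (simp add: fourier_coeff_def integral_unique)
qed (simp add: fourier_coeff_def scaleR_conv_of_real)

lemma continuous_on_fejer_kernel: "continuous_on S (\<lambda>t. fejer_kernel N (z * cis (- t)))"
  unfolding fejer_kernel_def by (intro continuous_intros) auto

lemma integral_of_real_fejer_kernel:
  "integral {0..2*pi} (\<lambda>t. complex_of_real (fejer_kernel N (z * cis (- t))))
    = complex_of_real (integral {0..2*pi} (\<lambda>t. fejer_kernel N (z * cis (- t))))"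
proof -
  have "(\<lambda>t. fejer_kernel N (z * cis (- t))) integrable_on {0..2*pi}"
    by (intro integrable_continuous_interval continuous_on_fejer_kernel)
  from has_integral_linear[OF integrable_integral[OF this] bounded_linear_of_real]
  show ?thesis by (intro integral_unique) (simp add: o_def)
qed

text \<open>The convolution formula for the constant function 1, of which only the zeroth Fourier
  coefficient survives.\<close>

lemma integral_fejer_kernel:
  assumes "cmod z = 1"
  shows "integral {0..2*pi} (\<lambda>t. fejer_kernel N (z * cis (- t))) = 2 * pi"
proof -
  have "fejer_mean (\<lambda>_. 1) N z = (\<Sum>k\<in>{- int N..int N}. if k = 0 then 1 else 0)"
    unfolding fejer_mean_def by (intro sum.cong) (auto simp: fourier_coeff_1)
  then have "fejer_mean (\<lambda>_. 1) N z = 1" by simp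
  then have "complex_of_real (1 / (2 * pi)) * integral {0..2*pi} (\<lambda>t. complex_of_real (fejer_kernel N (z * cis (- t)))) = 1"
    using fejer_mean_integral[of "\<lambda>_. 1" z N] assms by simp
  then have "complex_of_real (1 / (2 * pi) * integral {0..2*pi} (\<lambda>t. fejer_kernel N (z * cis (- t)))) = 1"
    by (simp add: integral_of_real_fejer_kernel)
  then have "1 / (2 * pi) * integral {0..2*pi} (\<lambda>t. fejer_kernel N (z * cis (- t))) = 1"
    by (simp only: of_real_eq_1_iff)
  then show ?thesis by (simp add: field_simps)
qed

lemma fejer_mean_le_1:
  assumes f: "continuous_on circle f" and f1: "\<And>z. z \<in> circle \<Longrightarrow> cmod (f z) \<le> 1" and z: "cmod z = 1"
  shows "cmod (fejer_mean f N z) \<le> 1"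
proof -
  have "cmod (integral {0..2*pi} (\<lambda>t. f (cis t) * complex_of_real (fejer_kernel N (z * cis (- t)))))
    \<le> integral {0..2*pi} (\<lambda>t. fejer_kernel N (z * cis (- t)))"
  proof (rule integral_norm_bound_integral)
    show "cmod (f (cis t) * complex_of_real (fejer_kernel N (z * cis (- t)))) \<le> fejer_kernel N (z * cis (- t))" for t
      using f1[of "cis t"] fejer_kernel_nonneg[of N "z * cis (- t)"]
      by (simp add: norm_mult circle_def mult_left_le_one_le)
  qed (intro integrable_continuous_interval continuous_intros continuous_on_comp_cis[OF f] continuous_on_fejer_kernel)+
  then show ?thesis
    unfolding fejer_mean_integral[OF f z] integral_fejer_kernel[OF z] norm_mult norm_of_real by (simp add: field_simps)
qed

text \<open>Approximate identity: uniform continuity handles \<open>cis t\<close> near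
  \<open>z\<close>; elsewhere the difference of values is at most 2 and the kernel is small. The
  choice of \<open>N0\<close> brings this far part \<open>8 / ((N + 1) * d\<^sup>2)\<close> below
  \<open>eps / 2\<close>.\<close>

lemma fejer_mean_uniform_limit:
  assumes f: "continuous_on circle f" and f1: "\<And>z. z \<in> circle \<Longrightarrow> cmod (f z) \<le> 1" and eps: "eps > 0"
  shows "\<exists>N0. \<forall>N\<ge>N0. \<forall>z. cmod z = 1 \<longrightarrow> cmod (fejer_mean f N z - f z) \<le> eps"
proof -
  have "compact circle" using compact_sphere[of "0::complex" 1] by (simp add: circle_def sphere_def dist_norm)
  then have "uniformly_continuous_on circle f" using f by (rule compact_uniformly_continuous[rotated])
  then obtain d where d: "d > 0" "\<And>x y. x \<in> circle \<Longrightarrow> y \<in> circle \<Longrightarrow> dist y x < d \<Longrightarrow> dist (f y) (f x) < eps / 2"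
    unfolding uniformly_continuous_on_def using eps half_gt_zero by metis
  obtain N0 where N0: "real N0 \<ge> 16 / (d\<^sup>2 * eps)" using real_arch_simple by blast
  have "cmod (fejer_mean f N z - f z) \<le> eps" if N: "N \<ge> N0" and z: "cmod z = 1" for N z
  proof -
    let ?K = "\<lambda>t. fejer_kernel N (z * cis (- t))"
    let ?b = "8 / (real (N + 1) * d\<^sup>2)"
    have 1: "cmod ((f (cis t) - f z) * complex_of_real (?K t)) \<le> eps / 2 * ?K t + ?b" for t
    proof (cases "cmod (cis t - z) < d")
      case True
      then have "cmod (f (cis t) - f z) \<le> eps / 2"
        using d(2)[of z "cis t"] z by (auto simp: dist_norm circle_def)
      then have "cmod (f (cis t) - f z) * ?K t \<le> eps / 2 * ?K t"
        by (intro mult_right_mono fejer_kernel_nonneg)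
      then have "cmod ((f (cis t) - f z) * complex_of_real (?K t)) \<le> eps / 2 * ?K t"
        by (simp add: norm_mult fejer_kernel_nonneg)
      also have "\<dots> \<le> eps / 2 * ?K t + ?b" by simp
      finally show ?thesis .
    next
      case False
      have "cmod (1 - z * cis (- t)) = cmod (cis t * (1 - z * cis (- t)))" by (simp add: norm_mult)
      also have "cis t * (1 - z * cis (- t)) = cis t - z"
        by (simp add: right_diff_distrib cis_mult mult.left_commute)
      finally have "?K t \<le> 4 / (real (N + 1) * d\<^sup>2)"
        using False z d(1) by (intro fejer_kernel_far) (auto simp: norm_mult)
      moreover have "cmod (f (cis t) - f z) \<le> 2"
        using norm_triangle_ineq4[of "f (cis t)" "f z"] f1[of z] f1[of "cis t"] z by (simp add: circle_def)
      ultimately have "cmod ((f (cis t) - f z) * complex_of_real (?K t)) \<le> 2 * (4 / (real (N + 1) * d\<^sup>2))"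
        using fejer_kernel_nonneg[of N "z * cis (- t)"]
        unfolding norm_mult by (intro mult_mono) auto
      also have "\<dots> \<le> eps / 2 * ?K t + ?b"
        using eps fejer_kernel_nonneg[of N "z * cis (- t)"] by simp
      finally show ?thesis .
    qed
    have i1: "(\<lambda>t. f (cis t) * complex_of_real (?K t)) integrable_on {0..2*pi}"
      "(\<lambda>t. f z * complex_of_real (?K t)) integrable_on {0..2*pi}"
      "(\<lambda>t. (f (cis t) - f z) * complex_of_real (?K t)) integrable_on {0..2*pi}"
      "(\<lambda>t. eps / 2 * ?K t + ?b) integrable_on {0..2*pi}" "(\<lambda>t. eps / 2 * ?K t) integrable_on {0..2*pi}"
      by (intro integrable_continuous_interval continuous_intros continuous_on_comp_cis[OF f] continuous_on_fejer_kernel)+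
    have "integral {0..2*pi} (\<lambda>t. f z * complex_of_real (?K t)) = f z * complex_of_real (2 * pi)"
      by (simp add: integral_of_real_fejer_kernel integral_fejer_kernel[OF z])
    then have "f z = complex_of_real (1 / (2 * pi)) * integral {0..2*pi} (\<lambda>t. f z * complex_of_real (?K t))"
      by (simp only:) simp
    then have "fejer_mean f N z - f z = complex_of_real (1 / (2 * pi)) *
        (integral {0..2*pi} (\<lambda>t. f (cis t) * complex_of_real (?K t)) - integral {0..2*pi} (\<lambda>t. f z * complex_of_real (?K t)))"
      unfolding fejer_mean_integral[OF f z] right_diff_distrib by simp
    also have "\<dots> = complex_of_real (1 / (2 * pi)) * integral {0..2*pi} (\<lambda>t. (f (cis t) - f z) * complex_of_real (?K t))"
      unfolding left_diff_distrib integral_diff[OF i1(1,2)] ..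
    finally have "cmod (fejer_mean f N z - f z)
      = 1 / (2 * pi) * cmod (integral {0..2*pi} (\<lambda>t. (f (cis t) - f z) * complex_of_real (?K t)))"
      by (simp add: norm_mult norm_divide)
    also have "\<dots> \<le> 1 / (2 * pi) * integral {0..2*pi} (\<lambda>t. eps / 2 * ?K t + ?b)"
      using i1 1 by (intro mult_left_mono integral_norm_bound_integral) auto
    also have "integral {0..2*pi} (\<lambda>t. eps / 2 * ?K t + ?b) = eps / 2 * (2 * pi) + ?b * (2 * pi)"
      by (subst integral_add[OF i1(5)]) (auto simp: integral_fejer_kernel[OF z])
    also have "1 / (2 * pi) * \<dots> = eps / 2 + ?b" by (simp add: field_simps)
    also have "?b \<le> eps / 2"
    proof -
      have "16 / (d\<^sup>2 * eps) \<le> real (N + 1)" using N0 N by simp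
      then have "16 \<le> real (N + 1) * (d\<^sup>2 * eps)" using d(1) eps by (simp add: pos_divide_le_eq)
      then show ?thesis using d(1) by (simp add: pos_divide_le_eq mult_ac)
    qed
    finally show ?thesis by simp
  qed
  then show ?thesis by blast
qed

section \<open>The strip network\<close>

lemma sigma_ccw_pred [simp]: "sigma_ccw (ccw_pred x) = x"
  by (cases x) (auto simp: sigma_ccw_def ccw_pred_def)

lemma ccw_pred_sigma [simp]: "ccw_pred (sigma_ccw x) = x"
  by (cases x) (auto simp: sigma_ccw_def ccw_pred_def)

lemma sigma_cw_pred [simp]: "sigma_cw (cw_pred x) = x"
  by (cases x) (auto simp: sigma_cw_def cw_pred_def)

lemma cw_pred_sigma [simp]: "cw_pred (sigma_cw x) = x"
  by (cases x) (auto simp: sigma_cw_def cw_pred_def)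

lemma inv_sigma_ccw: "inv sigma_ccw = ccw_pred"
  by (rule inv_equality) auto

lemma inv_sigma_cw: "inv sigma_cw = cw_pred"
  by (rule inv_equality) auto

text \<open>The other outgoing edge of the scattering node that \<open>x\<close> leaves.\<close>
definition partner :: "site \<Rightarrow> site" where
  "partner x = sigma_ccw (cw_pred x)"

lemma ccw_pred_partner [simp]: "ccw_pred (partner x) = cw_pred x"
  by (simp add: partner_def)

lemma cw_pred_partner [simp]: "cw_pred (partner x) = ccw_pred x"
  by (cases x) (auto simp: partner_def sigma_ccw_def cw_pred_def ccw_pred_def)

lemma partner_partner [simp]: "partner (partner x) = x"
  by (subst partner_def) simp

text \<open>Where the clockwise predecessor is missing, the 1 is \<open>cos phi\<close> plus the
  boundary coefficient \<open>1 - cos phi\<close> of \<open>T_op\<close>. The same rule at the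
  lateral sides of a box makes the box operator unitary.\<close>

definition coef_a :: "real \<Rightarrow> site set \<Rightarrow> site \<Rightarrow> complex" where
  "coef_a phi L x = (if x \<in> L then (if cw_pred x \<in> L then complex_of_real (cos phi) else 1) else 0)"

definition coef_b :: "real \<Rightarrow> site set \<Rightarrow> site \<Rightarrow> complex" where
  "coef_b phi L x = (if x \<in> L \<and> cw_pred x \<in> L then \<i> * complex_of_real (sin phi) else 0)"

text \<open>\<open>x\<close> and \<open>partner x\<close> have the same two predecessors in
  exchanged roles, so on such a pair \<open>hop\<close> is the unitary matrix with entries
  \<open>cos phi\<close> and \<open>\<i> * sin phi\<close>. Summed over \<open>I\<close>, the
  diagonal terms combine to 1 and the cross terms cancel under \<open>partner\<close>. On the other
  sites \<open>hop\<close> is a pure counterclockwise permutation.\<close>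

lemma hop_inner_on:
  assumes fin: "finite L" and cl: "\<And>x. ccw_pred x \<in> L \<longleftrightarrow> x \<in> L"
  shows "inner_on L (hop (coef_a phi L) (coef_b phi L) f) (hop (coef_a phi L) (coef_b phi L) g) = inner_on L f g"
proof -
  let ?h = "hop (coef_a phi L) (coef_b phi L)"
  define c s where "c = complex_of_real (cos phi)" and "s = complex_of_real (sin phi)"
  define I where "I = {x\<in>L. cw_pred x \<in> L}"
  have cs: "c * c + s * s = 1"
    using sin_cos_squared_add2[of phi] unfolding c_def s_def of_real_mult[symmetric] of_real_add[symmetric]
    by (simp add: power2_eq_square)
  have sg: "sigma_ccw y \<in> L \<longleftrightarrow> y \<in> L" for y using cl[of "sigma_ccw y"] by simp
  have fI: "finite I" "I \<subseteq> L" using fin by (auto simp: I_def)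
  have pI: "partner x \<in> I" if "x \<in> I" for x
  proof -
    have "partner x \<in> L" using that cl[of "partner x"] by (simp add: I_def)
    then show ?thesis using that cl[of x] by (simp add: I_def)
  qed
  have flip: "(\<Sum>x\<in>I. F (partner x)) = (\<Sum>x\<in>I. F x)" for F :: "site \<Rightarrow> complex"
    by (rule sum.reindex_bij_witness[of _ partner partner]) (auto simp: pI)
  have inside: "(\<Sum>x\<in>I. ?h f x * cnj (?h g x)) = (\<Sum>x\<in>I. f (ccw_pred x) * cnj (g (ccw_pred x)))"
  proof -
    define P where "P = (\<lambda>x. f (ccw_pred x) * cnj (g (ccw_pred x)))"
    define X where "X = (\<lambda>x. f (ccw_pred x) * cnj (g (cw_pred x)))"
    have e: "?h f x * cnj (?h g x) = c * c * P x + s * s * P (partner x) + \<i> * s * c * (X (partner x) - X x)"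
      if "x \<in> I" for x
    proof -
      have h: "?h F x = c * F (ccw_pred x) + \<i> * s * F (cw_pred x)" for F
        using that by (simp add: hop_def coef_a_def coef_b_def I_def c_def s_def)
      have cc: "cnj c = c" "cnj s = s" by (simp_all add: c_def s_def)
      have "(c * p + \<i> * s * q) * cnj (c * p' + \<i> * s * q')
        = c * c * (p * cnj p') + s * s * (q * cnj q') + \<i> * s * c * (q * cnj p' - p * cnj q')" for p q p' q'
        by (simp add: cc algebra_simps)
      then show ?thesis unfolding h by (simp add: P_def X_def)
    qed
    have "(\<Sum>x\<in>I. ?h f x * cnj (?h g x))
      = (\<Sum>x\<in>I. c * c * P x + s * s * P (partner x) + \<i> * s * c * (X (partner x) - X x))"
      by (rule sum.cong[OF refl e])
    also have "\<dots> = c * c * sum P I + s * s * (\<Sum>x\<in>I. P (partner x))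
        + \<i> * s * c * ((\<Sum>x\<in>I. X (partner x)) - sum X I)"
      by (simp add: sum.distrib sum_distrib_left sum_subtractf right_diff_distrib)
    also have "\<dots> = (c * c + s * s) * sum P I"
      unfolding flip by (simp add: distrib_right)
    finally show ?thesis by (simp add: cs P_def)
  qed
  have outside: "(\<Sum>x\<in>L - I. ?h f x * cnj (?h g x)) = (\<Sum>x\<in>L - I. f (ccw_pred x) * cnj (g (ccw_pred x)))"
    by (intro sum.cong) (auto simp: hop_def coef_a_def coef_b_def I_def)
  have "inner_on L (?h f) (?h g) = (\<Sum>x\<in>L. f (ccw_pred x) * cnj (g (ccw_pred x)))"
    unfolding inner_on_def sum.subset_diff[OF fI(2) fin] inside outside ..
  also have "\<dots> = inner_on L f g"
    unfolding inner_on_def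
    by (rule sum.reindex_bij_witness[of _ sigma_ccw ccw_pred]) (auto simp: cl sg)
  finally show ?thesis .
qed

lemma coef_scattering:
  assumes fin: "finite L" and cl: "\<And>x. ccw_pred x \<in> L \<longleftrightarrow> x \<in> L"
  shows "scattering (coef_a phi L) (coef_b phi L)"
proof
  fix X A :: "site set" and psi :: vec
  assume X: "finite X" "\<And>x. x \<notin> X \<Longrightarrow> psi x = 0" and A: "finite A"
  let ?h = "hop (coef_a phi L) (coef_b phi L)"
  have z: "?h psi x = 0" if "x \<notin> L" for x using that by (simp add: hop_def coef_a_def coef_b_def)
  have "nsq A (?h psi) = nsq (A \<inter> L) (?h psi)"
    unfolding nsq_def using A z by (intro sum.mono_neutral_right) auto
  also have "\<dots> \<le> nsq L (?h psi)" using fin by (intro nsq_mono) auto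
  also have "\<dots> = nsq L psi"
    using hop_inner_on[OF assms, of phi psi psi] by (simp only: inner_on_self of_real_eq_iff)
  also have "\<dots> = nsq (L \<inter> X) psi"
    unfolding nsq_def using fin X by (intro sum.mono_neutral_right) auto
  also have "\<dots> \<le> nsq X psi" using X by (intro nsq_mono) auto
  finally show "nsq A (?h psi) \<le> nsq X psi" .
qed

text \<open>The rows run from an even to an odd number, so the strip consists of whole plaquettes
  and no counterclockwise hop crosses a wall.\<close>

lemma strip_closed: "ccw_pred x \<in> strip M \<longleftrightarrow> x \<in> strip M"
proof (cases x)
  case (Pair i j)
  have "- 2 * int M + 2 \<le> j + 1 \<and> j + 1 \<le> 2 * int M + 1 \<longleftrightarrow> - 2 * int M + 2 \<le> j \<and> j \<le> 2 * int M + 1" if "even j"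
    using that by presburger
  moreover have "- 2 * int M + 2 \<le> j - 1 \<and> j - 1 \<le> 2 * int M + 1 \<longleftrightarrow> - 2 * int M + 2 \<le> j \<and> j \<le> 2 * int M + 1" if "odd j"
    using that by presburger
  ultimately show ?thesis using Pair by (auto simp: ccw_pred_def strip_def)
qed

section \<open>Finite boxes exhausting the strip\<close>

definition box :: "nat \<Rightarrow> nat \<Rightarrow> site set" where
  "box M n = {x \<in> strip M. - 2 * int n \<le> fst x \<and> fst x \<le> 2 * int n + 1}"

lemma finite_box: "finite (box M n)"
proof (rule finite_subset)
  show "box M n \<subseteq> {- 2 * int n..2 * int n + 1} \<times> {- 2 * int M + 2..2 * int M + 1}"
    by (auto simp: box_def strip_def)
qed simp

lemma box_closed: "ccw_pred x \<in> box M n \<longleftrightarrow> x \<in> box M n"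
proof (cases x)
  case (Pair i j)
  have "- 2 * int n \<le> i + 1 \<and> i + 1 \<le> 2 * int n + 1 \<longleftrightarrow> - 2 * int n \<le> i \<and> i \<le> 2 * int n + 1" if "even i"
    using that by presburger
  moreover have "- 2 * int n \<le> i - 1 \<and> i - 1 \<le> 2 * int n + 1 \<longleftrightarrow> - 2 * int n \<le> i \<and> i \<le> 2 * int n + 1" if "odd i"
    using that by presburger
  moreover have "fst (ccw_pred x) = (if even j then (if odd i then i - 1 else i) else (if odd i then i else i + 1))"
    using Pair by (simp add: ccw_pred_def)
  ultimately show ?thesis using strip_closed[of x M] Pair by (auto simp: box_def)
qed

lemma box_eventually:
  assumes "x \<in> strip M"
  shows "eventually (\<lambda>n. x \<in> box M n) sequentially"
  unfolding eventually_sequentially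
proof (intro exI allI impI)
  fix n assume "nat \<bar>fst x\<bar> \<le> n"
  then show "x \<in> box M n" using assms by (auto simp: box_def)
qed

lemma box_mem_eventually: "eventually (\<lambda>n. x \<in> box M n \<longleftrightarrow> x \<in> strip M) sequentially"
proof (cases "x \<in> strip M")
  case True
  from box_eventually[OF this] show ?thesis
    by (rule eventually_mono) (use True in simp)
qed (simp add: box_def)

text \<open>\<open>T_op\<close> acts exactly at the strip sites whose clockwise predecessor lies
  outside: even columns of the top row and odd columns of the bottom row.\<close>

lemma U_op_eq_hop:
  "U_op M om phi psi x = (if x \<in> strip M then om x * hop (coef_a phi (strip M)) (coef_b phi (strip M)) psi x else 0)"
proof (cases "x \<in> strip M")
  case True
  obtain i j where x: "x = (i, j)" by (cases x)
  have p: "ccw_pred x \<in> strip M" using True strip_closed by blast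
  have S: "S_phi phi (chi (strip M) psi) x = complex_of_real (cos phi) * psi (ccw_pred x)
     + \<i> * complex_of_real (sin phi) * (if cw_pred x \<in> strip M then psi (cw_pred x) else 0)"
    using p by (simp add: S_phi_def S_ccw_def S_cw_def perm_op_def inv_sigma_ccw inv_sigma_cw chi_def)
  have T: "T_op M phi psi x = (if cw_pred x \<in> strip M then 0 else complex_of_real (1 - cos phi) * psi (ccw_pred x))"
  proof -
    consider "j = 2 * int M + 1" "even i" | "j = - 2 * int M + 2" "odd i" | 
      "\<not> (j = 2 * int M + 1 \<and> even i)" "\<not> (j = - 2 * int M + 2 \<and> odd i)" by blast
    then show ?thesis
    proof cases
      case 1
      then show ?thesis by (simp add: T_op_def x cw_pred_def ccw_pred_def strip_def)
    next
      case 2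
      then show ?thesis by (simp add: T_op_def x cw_pred_def ccw_pred_def strip_def)
    next
      case 3
      have b: "- 2 * int M + 2 \<le> j" "j \<le> 2 * int M + 1" using True by (auto simp: strip_def x)
      have "cw_pred x \<in> strip M"
      proof -
        have "j + 1 \<le> 2 * int M + 1" if "odd j" "even i"
          using that 3 b by auto
        moreover have "- 2 * int M + 2 \<le> j - 1" if "even j" "odd i"
          using that 3 b by auto
        ultimately show ?thesis using b by (auto simp: x cw_pred_def strip_def)
      qed
      then show ?thesis using 3 by (auto simp: T_op_def x)
    qed
  qed
  show ?thesis
    using True p unfolding U_op_def
    by (simp add: chi_def[of "strip M"] D_op_def S[unfolded chi_def[of "strip M" psi]] T hop_def coef_a_def coef_b_def
        algebra_simps)
qed (simp add: U_op_def chi_def)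

lemma sum_times_e:
  "finite S \<Longrightarrow> (\<Sum>nu\<in>S. g nu * e nu x) = (if x \<in> S then g x else 0)"
  by (simp add: e_def if_distrib[of "\<lambda>u. _ * u"] cong: if_cong)

locale strip_model =
  fixes M :: nat and phi C :: real
  assumes C_ge1: "C \<ge> 1"
    and circle_pole: "\<And>b. cmod b \<le> 1 \<Longrightarrow>
      (\<integral>\<^sup>+ u. ennreal (1 / sqrt (cmod (1 - u * b))) \<partial>circle_measure) \<le> ennreal C"
    and small: "4 * C\<^sup>2 * sqrt \<bar>sin phi\<bar> \<le> 1 / 4"
begin

lemma unitary_box_box:
  "unitary_box (coef_a phi (box M n)) (coef_b phi (box M n)) \<bar>sin phi\<bar> C (box M n)"
proof -
  interpret scattering "coef_a phi (box M n)" "coef_b phi (box M n)"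
    by (rule coef_scattering[OF finite_box box_closed])
  show ?thesis
  proof
    show "cmod (coef_b phi (box M n) x) \<le> \<bar>sin phi\<bar>" for x
      by (simp add: coef_b_def norm_mult)
    show "inner_on (box M n) (hop (coef_a phi (box M n)) (coef_b phi (box M n)) f)
       (hop (coef_a phi (box M n)) (coef_b phi (box M n)) g) = inner_on (box M n) f g" for f g
      by (rule hop_inner_on[OF finite_box box_closed])
  qed (use C_ge1 circle_pole small finite_box in auto)
qed

sublocale B: unitary_box "coef_a phi (box M n)" "coef_b phi (box M n)" "\<bar>sin phi\<bar>" C "box M n" for n
  by (rule unitary_box_box)

abbreviation V :: "(site \<Rightarrow> complex) \<Rightarrow> op" where "V om \<equiv> U_op M om phi"

lemma V_sum: "V om (\<lambda>x. \<Sum>i\<in>I. c i * f i x) = (\<lambda>x. \<Sum>i\<in>I. c i * V om (f i) x)"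
  by (rule ext) (simp add: U_op_eq_hop hop_def sum_distrib_left sum.distrib distrib_left mult_ac)

lemma V_pow_sum: "(V om ^^ n) (\<lambda>x. \<Sum>i\<in>I. c i * f i x) = (\<lambda>x. \<Sum>i\<in>I. c i * (V om ^^ n) (f i) x)"
  by (induction n) (simp_all add: V_sum)

lemma V_outside: "x \<notin> strip M \<Longrightarrow> V om psi x = 0"
  by (simp add: U_op_eq_hop)

text \<open>\<open>adj\<close> reads columns, so negative powers stay inside the strip because the
  columns outside vanish.\<close>

lemma V_e_outside:
  assumes "k \<notin> strip M"
  shows "V om (e k) x = 0"
proof (cases "x \<in> strip M")
  case True
  then have "ccw_pred x \<noteq> k" using assms strip_closed by blast
  moreover have "coef_b phi (strip M) x * e k (cw_pred x) = 0"
    using assms by (auto simp: coef_b_def e_def)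
  ultimately show ?thesis by (simp add: U_op_eq_hop hop_def e_diff)
qed (simp add: V_outside)

lemma V_e_support: "nu \<notin> {sigma_ccw mu, sigma_cw mu} \<Longrightarrow> V om (e mu) nu = 0"
proof -
  assume nu: "nu \<notin> {sigma_ccw mu, sigma_cw mu}"
  have "ccw_pred nu \<noteq> mu" "cw_pred nu \<noteq> mu"
    using nu sigma_ccw_pred[of nu] sigma_cw_pred[of nu] by auto
  then show ?thesis by (simp add: U_op_eq_hop hop_def e_diff)
qed

lemma V_e_expand: "V om (e mu) = (\<lambda>x. \<Sum>nu\<in>{sigma_ccw mu, sigma_cw mu}. V om (e mu) nu * e nu x)"
proof
  fix x
  let ?S = "{sigma_ccw mu, sigma_cw mu}"
  show "V om (e mu) x = (\<Sum>nu\<in>?S. V om (e mu) nu * e nu x)"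
  proof (cases "x \<in> ?S")
    case True
    then show ?thesis using sum_times_e[of ?S "V om (e mu)" x] by simp
  next
    case False
    then show ?thesis using sum_times_e[of ?S "V om (e mu)" x] V_e_support[OF False] by simp
  qed
qed

text \<open>Columns are supported on two sites; the infinite sum in \<open>adj\<close> is finite,
  and no summability conditions arise for linearity.\<close>

lemma adj_V: "adj (V om) psi mu = (\<Sum>nu\<in>{sigma_ccw mu, sigma_cw mu}. cnj (V om (e mu) nu) * psi nu)"
proof -
  have "adj (V om) psi mu = infsum (\<lambda>nu. cnj (V om (e mu) nu) * psi nu) {sigma_ccw mu, sigma_cw mu}"
    unfolding adj_def by (rule infsum_cong_neutral) (auto simp: V_e_support)
  then show ?thesis by simp
qed

lemma adj_sum: "adj (V om) (\<lambda>x. \<Sum>i\<in>I. c i * f i x) = (\<lambda>x. \<Sum>i\<in>I. c i * adj (V om) (f i) x)"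
proof
  fix mu
  have "adj (V om) (\<lambda>x. \<Sum>i\<in>I. c i * f i x) mu
    = (\<Sum>nu\<in>{sigma_ccw mu, sigma_cw mu}. \<Sum>i\<in>I. c i * (cnj (V om (e mu) nu) * f i nu))"
    unfolding adj_V by (simp add: sum_distrib_left mult_ac)
  also have "\<dots> = (\<Sum>i\<in>I. c i * adj (V om) (f i) mu)"
    unfolding adj_V sum_distrib_left by (rule sum.swap)
  finally show "adj (V om) (\<lambda>x. \<Sum>i\<in>I. c i * f i x) mu = (\<Sum>i\<in>I. c i * adj (V om) (f i) mu)" .
qed

lemma adj_pow_sum: "(adj (V om) ^^ n) (\<lambda>x. \<Sum>i\<in>I. c i * f i x) = (\<lambda>x. \<Sum>i\<in>I. c i * (adj (V om) ^^ n) (f i) x)"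
  by (induction n) (simp_all add: adj_sum)

lemma upow_sum: "upow (V om) j (\<lambda>x. \<Sum>i\<in>I. c i * f i x) = (\<lambda>x. \<Sum>i\<in>I. c i * upow (V om) j (f i) x)"
  by (simp add: upow_def V_pow_sum adj_pow_sum)

text \<open>Expanding \<open>V om (e mu)\<close> over its target sites reduces entries of negative
  powers to conjugated entries of positive powers, for which locality is available.\<close>

lemma adj_pow_e: "(adj (V om) ^^ n) (e k) mu = cnj ((V om ^^ n) (e mu) k)"
proof (induction n arbitrary: mu)
  case 0
  then show ?case by (simp add: e_def)
next
  case (Suc n)
  let ?S = "{sigma_ccw mu, sigma_cw mu}"
  have "(adj (V om) ^^ Suc n) (e k) mu = (\<Sum>nu\<in>?S. cnj (V om (e mu) nu) * cnj ((V om ^^ n) (e nu) k))"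
    by (simp only: funpow.simps comp_apply adj_V Suc.IH)
  also have "\<dots> = cnj (\<Sum>nu\<in>?S. V om (e mu) nu * (V om ^^ n) (e nu) k)"
    by (simp only: cnj_sum complex_cnj_mult)
  also have "(\<Sum>nu\<in>?S. V om (e mu) nu * (V om ^^ n) (e nu) k) = (V om ^^ n) (\<lambda>x. \<Sum>nu\<in>?S. V om (e mu) nu * e nu x) k"
    by (simp only: V_pow_sum)
  also have "\<dots> = (V om ^^ n) (V om (e mu)) k" by (simp only: V_e_expand[symmetric])
  also have "\<dots> = (V om ^^ Suc n) (e mu) k" by (simp only: funpow_Suc_right comp_apply)
  finally show ?case .
qed

lemma upow_e_outside:
  assumes "k \<in> strip M" "m \<notin> strip M"
  shows "upow (V om) j (e k) m = 0"
proof (cases "j \<ge> 0")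
  case True
  have "(V om ^^ n) (e k) m = 0" for n
    using assms e_diff[of m k] by (cases n) (auto simp: V_outside)
  then show ?thesis using True by (simp add: upow_def)
next
  case False
  then obtain n where n: "nat (- j) = Suc n" using not0_implies_Suc by fastforce
  have "V om (e m) = (\<lambda>x. 0)" using V_e_outside[OF assms(2)] by blast
  moreover have "(V om ^^ n) (\<lambda>x. 0) = (\<lambda>x. 0)" using V_pow_sum[where om = om and n = n and I = "{}"] by simp
  ultimately have "(V om ^^ Suc n) (e m) k = 0" by (simp only: funpow_Suc_right comp_apply)
  then show ?thesis using False n adj_pow_e[where om = om and n = "Suc n" and k = k and mu = m] by (simp add: upow_def del: funpow.simps)
qed

definition unit_phase :: "(site \<Rightarrow> complex) \<Rightarrow> bool" where
  "unit_phase om \<longleftrightarrow> (\<forall>x. cmod (om x) = 1)"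

lemma AE_unit_phase: "AE om in Prob. unit_phase om"
  using AE_Prob_unit by (simp add: unit_phase_def)

lemma coef_eventually:
  "eventually (\<lambda>n. coef_a phi (box M n) x = coef_a phi (strip M) x \<and> coef_b phi (box M n) x = coef_b phi (strip M) x
     \<and> (x \<in> box M n \<longleftrightarrow> x \<in> strip M)) sequentially"
  using box_mem_eventually[of x M] box_mem_eventually[of "cw_pred x" M]
  by eventually_elim (simp add: coef_a_def coef_b_def)

lemma box_step_local:
  assumes om: "unit_phase om"
    and "eventually (\<lambda>n. f n (ccw_pred x) = g (ccw_pred x)) sequentially"
    and "eventually (\<lambda>n. f n (cw_pred x) = g (cw_pred x)) sequentially"
  shows "eventually (\<lambda>n. B.U n om (f n) x = V om g x) sequentially"
  using coef_eventually[of x] assms(2,3)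
proof eventually_elim
  case (elim n)
  have "unimod (om x) = om x" using om by (simp add: unit_phase_def unimod_def)
  then show ?case using elim by (simp add: B.stp_def U_op_eq_hop hop_def)
qed

text \<open>Finite propagation: the value at \<open>x\<close> after \<open>i\<close> steps involves
  finitely many sites, and a large box has the coefficients of the strip at all of them. No decay of
  \<open>psi\<close> enters.\<close>

lemma V_local:
  assumes "unit_phase om"
  shows "eventually (\<lambda>n. (B.U n om ^^ i) psi x = (V om ^^ i) psi x) sequentially"
proof (induction i arbitrary: x)
  case (Suc i)
  have "eventually (\<lambda>n. B.U n om ((B.U n om ^^ i) psi) x = V om ((V om ^^ i) psi) x) sequentially"
    by (rule box_step_local[OF assms Suc.IH Suc.IH])
  then show ?case by simp
qed simp

text \<open>The identity is exact once \<open>n\<close> is large, with a threshold depending on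
  \<open>j\<close>, \<open>k\<close> and \<open>m\<close>. It serves as a replacement for a spectral
  theorem on the strip.\<close>

lemma upow_spectral:
  assumes om: "unit_phase om" and k: "k \<in> strip M" and m: "m \<in> strip M"
  shows "eventually (\<lambda>n. \<forall>E w. B.FI.spectral_rep n om k E w \<longrightarrow>
    upow (V om) j (e k) m = (\<Sum>l\<in>E. l powi j * w l m)) sequentially"
proof (cases "j \<ge> 0")
  case True
  show ?thesis using V_local[OF om, of "nat j" "e k" m] box_eventually[OF k]
  proof eventually_elim
    case (elim n)
    show ?case
    proof (intro allI impI)
      fix E w assume rep: "B.FI.spectral_rep n om k E w"
      have "upow (V om) j (e k) m = (\<Sum>l\<in>E. l ^ nat j * w l m)"
        using True elim B.FI.rep_pow[OF elim(2) rep, of "nat j" m] by (simp add: upow_def)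
      then show "upow (V om) j (e k) m = (\<Sum>l\<in>E. l powi j * w l m)"
        using True by (simp add: power_int_def)
    qed
  qed
next
  case False
  show ?thesis using V_local[OF om, of "nat (- j)" "e m" k] box_eventually[OF k] box_eventually[OF m]
  proof eventually_elim
    case (elim n)
    show ?case
    proof (intro allI impI)
      fix E w assume rep: "B.FI.spectral_rep n om k E w"
      have "upow (V om) j (e k) m = (\<Sum>l\<in>E. l powi (- int (nat (- j))) * w l m)"
        using False elim B.FI.rep_pow_neg[OF elim(2) rep elim(3), of "nat (- j)"]
        by (simp add: upow_def adj_pow_e)
      then show "upow (V om) j (e k) m = (\<Sum>l\<in>E. l powi j * w l m)" using False by simp
    qed
  qed
qed

section \<open>Correlator bounds for functions of the strip operator\<close>

lemma correlator_le_1: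
  assumes "k \<in> box M n" "m \<in> box M n" and rep: "B.FI.spectral_rep n om k E w"
  shows "(\<Sum>l\<in>E. cmod (w l m)) \<le> 1"
proof -
  have "cmod (w l m) \<le> ((cmod (w l m))\<^sup>2 / nsq (box M n) (w l) + nsq (box M n) (w l)) / 2" if "l \<in> E" for l
  proof -
    let ?q = "nsq (box M n) (w l)"
    have q: "?q > 0" by (rule B.FI.rep_mass_pos[OF assms(1) rep that])
    \<comment> \<open>Arithmetic-geometric mean with the spectral mass \<open>?q\<close>, chosen so
      that Bessel's inequality bounds one sum and the total mass 1 the other.\<close>
    have "0 \<le> (cmod (w l m) - ?q)\<^sup>2" by simp
    then have "2 * (cmod (w l m) * ?q) \<le> (cmod (w l m))\<^sup>2 + ?q\<^sup>2" by (simp add: power2_diff)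
    then have "2 * cmod (w l m) \<le> ((cmod (w l m))\<^sup>2 + ?q\<^sup>2) / ?q"
      using q by (simp add: pos_le_divide_eq mult.assoc)
    also have "\<dots> = (cmod (w l m))\<^sup>2 / ?q + ?q" using q by (simp add: add_divide_distrib power2_eq_square)
    finally show ?thesis by simp
  qed
  then have "(\<Sum>l\<in>E. cmod (w l m)) \<le> (\<Sum>l\<in>E. ((cmod (w l m))\<^sup>2 / nsq (box M n) (w l) + nsq (box M n) (w l)) / 2)"
    by (rule sum_mono)
  also have "\<dots> = ((\<Sum>l\<in>E. (cmod (w l m))\<^sup>2 / nsq (box M n) (w l)) + (\<Sum>l\<in>E. nsq (box M n) (w l))) / 2"
    by (simp add: sum.distrib sum_divide_distrib[symmetric])
  also have "\<dots> \<le> (1 + 1) / 2"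
    using B.FI.rep_bessel[OF assms(1) rep assms(2)] B.FI.rep_mass_sum[OF assms(1) rep] by simp
  finally show ?thesis by simp
qed

text \<open>\<open>q\<close> is the correlator of the box. Hiding the eigenvectors behind a number
  with two bounds lets one argument serve both the sup norm estimate (\<open>q \<le> 1\<close>) and
  the decay (majorant).\<close>

lemma trig_poly_bound:
  assumes om: "unit_phase om" and k: "k \<in> strip M" and m: "m \<in> strip M"
    and J: "finite J" and R: "R \<ge> 0" and bound: "\<And>l. cmod l = 1 \<Longrightarrow> cmod (\<Sum>j\<in>J. c j * l powi j) \<le> R"
  shows "eventually (\<lambda>n. \<exists>q\<ge>0. cmod (\<Sum>j\<in>J. c j * upow (V om) j (e k) m) \<le> R * q \<and> q \<le> 1
    \<and> ennreal q \<le> B.majorant n m k om) sequentially"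
proof -
  have "eventually (\<lambda>n. \<forall>j\<in>J. \<forall>E w. B.FI.spectral_rep n om k E w \<longrightarrow>
    upow (V om) j (e k) m = (\<Sum>l\<in>E. l powi j * w l m)) sequentially"
    using J upow_spectral[OF om k m] by (intro eventually_ball_finite) auto
  then show ?thesis using box_eventually[OF k] box_eventually[OF m]
  proof eventually_elim
    case (elim n)
    obtain E w where rep: "B.FI.spectral_rep n om k E w"
      using B.FI.spectral_rep_exists[OF elim(2)] by blast
    let ?q = "\<Sum>l\<in>E. cmod (w l m)"
    have "(\<Sum>j\<in>J. c j * upow (V om) j (e k) m) = (\<Sum>j\<in>J. \<Sum>l\<in>E. c j * l powi j * w l m)"
    proof (intro sum.cong refl)
      fix j assume "j \<in> J"
      then have "upow (V om) j (e k) m = (\<Sum>l\<in>E. l powi j * w l m)" using elim(1) rep by blast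
      then show "c j * upow (V om) j (e k) m = (\<Sum>l\<in>E. c j * l powi j * w l m)"
        by (simp add: sum_distrib_left mult.assoc)
    qed
    also have "\<dots> = (\<Sum>l\<in>E. (\<Sum>j\<in>J. c j * l powi j) * w l m)"
      by (subst sum.swap) (simp add: sum_distrib_right)
    finally have eq: "(\<Sum>j\<in>J. c j * upow (V om) j (e k) m) = (\<Sum>l\<in>E. (\<Sum>j\<in>J. c j * l powi j) * w l m)" .
    have "cmod (\<Sum>j\<in>J. c j * upow (V om) j (e k) m) \<le> (\<Sum>l\<in>E. R * cmod (w l m))"
      unfolding eq
    proof (rule order_trans[OF norm_sum sum_mono])
      fix l assume "l \<in> E"
      then have "cmod l = 1" by (rule B.FI.rep_unit[OF elim(2) rep])
      then show "cmod ((\<Sum>j\<in>J. c j * l powi j) * w l m) \<le> R * cmod (w l m)"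
        unfolding norm_mult by (intro mult_right_mono bound) auto
    qed
    also have "\<dots> = R * ?q" by (simp add: sum_distrib_left)
    finally have "cmod (\<Sum>j\<in>J. c j * upow (V om) j (e k) m) \<le> R * ?q" .
    moreover have "?q \<le> 1" by (rule correlator_le_1[OF elim(2,3) rep])
    moreover have "ennreal ?q \<le> B.majorant n m k om" by (rule B.spectral_correlator_le[OF elim(2,3) rep])
    moreover have "?q \<ge> 0" by (intro sum_nonneg) auto
    ultimately show ?case by blast
  qed
qed

text \<open>The random majorant of the strip itself. As a \<open>liminf\<close> over boxes it is
  measurable, and Fatou's lemma transfers the uniform bound on the means.\<close>

definition Y :: "site \<Rightarrow> site \<Rightarrow> (site \<Rightarrow> complex) \<Rightarrow> ennreal" where
  "Y m k om = liminf (\<lambda>n. B.majorant n m k om)"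

lemma measurable_Y: "Y m k \<in> borel_measurable Prob"
proof -
  have "(\<lambda>om. liminf (\<lambda>n. B.majorant n m k om)) \<in> borel_measurable Prob"
    by (intro borel_measurable_liminf) (rule B.measurable_majorant)
  then show ?thesis by (simp add: Y_def[abs_def])
qed

definition rate :: "site \<Rightarrow> site \<Rightarrow> real" where
  "rate m k = (8 * pi * C\<^sup>2 + 1) * (1/2) ^ (ldist m k div 3)"

lemma rate_nonneg: "rate m k \<ge> 0"
  by (simp add: rate_def)

lemma nn_integral_Y:
  assumes "k \<in> strip M"
  shows "(\<integral>\<^sup>+ om. Y m k om \<partial>Prob) \<le> ennreal (rate m k)"
proof -
  have "(\<integral>\<^sup>+ om. Y m k om \<partial>Prob) \<le> liminf (\<lambda>n. \<integral>\<^sup>+ om. B.majorant n m k om \<partial>Prob)"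
    unfolding Y_def by (rule nn_integral_liminf) (rule B.measurable_majorant)
  also have "\<dots> \<le> liminf (\<lambda>n::nat. ennreal (rate m k))"
    using box_eventually[OF assms]
    by (intro Liminf_mono, eventually_elim) (simp add: rate_def B.nn_integral_majorant)
  also have "\<dots> = ennreal (rate m k)" by (rule Liminf_const) simp
  finally show ?thesis .
qed

lemma trig_poly_le_Y:
  assumes om: "unit_phase om" and k: "k \<in> strip M" and m: "m \<in> strip M"
    and J: "finite J" and bound: "\<And>l. cmod l = 1 \<Longrightarrow> cmod (\<Sum>j\<in>J. c j * l powi j) \<le> 1"
  shows "ennreal (cmod (\<Sum>j\<in>J. c j * upow (V om) j (e k) m)) \<le> Y m k om"
  unfolding Y_def
proof (rule Liminf_bounded)
  show "\<forall>\<^sub>F n in sequentially. ennreal (cmod (\<Sum>j\<in>J. c j * upow (V om) j (e k) m)) \<le> B.majorant n m k om"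
  proof (rule eventually_mono[OF trig_poly_bound[OF om k m J zero_le_one bound]])
    fix n assume "\<exists>q\<ge>0. cmod (\<Sum>j\<in>J. c j * upow (V om) j (e k) m) \<le> 1 * q \<and> q \<le> 1 \<and> ennreal q \<le> B.majorant n m k om"
    then obtain q where q: "cmod (\<Sum>j\<in>J. c j * upow (V om) j (e k) m) \<le> q" "ennreal q \<le> B.majorant n m k om"
      by auto
    show "ennreal (cmod (\<Sum>j\<in>J. c j * upow (V om) j (e k) m)) \<le> B.majorant n m k om"
      by (rule order_trans[OF ennreal_leI[OF q(1)] q(2)])
  qed
qed

lemma trig_poly_le_sup:
  assumes om: "unit_phase om" and k: "k \<in> strip M" and m: "m \<in> strip M"
    and J: "finite J" and R: "R \<ge> 0" and bound: "\<And>l. cmod l = 1 \<Longrightarrow> cmod (\<Sum>j\<in>J. c j * l powi j) \<le> R"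
  shows "cmod (\<Sum>j\<in>J. c j * upow (V om) j (e k) m) \<le> R"
proof -
  obtain q where q: "cmod (\<Sum>j\<in>J. c j * upow (V om) j (e k) m) \<le> R * q" "q \<le> 1"
    using eventually_happens[OF trig_poly_bound[OF om k m J R bound]] by auto
  moreover have "R * q \<le> R * 1" using q R by (intro mult_left_mono) auto
  ultimately show ?thesis by simp
qed

text \<open>Entries of \<open>fejer_op\<close> are trigonometric polynomials in the strip operator
  with symbol \<open>fejer_mean\<close>. Uniform convergence of the symbols makes them Cauchy, so
  the \<open>lim\<close> in \<open>fcalc\<close> is a genuine limit; since the symbols are bounded
  by 1, all entries lie below \<open>Y\<close>.\<close>

lemma fcalc_le_Y:
  assumes om: "unit_phase om" and k: "k \<in> strip M" and m: "m \<in> strip M"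
    and f: "continuous_on circle f" and f1: "\<And>z. z \<in> circle \<Longrightarrow> cmod (f z) \<le> 1"
  shows "ennreal (cmod (fcalc (V om) f (e k) m)) \<le> Y m k om"
proof -
  let ?c = "\<lambda>N j. complex_of_real (1 - real_of_int \<bar>j\<bar> / real (N + 1)) * fourier_coeff f j"
  let ?F = "\<lambda>N. fejer_op (V om) f N (e k) m"
  have F: "?F N = (\<Sum>j\<in>{- int N..int N}. ?c N j * upow (V om) j (e k) m)" for N
    by (simp add: fejer_op_def)
  have mean: "(\<Sum>j\<in>{- int N..int N}. ?c N j * l powi j) = fejer_mean f N l" for N l
    by (simp add: fejer_mean_def)
  have "Cauchy ?F"
  proof (rule metric_CauchyI)
    fix eps :: real assume eps: "0 < eps"
    obtain N0 where N0: "\<And>N z. N \<ge> N0 \<Longrightarrow> cmod z = 1 \<Longrightarrow> cmod (fejer_mean f N z - f z) \<le> eps / 4"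
      using fejer_mean_uniform_limit[OF f f1, of "eps / 4"] eps by auto
    have "dist (?F N) (?F N') < eps" if N: "N \<ge> N0" "N' \<ge> N0" for N N'
    proof -
      let ?J = "{- int (max N N')..int (max N N')}"
      \<comment> \<open>Both coefficient families are padded by 0 to a common range, so that the
        difference is a single trigonometric polynomial.\<close>
      let ?d = "\<lambda>j. (if j \<in> {- int N..int N} then ?c N j else 0) - (if j \<in> {- int N'..int N'} then ?c N' j else 0)"
      have ext: "(\<Sum>j\<in>{- int K..int K}. a j * g j) = (\<Sum>j\<in>?J. (if j \<in> {- int K..int K} then a j else 0) * g j)"
        if "K = N \<or> K = N'" for K and a g :: "int \<Rightarrow> complex"
        by (rule sum.mono_neutral_cong_left) (use that in auto)
      have diff: "(\<Sum>j\<in>{- int N..int N}. ?c N j * g j) - (\<Sum>j\<in>{- int N'..int N'}. ?c N' j * g j)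
        = (\<Sum>j\<in>?J. ?d j * g j)" for g
        unfolding ext[of N] ext[of N'] sum_subtractf[symmetric] left_diff_distrib
        by (subst ext, simp, subst ext, simp) (simp add: sum_subtractf)
      have "cmod (\<Sum>j\<in>?J. ?d j * upow (V om) j (e k) m) \<le> eps / 2"
      proof (rule trig_poly_le_sup[OF om k m])
        fix l :: complex assume l: "cmod l = 1"
        have "(\<Sum>j\<in>?J. ?d j * l powi j) = (fejer_mean f N l - f l) - (fejer_mean f N' l - f l)"
          unfolding diff[symmetric] mean by simp
        also have "cmod \<dots> \<le> eps / 4 + eps / 4"
          by (rule order_trans[OF norm_triangle_ineq4 add_mono[OF N0[OF N(1) l] N0[OF N(2) l]]])
        finally show "cmod (\<Sum>j\<in>?J. ?d j * l powi j) \<le> eps / 2" by simp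
      qed (use eps in auto)
      then show ?thesis unfolding dist_norm F diff using eps by simp
    qed
    then show "\<exists>N0. \<forall>N\<ge>N0. \<forall>N'\<ge>N0. dist (?F N) (?F N') < eps" by blast
  qed
  then have "convergent ?F" by (rule Cauchy_convergent)
  then have "?F \<longlonglongrightarrow> lim ?F" by (simp add: convergent_LIMSEQ_iff)
  then have "?F \<longlonglongrightarrow> fcalc (V om) f (e k) m" by (simp add: fcalc_def)
  then have lim: "(\<lambda>N. ennreal (cmod (?F N))) \<longlonglongrightarrow> ennreal (cmod (fcalc (V om) f (e k) m))"
    by (intro tendsto_ennrealI tendsto_norm)
  have "ennreal (cmod (?F N)) \<le> Y m k om" for N
    unfolding F
  proof (rule trig_poly_le_Y[OF om k m])
    show "cmod (\<Sum>j\<in>{- int N..int N}. ?c N j * l powi j) \<le> 1" if "cmod l = 1" for l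
      unfolding mean using fejer_mean_le_1[OF f f1 that] by simp
  qed simp
  then show ?thesis by (intro LIMSEQ_le_const2[OF lim]) auto
qed

lemma upow_le_Y:
  assumes om: "unit_phase om" and k: "k \<in> strip M" and m: "m \<in> strip M"
  shows "ennreal (cmod (upow (V om) j (e k) m)) \<le> Y m k om" "cmod (upow (V om) j (e k) m) \<le> 1"
  using trig_poly_le_Y[OF om k m, of "{j}" "\<lambda>_. 1"] trig_poly_le_sup[OF om k m, of "{j}" 1 "\<lambda>_. 1"]
  by (simp_all add: norm_power_int)

end

section \<open>Lattice sums and conversion of the decay rate\<close>

lemma nn_integral_exp_abs_int:
  fixes h :: real
  assumes h: "h > 0"
  shows "(\<integral>\<^sup>+ i. ennreal (exp (- h * \<bar>real_of_int i\<bar>)) \<partial>count_space UNIV) < \<infinity>"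
proof -
  have bij: "bij_betw int_decode UNIV UNIV" using bij_int_decode by simp
  have dec: "real n / 2 - 1 / 2 \<le> \<bar>real_of_int (int_decode n)\<bar>" for n
  proof -
    have "int n \<le> 2 * \<bar>int_decode n\<bar> + 1"
      unfolding int_decode_def sum_decode_def by (cases "even n") (auto elim!: evenE oddE)
    then have "real_of_int (int n) \<le> real_of_int (2 * \<bar>int_decode n\<bar> + 1)" by (rule of_int_le_iff[THEN iffD2])
    then show ?thesis by simp
  qed
  have "(\<integral>\<^sup>+ i. ennreal (exp (- h * \<bar>real_of_int i\<bar>)) \<partial>count_space UNIV)
    = (\<integral>\<^sup>+ n. ennreal (exp (- h * \<bar>real_of_int (int_decode n)\<bar>)) \<partial>count_space UNIV)"
    by (rule nn_integral_bij_count_space[OF bij, symmetric])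
  also have "\<dots> \<le> (\<integral>\<^sup>+ n. ennreal (exp (h / 2) * exp (- h / 2) ^ n) \<partial>count_space UNIV)"
  proof (intro nn_integral_mono ennreal_leI)
    fix n
    have "- h * \<bar>real_of_int (int_decode n)\<bar> \<le> - h * (real n / 2 - 1 / 2)"
      using dec[of n] h by (intro mult_left_mono_neg) auto
    also have "\<dots> = h / 2 + real n * (- h / 2)" by (simp add: algebra_simps)
    finally have "exp (- h * \<bar>real_of_int (int_decode n)\<bar>) \<le> exp (h / 2 + real n * (- h / 2))" by simp
    also have "\<dots> = exp (h / 2) * exp (- h / 2) ^ n" by (simp only: exp_add exp_of_nat_mult)
    finally show "exp (- h * \<bar>real_of_int (int_decode n)\<bar>) \<le> exp (h / 2) * exp (- h / 2) ^ n" .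
  qed
  also have "\<dots> = (\<Sum>n. ennreal (exp (h / 2) * exp (- h / 2) ^ n))"
    by (rule nn_integral_count_space_nat)
  also have "\<dots> < \<infinity>"
  proof -
    have "summable (\<lambda>n. exp (h / 2) * exp (- h / 2) ^ n)"
      using h by (intro summable_mult summable_geometric) auto
    then have "(\<Sum>n. ennreal (exp (h / 2) * exp (- h / 2) ^ n)) \<noteq> top"
      by (intro ennreal_suminf_neq_top) auto
    then show ?thesis by (simp add: less_top)
  qed
  finally show ?thesis .
qed

lemma real_ldist: "real (ldist m k) = \<bar>real_of_int (fst m - fst k)\<bar> + \<bar>real_of_int (snd m - snd k)\<bar>"
  by (simp add: ldist_def)

lemma nn_integral_exp_ldist:
  fixes h :: real
  assumes h: "h > 0"
  shows "(\<integral>\<^sup>+ m. ennreal (exp (- h * real (ldist m k))) \<partial>count_space UNIV) < \<infinity>"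
proof -
  let ?t = "\<lambda>x::site. (fst x + fst k, snd x + snd k)"
  let ?g = "\<lambda>i::int. ennreal (exp (- h * \<bar>real_of_int i\<bar>))"
  have "bij_betw ?t UNIV UNIV"
    by (rule bij_betw_byWitness[where f' = "\<lambda>x. (fst x - fst k, snd x - snd k)"]) auto
  moreover have "ennreal (exp (- h * real (ldist (?t x) k))) = ?g (fst x) * ?g (snd x)" for x
    unfolding real_ldist
    by (simp only: fst_conv snd_conv add_diff_cancel_right' distrib_left exp_add) (rule ennreal_mult, auto)
  moreover note nn_integral_bij_count_space[of ?t UNIV UNIV "\<lambda>m. ennreal (exp (- h * real (ldist m k)))"]
  ultimately have "(\<integral>\<^sup>+ m. ennreal (exp (- h * real (ldist m k))) \<partial>count_space UNIV)
    = (\<integral>\<^sup>+ x. ?g (fst x) * ?g (snd x) \<partial>count_space UNIV)"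
    by (simp only:)
  also have "\<dots> = (\<integral>\<^sup>+ x. \<integral>\<^sup>+ y. ?g x * ?g y \<partial>count_space UNIV \<partial>count_space UNIV)"
    using nn_integral_fst_count_space[of "\<lambda>x. ?g (fst x) * ?g (snd x)"] by simp
  also have "\<dots> = (\<integral>\<^sup>+ y. ?g y \<partial>count_space UNIV) * (\<integral>\<^sup>+ y. ?g y \<partial>count_space UNIV)"
    by (simp add: nn_integral_cmult nn_integral_multc)
  also have "\<dots> < \<infinity>"
    using nn_integral_exp_abs_int[OF h] by (simp add: ennreal_mult_less_top)
  finally show ?thesis .
qed

text \<open>Rounding in \<open>d div 3\<close> loses at most two steps, that is a factor
  \<open>2 powr (2/3)\<close>, which is below 2.\<close>

lemma half_power_le_exp: "(1/2::real) ^ (d div 3) \<le> 2 * exp (- (ln 2 / 3) * real d)"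
proof -
  have "real d \<le> 3 * real (d div 3) + 2"
    using div_mult_mod_eq[of d 3] mod_less_divisor[of 3 d] by linarith
  then have "ln 2 * (real d - 2) \<le> ln 2 * (3 * real (d div 3))" by (intro mult_left_mono) auto
  then have le: "- ln 2 * real (d div 3) \<le> ln 2 * (2 / 3) + - (ln 2 / 3) * real d"
    by (simp add: algebra_simps)
  have "(1/2::real) ^ (d div 3) = exp (- ln 2) ^ (d div 3)" by (simp add: exp_minus)
  also have "\<dots> = exp (- ln 2 * real (d div 3))" by (simp add: exp_of_nat_mult[symmetric] mult.commute)
  also have "\<dots> \<le> exp (ln 2 * (2 / 3) + - (ln 2 / 3) * real d)" using le by simp
  also have "\<dots> \<le> exp (ln 2 + - (ln 2 / 3) * real d)" by simp
  also have "\<dots> = 2 * exp (- (ln 2 / 3) * real d)" by (simp only: exp_add exp_ln zero_less_numeral)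
  finally show ?thesis .
qed

lemma enorm_le_ldist: "enorm (fst m - fst k, snd m - snd k) \<le> real (ldist m k)"
  unfolding enorm_def real_ldist fst_conv snd_conv by (rule sqrt_sum_squares_le_sum_abs)

lemma enorm_le: "enorm m \<le> real (ldist m k) + real (ldist k (0, 0))"
proof -
  have "enorm m \<le> real (ldist m (0, 0))" using enorm_le_ldist[of m "(0, 0)"] by simp
  also have "\<dots> \<le> real (ldist m k) + real (ldist k (0, 0))" using ldist_triangle[of m "(0, 0)" k] by simp
  finally show ?thesis .
qed

context strip_model
begin

lemma dynamical_localization:
  assumes "mu \<in> strip M" "nu \<in> strip M"
  shows "(\<integral>\<^sup>+ om. (SUP f \<in> {f. continuous_on circle f \<and> (\<forall>z\<in>circle. cmod (f z) \<le> 1)}.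
      ennreal (cmod (fcalc (V om) f (e nu) mu))) \<partial>Prob)
    \<le> ennreal (2 * (8 * pi * C\<^sup>2 + 1) * exp (- (ln 2 / 3) * enorm (fst mu - fst nu, snd mu - snd nu)))"
proof -
  have "(\<integral>\<^sup>+ om. (SUP f \<in> {f. continuous_on circle f \<and> (\<forall>z\<in>circle. cmod (f z) \<le> 1)}.
      ennreal (cmod (fcalc (V om) f (e nu) mu))) \<partial>Prob) \<le> (\<integral>\<^sup>+ om. Y mu nu om \<partial>Prob)"
  \<comment> \<open>\<open>Y\<close> lies above all \<open>f\<close> at once, so the supremum over
    the uncountable family is dominated before integration.\<close>
  proof (rule nn_integral_mono_AE)
    show "AE om in Prob. (SUP f \<in> {f. continuous_on circle f \<and> (\<forall>z\<in>circle. cmod (f z) \<le> 1)}.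
      ennreal (cmod (fcalc (V om) f (e nu) mu))) \<le> Y mu nu om"
      using AE_unit_phase
    proof eventually_elim
      case (elim om)
      show ?case by (rule SUP_least) (auto intro!: fcalc_le_Y elim assms)
    qed
  qed
  also have "\<dots> \<le> ennreal (rate mu nu)" by (rule nn_integral_Y[OF assms(2)])
  also have "\<dots> \<le> ennreal (2 * (8 * pi * C\<^sup>2 + 1) * exp (- (ln 2 / 3) * enorm (fst mu - fst nu, snd mu - snd nu)))"
  proof (rule ennreal_leI)
    have "exp (- (ln 2 / 3) * real (ldist mu nu)) \<le> exp (- (ln 2 / 3) * enorm (fst mu - fst nu, snd mu - snd nu))"
      using enorm_le_ldist[of mu nu] by (simp add: mult_left_mono divide_right_mono)
    then have "(1/2::real) ^ (ldist mu nu div 3) \<le> 2 * exp (- (ln 2 / 3) * enorm (fst mu - fst nu, snd mu - snd nu))"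
      using half_power_le_exp[of "ldist mu nu"] by linarith
    then have "rate mu nu \<le> (8 * pi * C\<^sup>2 + 1) * (2 * exp (- (ln 2 / 3) * enorm (fst mu - fst nu, snd mu - snd nu)))"
      unfolding rate_def by (intro mult_left_mono) auto
    then show "rate mu nu \<le> 2 * (8 * pi * C\<^sup>2 + 1) * exp (- (ln 2 / 3) * enorm (fst mu - fst nu, snd mu - snd nu))"
      by (simp only: mult_ac)
  qed
  finally show ?thesis .
qed

text \<open>Half of the rate, \<open>h = ln 2 / 6\<close>, absorbs the polynomial weight and the
  other half is summed over the lattice. The weight is squared to match
  \<open>sqnorm\<close>.\<close>

lemma weighted_rate_summable:
  assumes p: "p \<ge> 0"
  shows "(\<integral>\<^sup>+ m. ennreal ((if p = 0 then 1 else enorm m powr p)\<^sup>2 * rate m k) \<partial>count_space UNIV) < \<infinity>"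
proof -
  define c where "c = real (ldist k (0, 0))"
  define h :: real where "h = ln 2 / 6"
  have h: "h > (0::real)" by (simp add: h_def)
  have c: "c \<ge> 0" by (simp add: c_def)
  have "(\<lambda>d. (1 + real d + c) powr (2 * p) * exp (- h * real d)) \<longlonglongrightarrow> 0"
    using h by real_asymp
  then have "Bseq (\<lambda>d. (1 + real d + c) powr (2 * p) * exp (- h * real d))"
    by (intro convergent_imp_Bseq) (auto simp: convergent_def)
  then obtain K where K: "K > 0" "\<And>d. \<bar>(1 + real d + c) powr (2 * p) * exp (- h * real d)\<bar> \<le> K"
    unfolding Bseq_def by auto
  define R where "R = (8 * pi * C\<^sup>2 + 1) * 2"
  have R: "R \<ge> 0" by (simp add: R_def)
  have bound: "(if p = 0 then 1 else enorm m powr p)\<^sup>2 * rate m k \<le> K * R * exp (- h * real (ldist m k))" for m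
  proof -
    let ?d = "real (ldist m k)"
    have w: "(if p = 0 then 1 else enorm m powr p)\<^sup>2 \<le> (1 + ?d + c) powr (2 * p)"
    proof (cases "p = 0")
      case False
      have "enorm m \<ge> 0" by (simp add: enorm_def)
      then have "enorm m powr p \<le> (1 + ?d + c) powr p"
        using enorm_le[of m k] p by (intro powr_mono2) (auto simp: c_def)
      then have "(enorm m powr p)\<^sup>2 \<le> ((1 + ?d + c) powr p)\<^sup>2" by (intro power_mono) auto
      then show ?thesis using False by (simp add: power2_eq_square powr_add[symmetric])
    qed (use c in simp)
    have r: "rate m k \<le> R * exp (- (ln 2 / 3) * ?d)"
      unfolding rate_def R_def mult.assoc using half_power_le_exp[of "ldist m k"] by (intro mult_left_mono) auto
    have "exp (- (ln 2 / 3) * ?d) = exp (- h * ?d) * exp (- h * ?d)"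
      by (simp add: h_def exp_add[symmetric])
    then have "(if p = 0 then 1 else enorm m powr p)\<^sup>2 * rate m k
      \<le> (1 + ?d + c) powr (2 * p) * (R * (exp (- h * ?d) * exp (- h * ?d)))"
      using w r rate_nonneg by (intro mult_mono) auto
    also have "\<dots> = ((1 + ?d + c) powr (2 * p) * exp (- h * ?d)) * (R * exp (- h * ?d))" by (simp only: mult_ac)
    also have "\<dots> \<le> K * (R * exp (- h * ?d))"
      using K(2)[of "ldist m k"] R by (intro mult_right_mono) auto
    finally show ?thesis by (simp only: mult_ac)
  qed
  have "(\<integral>\<^sup>+ m. ennreal ((if p = 0 then 1 else enorm m powr p)\<^sup>2 * rate m k) \<partial>count_space UNIV)
    \<le> (\<integral>\<^sup>+ m. ennreal (K * R) * ennreal (exp (- h * real (ldist m k))) \<partial>count_space UNIV)"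
    using bound K(1) R by (intro nn_integral_mono) (simp add: ennreal_leI flip: ennreal_mult)
  also have "\<dots> = ennreal (K * R) * (\<integral>\<^sup>+ m. ennreal (exp (- h * real (ldist m k))) \<partial>count_space UNIV)"
    by (rule nn_integral_cmult) simp
  also have "\<dots> < \<infinity>" using nn_integral_exp_ldist[OF h, of k] by (simp add: ennreal_mult_less_top)
  finally show ?thesis .
qed

text \<open>\<open>F\<close> dominates the weighted norms at all times: entries of powers are at
  most 1, so their squares lie below the entries and hence below \<open>Y\<close>, which does not
  depend on the time. The mean of \<open>F\<close> is finite, so \<open>F\<close> is finite almost
  surely.\<close>

lemma moments_bounded:
  assumes p: "p \<ge> 0" and psi: "in_l2 (strip M) psi" and fin: "finite {mu. psi mu \<noteq> 0}"
  shows "AE om in Prob. (SUP n::int. sqnorm (absX_pow p (upow (V om) n psi))) < \<infinity>"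
proof -
  define S where "S = {mu. psi mu \<noteq> 0}"
  have S: "finite S" "S \<subseteq> strip M" using fin psi by (auto simp: S_def in_l2_def)
  have psi_eq: "psi = (\<lambda>x. \<Sum>nu\<in>S. psi nu * e nu x)"
    using sum_times_e[OF S(1), of psi] by (auto simp: S_def fun_eq_iff)
  let ?w = "\<lambda>m. (if p = 0 then 1 else enorm m powr p)\<^sup>2"
  \<comment> \<open>\<open>card S\<close> is the Cauchy-Schwarz factor for the sum over the
    support.\<close>
  let ?b = "\<lambda>nu. real (card S) * (cmod (psi nu))\<^sup>2"
  let ?t = "\<lambda>m om. \<Sum>nu\<in>S. ennreal (?b nu) * (ennreal (?w m) * Y m nu om)"
  define F where "F = (\<lambda>om. \<integral>\<^sup>+ m. ?t m om \<partial>count_space UNIV)"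
  have meas[measurable]: "?t m \<in> borel_measurable Prob" for m
    by (intro borel_measurable_sum borel_measurable_times_ennreal borel_measurable_const measurable_Y)
  have EF: "(\<integral>\<^sup>+ om. F om \<partial>Prob) < \<infinity>"
  proof -
    have "(\<integral>\<^sup>+ om. F om \<partial>Prob) = (\<integral>\<^sup>+ m. \<integral>\<^sup>+ om. ?t m om \<partial>Prob \<partial>count_space UNIV)"
      unfolding F_def by (rule nn_integral_count_space_nn_integral[OF _ meas]) simp
    also have "\<dots> = (\<integral>\<^sup>+ m. (\<Sum>nu\<in>S. ennreal (?b nu) * (ennreal (?w m) * (\<integral>\<^sup>+ om. Y m nu om \<partial>Prob))) \<partial>count_space UNIV)"
    proof (rule nn_integral_cong)
      fix m
      have "(\<integral>\<^sup>+ om. ?t m om \<partial>Prob) = (\<Sum>nu\<in>S. (\<integral>\<^sup>+ om. ennreal (?b nu) * (ennreal (?w m) * Y m nu om) \<partial>Prob))"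
        by (intro nn_integral_sum borel_measurable_times_ennreal borel_measurable_const measurable_Y)
      also have "\<dots> = (\<Sum>nu\<in>S. ennreal (?b nu) * (ennreal (?w m) * (\<integral>\<^sup>+ om. Y m nu om \<partial>Prob)))"
      proof (rule sum.cong[OF refl])
        fix nu
        have "(\<integral>\<^sup>+ om. ennreal (?b nu) * (ennreal (?w m) * Y m nu om) \<partial>Prob)
          = ennreal (?b nu) * (\<integral>\<^sup>+ om. ennreal (?w m) * Y m nu om \<partial>Prob)"
          by (intro nn_integral_cmult borel_measurable_times_ennreal borel_measurable_const measurable_Y)
        also have "(\<integral>\<^sup>+ om. ennreal (?w m) * Y m nu om \<partial>Prob) = ennreal (?w m) * (\<integral>\<^sup>+ om. Y m nu om \<partial>Prob)"
          by (intro nn_integral_cmult measurable_Y)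
        finally show "(\<integral>\<^sup>+ om. ennreal (?b nu) * (ennreal (?w m) * Y m nu om) \<partial>Prob)
          = ennreal (?b nu) * (ennreal (?w m) * (\<integral>\<^sup>+ om. Y m nu om \<partial>Prob))" .
      qed
      finally show "(\<integral>\<^sup>+ om. ?t m om \<partial>Prob)
        = (\<Sum>nu\<in>S. ennreal (?b nu) * (ennreal (?w m) * (\<integral>\<^sup>+ om. Y m nu om \<partial>Prob)))" .
    qed
    also have "\<dots> \<le> (\<integral>\<^sup>+ m. (\<Sum>nu\<in>S. ennreal (?b nu) * ennreal (?w m * rate m nu)) \<partial>count_space UNIV)"
    proof (rule nn_integral_mono, rule sum_mono)
      fix m nu assume "nu \<in> S"
      then have "nu \<in> strip M" using S(2) by blast
      then have "ennreal (?w m) * (\<integral>\<^sup>+ om. Y m nu om \<partial>Prob) \<le> ennreal (?w m) * ennreal (rate m nu)"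
        by (intro mult_left_mono nn_integral_Y) auto
      also have "\<dots> = ennreal (?w m * rate m nu)" by (rule ennreal_mult[symmetric]) (auto simp: rate_nonneg)
      finally show "ennreal (?b nu) * (ennreal (?w m) * (\<integral>\<^sup>+ om. Y m nu om \<partial>Prob)) \<le> ennreal (?b nu) * ennreal (?w m * rate m nu)"
        by (rule mult_left_mono) simp
    qed
    also have "\<dots> = (\<Sum>nu\<in>S. ennreal (?b nu) * (\<integral>\<^sup>+ m. ennreal (?w m * rate m nu) \<partial>count_space UNIV))"
      by (simp add: nn_integral_sum nn_integral_cmult)
    also have "\<dots> < \<infinity>"
      using S weighted_rate_summable[OF p] by (simp add: ennreal_mult_less_top)
    finally show ?thesis .
  qed
  have le: "sqnorm (absX_pow p (upow (V om) j psi)) \<le> F om" if om: "unit_phase om" for om j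
    unfolding sqnorm_def F_def
  proof (rule nn_integral_mono)
    fix m
    let ?u = "\<lambda>nu. upow (V om) j (e nu) m"
    have up: "upow (V om) j psi m = (\<Sum>nu\<in>S. psi nu * ?u nu)"
      by (subst psi_eq) (simp add: upow_sum)
    show "ennreal ((cmod (absX_pow p (upow (V om) j psi) m))\<^sup>2) \<le> ?t m om"
    proof (cases "m \<in> strip M")
      case False
      then have "?u nu = 0" if "nu \<in> S" for nu using upow_e_outside that S by blast
      then have "upow (V om) j psi m = 0" unfolding up by simp
      then show ?thesis by (simp add: absX_pow_def)
    next
      case True
      have "(cmod (\<Sum>nu\<in>S. psi nu * ?u nu))\<^sup>2 \<le> (\<Sum>nu\<in>S. cmod (psi nu * ?u nu))\<^sup>2"
        by (intro power_mono norm_sum) auto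
      also have "\<dots> \<le> (\<Sum>nu\<in>S. (cmod (psi nu * ?u nu))\<^sup>2) * real (card S)"
        by (rule sum_squared_le_sum_of_squares)
      also have "\<dots> \<le> (\<Sum>nu\<in>S. (cmod (psi nu))\<^sup>2 * cmod (?u nu)) * real (card S)"
      proof (intro mult_right_mono sum_mono)
        fix nu assume "nu \<in> S"
        then have "cmod (?u nu) \<le> 1" using upow_le_Y(2)[OF om _ True] S(2) by blast
        then have "(cmod (?u nu))\<^sup>2 \<le> cmod (?u nu)" by (simp add: power2_eq_square mult_left_le_one_le)
        then show "(cmod (psi nu * ?u nu))\<^sup>2 \<le> (cmod (psi nu))\<^sup>2 * cmod (?u nu)"
          by (simp add: norm_mult power_mult_distrib mult_left_mono)
      qed simp
      finally have 1: "(cmod (upow (V om) j psi m))\<^sup>2 \<le> (\<Sum>nu\<in>S. ?b nu * cmod (?u nu))"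
        unfolding up by (simp add: sum_distrib_right sum_distrib_left mult_ac)
      have "(cmod (absX_pow p (upow (V om) j psi) m))\<^sup>2 = ?w m * (cmod (upow (V om) j psi m))\<^sup>2"
        unfolding absX_pow_def norm_mult norm_of_real power_mult_distrib power2_abs ..
      also have "\<dots> \<le> ?w m * (\<Sum>nu\<in>S. ?b nu * cmod (?u nu))" using 1 by (intro mult_left_mono) auto
      also have "\<dots> = (\<Sum>nu\<in>S. ?b nu * (?w m * cmod (?u nu)))" by (simp add: sum_distrib_left mult_ac)
      finally have "ennreal ((cmod (absX_pow p (upow (V om) j psi) m))\<^sup>2) \<le> ennreal (\<Sum>nu\<in>S. ?b nu * (?w m * cmod (?u nu)))"
        by (rule ennreal_leI)
      also have "\<dots> = (\<Sum>nu\<in>S. ennreal (?b nu) * (ennreal (?w m) * ennreal (cmod (?u nu))))"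
        by (subst sum_ennreal[symmetric]) (auto simp: ennreal_mult)
      also have "\<dots> \<le> ?t m om"
        using S upow_le_Y(1)[OF om _ True] by (intro sum_mono mult_left_mono) auto
      finally show ?thesis .
    qed
  qed
  have Fm: "F \<in> borel_measurable Prob"
  proof -
    interpret C: sigma_finite_measure "count_space (UNIV :: site set)"
      by (rule sigma_finite_measure_count_space_countable) simp
    define T where "T = (\<lambda>m om. ?t m om)"
    have "T m \<in> borel_measurable Prob" for m unfolding T_def by (rule meas)
    then have "(\<lambda>p. T (fst p) (snd p)) \<in> borel_measurable (count_space UNIV \<Otimes>\<^sub>M Prob)"
      by (intro measurable_pair_measure_countable1) simp_all
    from C.borel_measurable_nn_integral_fst[OF measurable_compose[OF measurable_pair_swap' this]]
    have "(\<lambda>om. \<integral>\<^sup>+ m. T m om \<partial>count_space UNIV) \<in> borel_measurable Prob" by simp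
    then show ?thesis unfolding F_def T_def .
  qed
  have "AE om in Prob. F om \<noteq> \<infinity>"
    using EF by (intro nn_integral_PInf_AE Fm) auto
  with AE_unit_phase show ?thesis
  proof eventually_elim
    case (elim om)
    have "(SUP n::int. sqnorm (absX_pow p (upow (V om) n psi))) \<le> F om"
      by (rule SUP_least) (rule le[OF elim(1)])
    also have "F om < \<infinity>" using elim(2) by (simp add: less_top)
    finally show ?case .
  qed
qed

end

section \<open>Pure point spectrum\<close>

text \<open>Cantor's diagonal argument along an enumeration of the index type.\<close>

lemma bounded_family_convergent_subsequence:
  fixes g :: "nat \<Rightarrow> 'i::countable \<Rightarrow> complex"
  assumes bound: "\<And>k i. cmod (g k i) \<le> 1"
  obtains r where "strict_mono r" "\<And>i. convergent (\<lambda>k. g (r k) i)"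
proof -
  define P where "P = (\<lambda>n s. convergent (\<lambda>k. g (s k) (from_nat n)))"
  interpret subseqs P
  proof
    fix n and s :: "nat \<Rightarrow> nat"
    have "bounded (range (\<lambda>k. g (s k) (from_nat n)))"
      using bound by (intro boundedI[of _ 1]) auto
    then obtain l r where "strict_mono r" "((\<lambda>k. g (s k) (from_nat n)) \<circ> r) \<longlonglongrightarrow> l"
      using bounded_imp_convergent_subsequence by blast
    then show "\<exists>r'. strict_mono r' \<and> P n (s \<circ> r')"
      by (intro exI[of _ r]) (auto simp: P_def convergent_def o_def)
  qed
  have "P n (diagseq \<circ> ((+) (Suc n)))" for n
  proof (rule diagseq_holds)
    fix n and s r :: "nat \<Rightarrow> nat" assume "strict_mono r" "P n s"
    then show "P n (s \<circ> r)"
      using convergent_subseq_convergent[of "\<lambda>k. g (s k) (from_nat n)" r] by (simp add: P_def o_def)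
  qed
  note diag = this
  have "convergent (\<lambda>k. g (diagseq (k + Suc n)) (from_nat n))" for n
    using diag[of n] by (simp only: P_def comp_def add.commute[of _ "Suc n"])
  then have "convergent (\<lambda>k. g (diagseq k) (from_nat n))" for n
    using convergent_ignore_initial_segment[of "\<lambda>k. g (diagseq k) (from_nat n)" "Suc n"] by blast
  then have "convergent (\<lambda>k. g (diagseq k) i)" for i by (metis from_nat_to_nat)
  then show ?thesis using that subseq_diagseq by blast
qed

definition exhaustion :: "nat \<Rightarrow> 'i::countable set" where
  "exhaustion n = {x. to_nat x \<le> n}"

lemma finite_exhaustion: "finite (exhaustion n)"
proof -
  have "exhaustion n \<subseteq> from_nat ` {..n}"
    by (auto simp: exhaustion_def) (metis atMost_iff from_nat_to_nat image_eqI)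
  then show ?thesis by (rule finite_subset) simp
qed

lemma count_space_tail:
  fixes f :: "'i::countable \<Rightarrow> ennreal"
  assumes "(\<integral>\<^sup>+ x. f x \<partial>count_space UNIV) < \<infinity>"
  shows "(INF n. \<integral>\<^sup>+ x. f x * indicator (- exhaustion n) x \<partial>count_space UNIV) = 0"
proof -
  let ?g = "\<lambda>n x. f x * indicator (- exhaustion n) x"
  have dec: "decseq ?g"
    by (intro decseq_SucI le_funI) (auto simp: exhaustion_def split: split_indicator)
  have fin: "(\<integral>\<^sup>+ x. ?g 0 x \<partial>count_space UNIV) < \<infinity>"
  proof (rule order.strict_trans1[OF _ assms])
    show "(\<integral>\<^sup>+ x. ?g 0 x \<partial>count_space UNIV) \<le> (\<integral>\<^sup>+ x. f x \<partial>count_space UNIV)"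
      by (rule nn_integral_mono) (auto split: split_indicator)
  qed
  have "(INF n. ?g n x) = 0" for x
  proof -
    have "(INF n. ?g n x) \<le> ?g (to_nat x) x" by (rule INF_lower) simp
    also have "\<dots> = 0" by (simp add: exhaustion_def)
    finally show ?thesis by simp
  qed
  then show ?thesis
    using nn_integral_monotone_convergence_INF_decseq[OF dec _ fin] by simp
qed

lemma count_space_le_of_finite:
  fixes f :: "'i::countable \<Rightarrow> real"
  assumes f: "\<And>x. 0 \<le> f x" and c: "\<And>J. finite J \<Longrightarrow> (\<Sum>x\<in>J. f x) \<le> c"
  shows "(\<integral>\<^sup>+ x. ennreal (f x) \<partial>count_space UNIV) \<le> ennreal c"
proof -
  let ?g = "\<lambda>n x. ennreal (f x) * indicator (exhaustion n) x"
  have "ennreal (f x) = (SUP n. ?g n x)" for x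
  proof (rule antisym)
    have "ennreal (f x) = ?g (to_nat x) x" by (simp add: exhaustion_def)
    also have "\<dots> \<le> (SUP n. ?g n x)" by (rule SUP_upper) simp
    finally show "ennreal (f x) \<le> (SUP n. ?g n x)" .
    show "(SUP n. ?g n x) \<le> ennreal (f x)"
      by (rule SUP_least) (auto split: split_indicator)
  qed
  then have "(\<integral>\<^sup>+ x. ennreal (f x) \<partial>count_space UNIV) = (\<integral>\<^sup>+ x. (SUP n. ?g n x) \<partial>count_space UNIV)" by simp
  also have "\<dots> = (SUP n. \<integral>\<^sup>+ x. ?g n x \<partial>count_space UNIV)"
    by (rule nn_integral_monotone_convergence_SUP)
       (auto simp: incseq_def le_fun_def exhaustion_def intro!: mult_left_mono split: split_indicator)
  also have "\<dots> \<le> ennreal c"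
  proof (rule SUP_least)
    fix n
    have "(\<integral>\<^sup>+ x. ?g n x \<partial>count_space UNIV) = (\<integral>\<^sup>+ x. ennreal (f x) \<partial>count_space (exhaustion n))"
      by (simp add: nn_integral_count_space_indicator)
    also have "\<dots> = (\<Sum>x\<in>exhaustion n. ennreal (f x))"
      by (rule nn_integral_count_space_finite) (rule finite_exhaustion)
    also have "\<dots> = ennreal (\<Sum>x\<in>exhaustion n. f x)" using f by simp
    also have "\<dots> \<le> ennreal c" by (intro ennreal_leI c finite_exhaustion)
    finally show "(\<integral>\<^sup>+ x. ?g n x \<partial>count_space UNIV) \<le> ennreal c" .
  qed
  finally show ?thesis .
qed

lemma sqnorm_le_of_nsq:
  assumes "\<And>J. finite J \<Longrightarrow> nsq J psi \<le> c"
  shows "sqnorm psi \<le> ennreal c"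
  unfolding sqnorm_def using assms by (intro count_space_le_of_finite) (auto simp: nsq_def)

lemma sqnorm_add: "sqnorm (\<lambda>x. f x + g x) \<le> 2 * sqnorm f + 2 * sqnorm g"
proof -
  have "sqnorm (\<lambda>x. f x + g x) \<le> (\<integral>\<^sup>+ x. 2 * ennreal ((cmod (f x))\<^sup>2) + 2 * ennreal ((cmod (g x))\<^sup>2) \<partial>count_space UNIV)"
    unfolding sqnorm_def
  proof (rule nn_integral_mono)
    fix x
    have "(cmod (f x + g x))\<^sup>2 \<le> (cmod (f x) + cmod (g x))\<^sup>2" by (intro power_mono norm_triangle_ineq) auto
    also have "\<dots> \<le> 2 * (cmod (f x))\<^sup>2 + 2 * (cmod (g x))\<^sup>2"
      using sum_squares_bound[of "cmod (f x)" "cmod (g x)"] by (simp add: power2_sum)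
    finally have "ennreal ((cmod (f x + g x))\<^sup>2) \<le> ennreal (2 * (cmod (f x))\<^sup>2 + 2 * (cmod (g x))\<^sup>2)"
      by (rule ennreal_leI)
    then show "ennreal ((cmod (f x + g x))\<^sup>2) \<le> 2 * ennreal ((cmod (f x))\<^sup>2) + 2 * ennreal ((cmod (g x))\<^sup>2)"
      by (simp add: ennreal_plus ennreal_mult)
  qed
  also have "\<dots> = 2 * sqnorm f + 2 * sqnorm g"
    by (simp add: sqnorm_def nn_integral_add nn_integral_cmult)
  finally show ?thesis .
qed

text \<open>Adding one summand at a time avoids concatenating index ranges;
  \<open>eig_span_finite_sum\<close> recovers the indexed form required by
  \<open>pure_point\<close>.\<close>

inductive eig_span :: "site set \<Rightarrow> op \<Rightarrow> vec \<Rightarrow> bool" for L U where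
  eig_zero: "eig_span L U (\<lambda>x. 0)"
| eig_step: "eig_span L U f \<Longrightarrow> eigvec L U v \<Longrightarrow> eig_span L U (\<lambda>x. f x + c * v x)"

lemma eig_span_add:
  assumes "eig_span L U f" "eig_span L U g"
  shows "eig_span L U (\<lambda>x. f x + g x)"
  using assms(2,1)
proof (induction rule: eig_span.induct)
  case (eig_step g v c)
  have "eig_span L U (\<lambda>x. (f x + g x) + c * v x)"
    by (rule eig_span.eig_step) (use eig_step in auto)
  then show ?case by (simp add: add.assoc)
qed simp

lemma eig_span_cmult: "eig_span L U f \<Longrightarrow> eig_span L U (\<lambda>x. d * f x)"
proof (induction rule: eig_span.induct)
  case (eig_step f v c)
  have "eig_span L U (\<lambda>x. d * f x + (d * c) * v x)"
    by (rule eig_span.eig_step) (use eig_step in auto)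
  then show ?case by (simp add: distrib_left mult.assoc)
qed (simp add: eig_zero)

lemma eig_span_sum:
  "(\<And>i. i \<in> I \<Longrightarrow> eig_span L U (f i)) \<Longrightarrow> eig_span L U (\<lambda>x. \<Sum>i\<in>I. f i x)"
  by (induction I rule: infinite_finite_induct) (auto simp: eig_zero intro: eig_span_add)

lemma eig_span_eigvec: "eigvec L U v \<Longrightarrow> eig_span L U v"
  using eig_step[OF eig_zero, of L U v 1] by simp

lemma eig_span_finite_sum:
  "eig_span L U f \<Longrightarrow> \<exists>(n::nat) c v. (\<forall>i<n. eigvec L U (v i)) \<and> f = (\<lambda>x. \<Sum>i<n. c i * v i x)"
proof (induction rule: eig_span.induct)
  case eig_zero
  show ?case by (intro exI[of _ 0]) simp
next
  case (eig_step f v0 c0)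
  then obtain n :: nat and c v where *: "\<forall>i<n. eigvec L U (v i)" "f = (\<lambda>x. \<Sum>i<n. c i * v i x)" by blast
  have "(\<Sum>i<n. (c(n := c0)) i * (v(n := v0)) i x) = (\<Sum>i<n. c i * v i x)" for x
    by (rule sum.cong) auto
  then show ?case using * eig_step.hyps
    by (intro exI[of _ "Suc n"] exI[of _ "c(n := c0)"] exI[of _ "v(n := v0)"]) (auto simp: less_Suc_eq)
qed

lemma pure_point_of_sites:
  assumes e: "\<And>nu eps::real. nu \<in> L \<Longrightarrow> eps > 0 \<Longrightarrow> \<exists>u. eig_span L U u \<and> sqnorm (\<lambda>x. e nu x - u x) \<le> ennreal eps"
  shows "pure_point L U"
  unfolding pure_point_def
proof (intro allI impI)
  fix psi and eps :: real assume psi: "in_l2 L psi" and eps: "eps > 0"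
  have "(\<integral>\<^sup>+ x. ennreal ((cmod (psi x))\<^sup>2) \<partial>count_space UNIV) < \<infinity>"
    using psi by (simp add: in_l2_def sqnorm_def)
  from count_space_tail[OF this]
  \<comment> \<open>Tail and finite part get \<open>eps / 8\<close> each; \<open>sqnorm_add\<close>
    doubles both, and the total \<open>eps / 2\<close> leaves room for the strict
    inequality.\<close>
  have "(INF n. \<integral>\<^sup>+ x. ennreal ((cmod (psi x))\<^sup>2) * indicator (- exhaustion n) x \<partial>count_space UNIV) < ennreal (eps / 8)"
    using eps by simp
  then obtain n where n: "(\<integral>\<^sup>+ x. ennreal ((cmod (psi x))\<^sup>2) * indicator (- exhaustion n) x \<partial>count_space UNIV) < ennreal (eps / 8)"
    by (auto simp: INF_less_iff)
  define J where "J = exhaustion n \<inter> L"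
  have J: "finite J" "J \<subseteq> L" by (auto simp: J_def finite_exhaustion)
  define tl where "tl = (\<lambda>x. if x \<in> J then 0 else psi x)"
  have tl: "sqnorm tl \<le> ennreal (eps / 8)"
  proof -
    have "sqnorm tl \<le> (\<integral>\<^sup>+ x. ennreal ((cmod (psi x))\<^sup>2) * indicator (- exhaustion n) x \<partial>count_space UNIV)"
      unfolding sqnorm_def using psi by (intro nn_integral_mono) (auto simp: tl_def J_def in_l2_def split: split_indicator)
    then show ?thesis using n by simp
  qed
  \<comment> \<open>Apart from the 1, which keeps \<open>B\<close> positive when \<open>psi\<close>
    vanishes on \<open>J\<close>, this is the Cauchy-Schwarz factor in the estimate of
    \<open>r\<close>.\<close>
  define B where "B = 1 + real (card J) * (\<Sum>nu\<in>J. (cmod (psi nu))\<^sup>2)"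
  have B: "B > 0" unfolding B_def by (intro add_pos_nonneg mult_nonneg_nonneg sum_nonneg) auto
  define d where "d = eps / (8 * B)"
  have d: "d > 0" using eps B by (simp add: d_def)
  have "\<exists>u. \<forall>nu\<in>J. eig_span L U (u nu) \<and> sqnorm (\<lambda>x. e nu x - u nu x) \<le> ennreal d"
    using e[OF _ d] J(2) by (intro bchoice) blast
  then obtain u where u: "\<And>nu. nu \<in> J \<Longrightarrow> eig_span L U (u nu)" "\<And>nu. nu \<in> J \<Longrightarrow> sqnorm (\<lambda>x. e nu x - u nu x) \<le> ennreal d"
    by blast
  define f where "f = (\<lambda>x. \<Sum>nu\<in>J. psi nu * u nu x)"
  have f: "eig_span L U f" unfolding f_def by (intro eig_span_sum eig_span_cmult u)
  define r where "r = (\<lambda>x. \<Sum>nu\<in>J. psi nu * (e nu x - u nu x))"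
  have eq: "psi x - f x = tl x + r x" for x
    using sum_times_e[OF J(1), of psi x]
    by (simp add: f_def r_def tl_def right_diff_distrib sum_subtractf)
  have r: "sqnorm r \<le> ennreal (eps / 8)"
  proof -
    have "sqnorm r \<le> (\<integral>\<^sup>+ x. (\<Sum>nu\<in>J. ennreal (real (card J) * (cmod (psi nu))\<^sup>2) * ennreal ((cmod (e nu x - u nu x))\<^sup>2)) \<partial>count_space UNIV)"
      unfolding sqnorm_def
    proof (rule nn_integral_mono)
      fix x
      have "(cmod (r x))\<^sup>2 \<le> (\<Sum>nu\<in>J. cmod (psi nu * (e nu x - u nu x)))\<^sup>2"
        unfolding r_def by (intro power_mono norm_sum) auto
      also have "\<dots> \<le> (\<Sum>nu\<in>J. (cmod (psi nu * (e nu x - u nu x)))\<^sup>2) * real (card J)"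
        by (rule sum_squared_le_sum_of_squares)
      also have "\<dots> = (\<Sum>nu\<in>J. (real (card J) * (cmod (psi nu))\<^sup>2) * (cmod (e nu x - u nu x))\<^sup>2)"
        by (simp add: sum_distrib_left sum_distrib_right norm_mult power_mult_distrib mult_ac)
      finally have "ennreal ((cmod (r x))\<^sup>2) \<le> ennreal (\<Sum>nu\<in>J. (real (card J) * (cmod (psi nu))\<^sup>2) * (cmod (e nu x - u nu x))\<^sup>2)"
        by (rule ennreal_leI)
      also have "\<dots> = (\<Sum>nu\<in>J. ennreal ((real (card J) * (cmod (psi nu))\<^sup>2) * (cmod (e nu x - u nu x))\<^sup>2))"
        by (rule sum_ennreal[symmetric]) auto
      also have "\<dots> = (\<Sum>nu\<in>J. ennreal (real (card J) * (cmod (psi nu))\<^sup>2) * ennreal ((cmod (e nu x - u nu x))\<^sup>2))"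
        by (rule sum.cong[OF refl], rule ennreal_mult) auto
      finally show "ennreal ((cmod (r x))\<^sup>2) \<le> (\<Sum>nu\<in>J. ennreal (real (card J) * (cmod (psi nu))\<^sup>2) * ennreal ((cmod (e nu x - u nu x))\<^sup>2))" .
    qed
    also have "\<dots> = (\<Sum>nu\<in>J. ennreal (real (card J) * (cmod (psi nu))\<^sup>2) * sqnorm (\<lambda>x. e nu x - u nu x))"
      by (simp add: nn_integral_sum nn_integral_cmult sqnorm_def)
    also have "\<dots> \<le> (\<Sum>nu\<in>J. ennreal (real (card J) * (cmod (psi nu))\<^sup>2) * ennreal d)"
      using u(2) by (intro sum_mono mult_left_mono) auto
    also have "\<dots> = ennreal (\<Sum>nu\<in>J. real (card J) * (cmod (psi nu))\<^sup>2 * d)"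
      using d by (subst sum_ennreal[symmetric]) (auto simp: ennreal_mult)
    also have "\<dots> \<le> ennreal (eps / 8)"
    proof (rule ennreal_leI)
      have "(\<Sum>nu\<in>J. real (card J) * (cmod (psi nu))\<^sup>2 * d) = (B - 1) * d"
        by (simp add: B_def sum_distrib_left sum_distrib_right)
      also have "\<dots> \<le> B * d" using d by (simp add: mult_right_mono)
      also have "\<dots> = eps / 8" using B by (simp add: d_def)
      finally show "(\<Sum>nu\<in>J. real (card J) * (cmod (psi nu))\<^sup>2 * d) \<le> eps / 8" .
    qed
    finally show ?thesis .
  qed
  have "sqnorm (\<lambda>x. psi x - f x) \<le> 2 * sqnorm tl + 2 * sqnorm r"
    unfolding eq by (rule sqnorm_add)
  also have "\<dots> \<le> 2 * ennreal (eps / 8) + 2 * ennreal (eps / 8)"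
    by (intro add_mono mult_left_mono tl r) auto
  also have "\<dots> = ennreal (eps / 2)" using eps by (simp flip: ennreal_numeral ennreal_mult ennreal_plus)
  also have "\<dots> < ennreal eps" using eps by (intro ennreal_lessI) auto
  finally have "sqnorm (\<lambda>x. psi x - f x) < ennreal eps" .
  moreover obtain n :: nat and c v where "\<forall>i<n. eigvec L U (v i)" "f = (\<lambda>x. \<Sum>i<n. c i * v i x)"
    using eig_span_finite_sum[OF f] by blast
  ultimately show "\<exists>(n::nat) (c::nat \<Rightarrow> complex) v. (\<forall>i<n. eigvec L U (v i)) \<and>
      sqnorm (\<lambda>mu. psi mu - (\<Sum>i<n. c i * v i mu)) < ennreal eps"
    by (intro exI[of _ n] exI[of _ c] exI[of _ v]) auto
qed

section \<open>Limits of box eigenvectors\<close>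

context strip_model
begin

text \<open>A \<open>liminf\<close> below \<open>eps\<close> supplies infinitely many good boxes,
  enough for a subsequence, and \<open>F\<close> is the same for all of them.\<close>

definition localized :: "site \<Rightarrow> (site \<Rightarrow> complex) \<Rightarrow> bool" where
  "localized nu om \<longleftrightarrow> (\<forall>eps>0. \<exists>F. finite F \<and>
     liminf (\<lambda>n. \<Sum>m\<in>box M n - F. B.majorant n m nu om) < ennreal eps)"

text \<open>Fatou's lemma bounds the mean of \<open>Z j\<close> by the tail of the summable rate
  outside \<open>exhaustion j\<close>. The infimum over \<open>j\<close> therefore has mean 0 and
  vanishes almost surely.\<close>

lemma AE_localized:
  assumes nu: "nu \<in> strip M"
  shows "AE om in Prob. localized nu om"
proof -
  define Z where "Z = (\<lambda>j om. liminf (\<lambda>n. \<Sum>m\<in>box M n - exhaustion j. B.majorant n m nu om))"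
  have mz: "(\<lambda>om. \<Sum>m\<in>A. B.majorant n m nu om) \<in> borel_measurable Prob" for A n
    by (intro borel_measurable_sum B.measurable_majorant)
  have Zm: "Z j \<in> borel_measurable Prob" for j
    unfolding Z_def by (intro borel_measurable_liminf mz)
  have EZ: "(\<integral>\<^sup>+ om. Z j om \<partial>Prob) \<le> (\<integral>\<^sup>+ m. ennreal (rate m nu) * indicator (- exhaustion j) m \<partial>count_space UNIV)" for j
  proof -
    have "(\<integral>\<^sup>+ om. Z j om \<partial>Prob) \<le> liminf (\<lambda>n. \<integral>\<^sup>+ om. (\<Sum>m\<in>box M n - exhaustion j. B.majorant n m nu om) \<partial>Prob)"
      unfolding Z_def by (rule nn_integral_liminf) (rule mz)
    also have "\<dots> \<le> liminf (\<lambda>n::nat. \<integral>\<^sup>+ m. ennreal (rate m nu) * indicator (- exhaustion j) m \<partial>count_space UNIV)"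
    proof (rule Liminf_mono)
      show "\<forall>\<^sub>F n in sequentially. (\<integral>\<^sup>+ om. (\<Sum>m\<in>box M n - exhaustion j. B.majorant n m nu om) \<partial>Prob)
        \<le> (\<integral>\<^sup>+ m. ennreal (rate m nu) * indicator (- exhaustion j) m \<partial>count_space UNIV)"
        using box_eventually[OF nu]
      proof eventually_elim
        case (elim n)
        let ?A = "box M n - exhaustion j"
        have "(\<integral>\<^sup>+ om. (\<Sum>m\<in>?A. B.majorant n m nu om) \<partial>Prob) = (\<Sum>m\<in>?A. \<integral>\<^sup>+ om. B.majorant n m nu om \<partial>Prob)"
          by (rule nn_integral_sum) (rule B.measurable_majorant)
        also have "\<dots> \<le> (\<Sum>m\<in>?A. ennreal (rate m nu))"
          unfolding rate_def by (rule sum_mono) (rule B.nn_integral_majorant[OF elim])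
        also have "\<dots> = (\<integral>\<^sup>+ m. ennreal (rate m nu) \<partial>count_space ?A)"
          by (rule nn_integral_count_space_finite[symmetric]) (simp add: finite_box)
        also have "\<dots> = (\<integral>\<^sup>+ m. ennreal (rate m nu) * indicator ?A m \<partial>count_space UNIV)"
          by (rule nn_integral_count_space_indicator) simp
        also have "\<dots> \<le> (\<integral>\<^sup>+ m. ennreal (rate m nu) * indicator (- exhaustion j) m \<partial>count_space UNIV)"
          by (rule nn_integral_mono) (auto split: split_indicator)
        finally show ?case .
      qed
    qed
    also have "\<dots> = (\<integral>\<^sup>+ m. ennreal (rate m nu) * indicator (- exhaustion j) m \<partial>count_space UNIV)"
      by (rule Liminf_const) simp
    finally show ?thesis .
  qed
  have "(\<integral>\<^sup>+ m. ennreal (rate m nu) \<partial>count_space UNIV) < \<infinity>"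
    using weighted_rate_summable[of 0 nu] by simp
  from count_space_tail[OF this]
  have tail: "(INF j. \<integral>\<^sup>+ m. ennreal (rate m nu) * indicator (- exhaustion j) m \<partial>count_space UNIV) = 0" .
  have "(\<integral>\<^sup>+ om. (INF j. Z j om) \<partial>Prob) \<le> (INF j. \<integral>\<^sup>+ om. Z j om \<partial>Prob)"
    by (intro INF_greatest nn_integral_mono INF_lower) simp
  also have "\<dots> \<le> (INF j. \<integral>\<^sup>+ m. ennreal (rate m nu) * indicator (- exhaustion j) m \<partial>count_space UNIV)"
    by (intro INF_mono) (use EZ in blast)
  finally have "(\<integral>\<^sup>+ om. (INF j. Z j om) \<partial>Prob) = 0" using tail by simp
  moreover have "(\<lambda>om. INF j. Z j om) \<in> borel_measurable Prob"
    by (intro borel_measurable_INF Zm) simp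
  ultimately have "AE om in Prob. (INF j. Z j om) = 0"
    by (simp add: nn_integral_0_iff_AE)
  then show ?thesis
  proof eventually_elim
    case (elim om)
    show ?case unfolding localized_def
    proof (intro allI impI)
      fix eps :: real assume "0 < eps"
      then have "(INF j. Z j om) < ennreal eps" using elim by simp
      then obtain j where "Z j om < ennreal eps" by (auto simp: INF_less_iff)
      then show "\<exists>F. finite F \<and> liminf (\<lambda>n. \<Sum>m\<in>box M n - F. B.majorant n m nu om) < ennreal eps"
        using finite_exhaustion[of j] unfolding Z_def by blast
    qed
  qed
qed

text \<open>\<open>G\<close> collects the components with at least half of their mass in
  \<open>F\<close>; Bessel's inequality at each site of \<open>F\<close> admits at most
  \<open>2 * card F\<close> of them. Every other component has mass at most twice its part outside
  \<open>F\<close>, and the correlator bounds the sum of these parts, hence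
  \<open>2 * eps\<close>.\<close>

lemma finite_volume_approximation:
  assumes nu: "nu \<in> box M n" and F: "finite F" and eps: "eps > 0"
    and small: "(\<Sum>m\<in>box M n - F. B.majorant n m nu om) < ennreal eps"
  shows "\<exists>v lam. (\<forall>i. cmod (lam i) = 1 \<and> (\<forall>x. B.U n om (v i) x = lam i * v i x) \<and> nsq (box M n) (v i) \<le> 1
      \<and> (\<forall>x. x \<notin> box M n \<longrightarrow> v i x = 0))
    \<and> (\<forall>J. finite J \<longrightarrow> nsq J (\<lambda>x. e nu x - (\<Sum>i<2 * card F. v i x)) \<le> 2 * eps)"
proof -
  let ?L = "box M n"
  obtain E w where rep: "B.FI.spectral_rep n om nu E w" using B.FI.spectral_rep_exists[OF nu] by blast
  note r = B.FI.rep_finite[OF nu rep] B.FI.rep_unit[OF nu rep] B.FI.rep_eig[OF nu rep]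
    B.FI.rep_sum[OF nu rep] B.FI.rep_supp[OF nu rep] B.FI.rep_mass_pos[OF nu rep]
    B.FI.rep_mass_sum[OF nu rep] B.FI.rep_bessel[OF nu rep] B.FI.rep_orthogonal[OF nu rep]
  have mass1: "nsq ?L (w l) \<le> 1" if "l \<in> E" for l
    using member_le_sum[of l E "\<lambda>l. nsq ?L (w l)"] that r(1,7) by simp
  define G where "G = {l\<in>E. nsq ?L (w l) / 2 \<le> (\<Sum>x\<in>F \<inter> ?L. (cmod (w l x))\<^sup>2)}"
  have G: "finite G" "G \<subseteq> E" using r(1) by (auto simp: G_def)
  have "real (card G) / 2 = (\<Sum>l\<in>G. 1 / 2)" by simp
  also have "\<dots> \<le> (\<Sum>l\<in>G. (\<Sum>x\<in>F \<inter> ?L. (cmod (w l x))\<^sup>2 / nsq ?L (w l)))"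
  proof (rule sum_mono)
    fix l assume l: "l \<in> G"
    then have "nsq ?L (w l) > 0" using r(6) G by blast
    then show "1 / 2 \<le> (\<Sum>x\<in>F \<inter> ?L. (cmod (w l x))\<^sup>2 / nsq ?L (w l))"
      using l by (simp add: G_def sum_divide_distrib[symmetric] pos_le_divide_eq)
  qed
  also have "\<dots> \<le> (\<Sum>l\<in>E. (\<Sum>x\<in>F \<inter> ?L. (cmod (w l x))\<^sup>2 / nsq ?L (w l)))"
    using G r(1) by (intro sum_mono2 sum_nonneg) auto
  also have "\<dots> = (\<Sum>x\<in>F \<inter> ?L. (\<Sum>l\<in>E. (cmod (w l x))\<^sup>2 / nsq ?L (w l)))" by (rule sum.swap)
  also have "\<dots> \<le> (\<Sum>x\<in>F \<inter> ?L. 1)" using r(8) by (intro sum_mono) auto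
  also have "\<dots> \<le> real (card F)" using F by (simp add: card_mono)
  finally have cardG: "card G \<le> 2 * card F" by linarith
  have rest: "(\<Sum>l\<in>E - G. nsq ?L (w l)) \<le> 2 * eps"
  proof -
    have half: "nsq ?L (w l) \<le> 2 * (\<Sum>x\<in>?L - F. cmod (w l x))" if l: "l \<in> E - G" for l
    proof -
      have "nsq ?L (w l) = (\<Sum>x\<in>F \<inter> ?L. (cmod (w l x))\<^sup>2) + (\<Sum>x\<in>?L - F. (cmod (w l x))\<^sup>2)"
        unfolding nsq_def using finite_box by (subst sum.union_disjoint[symmetric]) (auto intro!: sum.cong)
      moreover have "(\<Sum>x\<in>F \<inter> ?L. (cmod (w l x))\<^sup>2) < nsq ?L (w l) / 2" using l by (auto simp: G_def)
      moreover have "(\<Sum>x\<in>?L - F. (cmod (w l x))\<^sup>2) \<le> (\<Sum>x\<in>?L - F. cmod (w l x))"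
      proof (rule sum_mono)
        fix x assume "x \<in> ?L - F"
        then have "(cmod (w l x))\<^sup>2 \<le> 1" using cmod_le_nsq[OF finite_box, of x M n "w l"] mass1[of l] l by force
        then have "cmod (w l x) \<le> 1" by (simp add: abs_square_le_1)
        then show "(cmod (w l x))\<^sup>2 \<le> cmod (w l x)" by (simp add: power2_eq_square mult_left_le_one_le)
      qed
      ultimately show ?thesis by linarith
    qed
    have "ennreal (\<Sum>x\<in>?L - F. \<Sum>l\<in>E. cmod (w l x)) = (\<Sum>x\<in>?L - F. ennreal (\<Sum>l\<in>E. cmod (w l x)))"
      by (rule sum_ennreal[symmetric]) (auto intro: sum_nonneg)
    also have "\<dots> \<le> (\<Sum>x\<in>?L - F. B.majorant n x nu om)"
      by (rule sum_mono) (use B.spectral_correlator_le[OF nu _ rep] in auto)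
    also have "\<dots> < ennreal eps" by (rule small)
    finally have corr: "(\<Sum>x\<in>?L - F. \<Sum>l\<in>E. cmod (w l x)) < eps"
      using eps by (simp add: ennreal_less_iff sum_nonneg)
    have "(\<Sum>l\<in>E - G. nsq ?L (w l)) \<le> (\<Sum>l\<in>E - G. 2 * (\<Sum>x\<in>?L - F. cmod (w l x)))"
      by (rule sum_mono) (rule half)
    also have "\<dots> \<le> (\<Sum>l\<in>E. 2 * (\<Sum>x\<in>?L - F. cmod (w l x)))"
      using r(1) by (intro sum_mono2) (auto intro!: sum_nonneg)
    also have "\<dots> = 2 * (\<Sum>x\<in>?L - F. \<Sum>l\<in>E. cmod (w l x))"
      by (simp add: sum_distrib_left[symmetric] sum.swap[of _ E])
    finally show ?thesis using corr by simp
  qed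
  obtain h where h: "bij_betw h {0..<card G} G" using ex_bij_betw_nat_finite[OF G(1)] by blast
  \<comment> \<open>Padding with zero vectors, and below with the eigenvalue 1, makes the number of
    vectors \<open>2 * card F\<close> for every box.\<close>
  define v where "v = (\<lambda>i. if i < card G then w (h i) else (\<lambda>_. 0))"
  define lam where "lam = (\<lambda>i. if i < card G then h i else 1)"
  have hE: "h i \<in> E" if "i < card G" for i using h G(2) that by (auto simp: bij_betw_def)
  have props: "cmod (lam i) = 1 \<and> (\<forall>x. B.U n om (v i) x = lam i * v i x) \<and> nsq ?L (v i) \<le> 1
      \<and> (\<forall>x. x \<notin> ?L \<longrightarrow> v i x = 0)" for i
  proof (cases "i < card G")
    case True
    then show ?thesis using hE[OF True] r(2,3,5) mass1 by (simp add: v_def lam_def)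
  next
    case False
    then show ?thesis by (simp add: v_def lam_def B.FI.U_zero nsq_def)
  qed
  have vsum: "(\<Sum>i<2 * card F. v i x) = (\<Sum>l\<in>G. w l x)" for x
  proof -
    have "(\<Sum>i<2 * card F. v i x) = (\<Sum>i\<in>{0..<card G}. w (h i) x)"
      using cardG by (intro sum.mono_neutral_cong_right) (auto simp: v_def)
    also have "\<dots> = (\<Sum>l\<in>G. w l x)" by (rule sum.reindex_bij_betw[OF h])
    finally show ?thesis .
  qed
  define g where "g = (\<lambda>x. e nu x - (\<Sum>i<2 * card F. v i x))"
  have g: "g = (\<lambda>x. \<Sum>l\<in>E - G. w l x)"
    unfolding g_def vsum r(4) using G r(1) by (simp add: sum_diff)
  have "inner_on ?L g g = (\<Sum>l\<in>E - G. \<Sum>l'\<in>E - G. inner_on ?L (w l) (w l'))"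
    unfolding g inner_on_sum inner_on_sum_right ..
  also have "\<dots> = (\<Sum>l\<in>E - G. inner_on ?L (w l) (w l))"
  proof (rule sum.cong[OF refl])
    fix l assume l: "l \<in> E - G"
    have fin: "finite (E - G)" using r(1) by simp
    have "inner_on ?L (w l) (w l') = 0" if "l' \<in> E - G - {l}" for l'
      using that l by (intro r(9)) auto
    then show "(\<Sum>l'\<in>E - G. inner_on ?L (w l) (w l')) = inner_on ?L (w l) (w l)"
      by (simp add: sum.remove[OF fin l])
  qed
  finally have "complex_of_real (nsq ?L g) = complex_of_real (\<Sum>l\<in>E - G. nsq ?L (w l))"
    by (simp only: inner_on_self of_real_sum)
  then have ng: "nsq ?L g \<le> 2 * eps" using rest by (simp only: of_real_eq_iff)
  have gsupp: "g x = 0" if "x \<notin> ?L" for x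
    unfolding g using r(5)[OF _ that] by (intro sum.neutral) auto
  have "nsq J g \<le> 2 * eps" if J: "finite J" for J
  proof -
    have "nsq J g = nsq (J \<inter> ?L) g"
      unfolding nsq_def using J gsupp by (intro sum.mono_neutral_right) auto
    also have "\<dots> \<le> nsq ?L g" by (rule nsq_mono[OF finite_box]) simp
    finally show ?thesis using ng by simp
  qed
  then show ?thesis using props unfolding g_def by blast
qed

text \<open>Along a subsequence all eigenvalues and components converge. Pointwise convergence is
  enough: the eigenvalue equation is local, while norm bounds and the approximation error are tested
  on finite sets of sites.\<close>

lemma site_approximation:
  assumes om: "unit_phase om" and nu: "nu \<in> strip M" and loc: "localized nu om" and eps: "eps > 0"
  shows "\<exists>u. eig_span (strip M) (V om) u \<and> sqnorm (\<lambda>x. e nu x - u x) \<le> ennreal eps"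
proof -
  obtain F where F: "finite F"
    "liminf (\<lambda>n. \<Sum>m\<in>box M n - F. B.majorant n m nu om) < ennreal (eps / 2)"
    using loc eps unfolding localized_def by (meson half_gt_zero)
  define P where "P = (\<lambda>n (v :: nat \<Rightarrow> vec) (lam :: nat \<Rightarrow> complex).
     (\<forall>i. cmod (lam i) = 1 \<and> (\<forall>x. B.U n om (v i) x = lam i * v i x) \<and> nsq (box M n) (v i) \<le> 1
      \<and> (\<forall>x. x \<notin> box M n \<longrightarrow> v i x = 0))
    \<and> (\<forall>J. finite J \<longrightarrow> nsq J (\<lambda>x. e nu x - (\<Sum>i<2 * card F. v i x)) \<le> eps))"
  have ex: "\<exists>n\<ge>k. \<exists>v lam. P n v lam" for k
  proof -
    have "\<exists>n\<ge>k. nu \<in> box M n \<and> (\<Sum>m\<in>box M n - F. B.majorant n m nu om) < ennreal (eps / 2)"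
    proof (rule ccontr)
      assume "\<not> ?thesis"
      then have ge: "n \<ge> k \<Longrightarrow> nu \<in> box M n \<Longrightarrow> ennreal (eps / 2) \<le> (\<Sum>m\<in>box M n - F. B.majorant n m nu om)" for n
        by (meson not_le)
      have "ennreal (eps / 2) \<le> liminf (\<lambda>n. \<Sum>m\<in>box M n - F. B.majorant n m nu om)"
        using box_eventually[OF nu] eventually_ge_at_top[of k]
        by (intro Liminf_bounded, eventually_elim) (rule ge)
      then show False using F(2) by simp
    qed
    then obtain n where n: "n \<ge> k" "nu \<in> box M n" "(\<Sum>m\<in>box M n - F. B.majorant n m nu om) < ennreal (eps / 2)" by blast
    have "\<exists>v lam. P n v lam"
      using finite_volume_approximation[OF n(2) F(1) _ n(3)] eps unfolding P_def by simp
    then show ?thesis using n(1) by blast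
  qed
  then obtain nn vv ll where s: "\<And>k. nn k \<ge> k" "\<And>k. P (nn k) (vv k) (ll k)" by metis
  have nn: "filterlim nn sequentially sequentially"
    by (rule filterlim_at_top_mono[OF filterlim_ident]) (use s(1) in simp)
  \<comment> \<open>Eigenvalues (\<open>None\<close>) and components (\<open>Some x\<close>) form
    one countable family, so that one diagonal argument suffices.\<close>
  define g where "g = (\<lambda>k (i, y). case y of None \<Rightarrow> ll k i | Some x \<Rightarrow> vv k i x)"
  have vv1: "cmod (vv k i x) \<le> 1" for k i x
  proof (cases "x \<in> box M (nn k)")
    case True
    have "(cmod (vv k i x))\<^sup>2 \<le> nsq (box M (nn k)) (vv k i)" by (rule cmod_le_nsq[OF finite_box True])
    also have "\<dots> \<le> 1" using s(2)[of k] by (simp add: P_def)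
    finally show ?thesis by (simp add: abs_square_le_1)
  next
    case False
    then show ?thesis using s(2)[of k] by (simp add: P_def)
  qed
  have "cmod (g k p) \<le> 1" for k p
    using vv1 s(2)[of k] by (cases p) (auto simp: g_def P_def split: option.split)
  then obtain r where r: "strict_mono r" "\<And>p. convergent (\<lambda>k. g (r k) p)"
    using bounded_family_convergent_subsequence[of g] by blast
  have "convergent (\<lambda>k. ll (r k) i)" "convergent (\<lambda>k. vv (r k) i x)" for i x
    using r(2)[of "(i, None)"] r(2)[of "(i, Some x)"] by (simp_all add: g_def)
  then obtain lam v where lam: "\<And>i. (\<lambda>k. ll (r k) i) \<longlonglongrightarrow> lam i" and v: "\<And>i x. (\<lambda>k. vv (r k) i x) \<longlonglongrightarrow> v i x"
    unfolding convergent_def by metis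
  have nr: "filterlim (\<lambda>k. nn (r k)) sequentially sequentially"
    by (rule filterlim_compose[OF nn filterlim_subseq[OF r(1)]])
  have eig: "V om (v i) x = lam i * v i x" for i x
  proof -
    \<comment> \<open>The agreement has to hold for all \<open>f\<close> at once, because the
      vectors inserted below vary with the box.\<close>
    have loc: "eventually (\<lambda>n. \<forall>f. B.U n om f x = V om f x) sequentially"
      using coef_eventually[of x]
    proof eventually_elim
      case (elim n)
      have "unimod (om x) = om x" using om by (simp add: unit_phase_def unimod_def)
      then show ?case using elim by (simp add: B.stp_def U_op_eq_hop hop_def)
    qed
    have "eventually (\<lambda>k. V om (vv (r k) i) x = ll (r k) i * vv (r k) i x) sequentially"
      using filterlim_iff[THEN iffD1, OF nr, rule_format, OF loc]
    proof eventually_elim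
      case (elim k)
      have "B.U (nn (r k)) om (vv (r k) i) x = ll (r k) i * vv (r k) i x"
        using s(2)[of "r k"] unfolding P_def by blast
      then show ?case using spec[OF elim, of "vv (r k) i"] by (simp only:)
    qed
    moreover have "(\<lambda>k. V om (vv (r k) i) x) \<longlonglongrightarrow> V om (v i) x"
    proof (cases "x \<in> strip M")
      case True
      show ?thesis unfolding U_op_eq_hop hop_def if_P[OF True] by (intro tendsto_intros v)
    qed (simp add: U_op_eq_hop)
    ultimately have "(\<lambda>k. ll (r k) i * vv (r k) i x) \<longlonglongrightarrow> V om (v i) x"
      by (rule Lim_transform_eventually[rotated])
    moreover have "(\<lambda>k. ll (r k) i * vv (r k) i x) \<longlonglongrightarrow> lam i * v i x"
      by (intro tendsto_intros lam v)
    ultimately show ?thesis by (rule LIMSEQ_unique)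
  qed
  have lim_nsq: "(\<lambda>k. nsq J (f k)) \<longlonglongrightarrow> nsq J h" if "\<And>x. (\<lambda>k. f k x) \<longlonglongrightarrow> h x" for J f h
    unfolding nsq_def by (intro tendsto_intros that)
  have vout: "v i x = 0" if "x \<notin> strip M" for i x
  proof -
    have "vv k i x = 0" for k using s(2)[of k] that by (auto simp: P_def box_def)
    then show ?thesis using v[of i x] LIMSEQ_unique[OF _ tendsto_const] by simp
  qed
  have vl2: "in_l2 (strip M) (v i)" for i
  proof -
    have "nsq J (v i) \<le> 1" if J: "finite J" for J
    proof (rule LIMSEQ_le_const2[OF lim_nsq[OF v]], intro exI allI impI)
      fix k :: nat
      let ?n = "nn (r k)"
      have z: "vv (r k) i x = 0" if "x \<notin> box M ?n" for x using s(2)[of "r k"] that by (simp add: P_def)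
      have "nsq J (vv (r k) i) = nsq (J \<inter> box M ?n) (vv (r k) i)"
        unfolding nsq_def using J z by (intro sum.mono_neutral_right) auto
      also have "\<dots> \<le> nsq (box M ?n) (vv (r k) i)" by (rule nsq_mono[OF finite_box]) simp
      also have "\<dots> \<le> 1" using s(2)[of "r k"] by (simp add: P_def)
      finally show "nsq J (vv (r k) i) \<le> 1" .
    qed
    then have "sqnorm (v i) \<le> ennreal 1" by (rule sqnorm_le_of_nsq)
    also have "\<dots> < \<infinity>" by simp
    finally show ?thesis using vout by (simp add: in_l2_def)
  qed
  have span: "eig_span (strip M) (V om) (v i)" for i
  \<comment> \<open>A limit may vanish; it is then no eigenvector but adds nothing to the
    span.\<close>
  proof (cases "v i = (\<lambda>_. 0)")
    case True
    then show ?thesis by (simp add: eig_zero)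
  next
    case False
    then have "eigvec (strip M) (V om) (v i)"
      unfolding eigvec_def using vl2 eig by blast
    then show ?thesis by (rule eig_span_eigvec)
  qed
  define u where "u = (\<lambda>x. \<Sum>i<2 * card F. v i x)"
  have "nsq J (\<lambda>x. e nu x - u x) \<le> eps" if J: "finite J" for J
  proof (rule LIMSEQ_le_const2, rule lim_nsq)
    show "(\<lambda>k. e nu x - (\<Sum>i<2 * card F. vv (r k) i x)) \<longlonglongrightarrow> e nu x - u x" for x
      unfolding u_def by (intro tendsto_intros v)
    show "\<exists>N. \<forall>k\<ge>N. nsq J (\<lambda>x. e nu x - (\<Sum>i<2 * card F. vv (r k) i x)) \<le> eps"
      using s(2) J by (auto simp: P_def)
  qed
  then have "sqnorm (\<lambda>x. e nu x - u x) \<le> ennreal eps" by (rule sqnorm_le_of_nsq)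
  moreover have "eig_span (strip M) (V om) u" unfolding u_def by (rule eig_span_sum) (rule span)
  ultimately show ?thesis by blast
qed

lemma AE_pure_point: "AE om in Prob. pure_point (strip M) (V om)"
proof -
  have "AE om in Prob. \<forall>nu\<in>strip M. localized nu om"
    using AE_localized by (subst AE_ball_countable) (auto intro: countableI_type)
  with AE_unit_phase show ?thesis
  proof eventually_elim
    case (elim om)
    then show ?case by (intro pure_point_of_sites site_approximation) auto
  qed
qed

end

theorem theorem2:
  fixes M :: nat
  assumes "M \<ge> 1"
  shows "\<exists>phi0 > 0. \<forall>phi::real. (\<exists>k::int. \<bar>phi - real_of_int k * pi\<bar> \<le> phi0) \<longrightarrow>
     ((AE om in Prob. pure_point (strip M) (U_op M om phi))
    \<and> (\<forall>p::real. \<forall>psi. p \<ge> 0 \<longrightarrow> in_l2 (strip M) psi \<longrightarrow> finite {mu. psi mu \<noteq> 0} \<longrightarrow>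
         (AE om in Prob. (SUP n::int. sqnorm (absX_pow p (upow (U_op M om phi) n psi))) < \<infinity>))
    \<and> (\<exists>c>0. \<exists>g>0. \<forall>mu \<in> strip M. \<forall>nu \<in> strip M.
         (\<integral>\<^sup>+ om. (SUP f \<in> {f. continuous_on circle f \<and> (\<forall>z\<in>circle. cmod (f z) \<le> 1)}.
                      ennreal (cmod (fcalc (U_op M om phi) f (e nu) mu))) \<partial>Prob)
         \<le> ennreal (c * exp (- g * enorm (fst mu - fst nu, snd mu - snd nu)))))"
proof -
  obtain C :: real where C: "C \<ge> 1" "\<And>b. cmod b \<le> 1 \<Longrightarrow>
      (\<integral>\<^sup>+ u. ennreal (1 / sqrt (cmod (1 - u * b))) \<partial>circle_measure) \<le> ennreal C"
    using circle_inverse_sqrt by blast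
  \<comment> \<open>Chosen so that \<open>4 * C\<^sup>2 * sqrt phi0 = 1 / 4\<close>. Since
    \<open>C\<close> comes from an integral over one circle, the value is the same for all
    \<open>M\<close>.\<close>
  define phi0 where "phi0 = (1 / (16 * C\<^sup>2))\<^sup>2"
  have phi0: "phi0 > 0" using C(1) by (simp add: phi0_def)
  have model: "strip_model phi C" if k: "\<bar>phi - real_of_int k * pi\<bar> \<le> phi0" for phi k
  proof
    have "sin (real_of_int k * pi) = 0" by (simp add: sin_zero_iff_int2)
    then have "\<bar>sin phi\<bar> = \<bar>sin (phi - real_of_int k * pi)\<bar>"
      using sin_cos_squared_add[of "real_of_int k * pi"]
      by (simp add: sin_diff abs_mult abs_square_eq_1)
    also have "\<dots> \<le> \<bar>phi - real_of_int k * pi\<bar>" by (rule abs_sin_x_le_abs_x)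
    also have "\<dots> \<le> phi0" by (rule k)
    finally have "sqrt \<bar>sin phi\<bar> \<le> sqrt phi0" by (rule real_sqrt_le_mono)
    also have "sqrt phi0 = 1 / (16 * C\<^sup>2)" unfolding phi0_def by (simp add: real_sqrt_abs)
    finally have "4 * C\<^sup>2 * sqrt \<bar>sin phi\<bar> \<le> 4 * C\<^sup>2 * (1 / (16 * C\<^sup>2))" by (intro mult_left_mono) auto
    then show "4 * C\<^sup>2 * sqrt \<bar>sin phi\<bar> \<le> 1 / 4" using C(1) by simp
  qed (use C in auto)
  show ?thesis
  proof (rule exI[of _ phi0], rule conjI[OF phi0], intro allI impI)
    fix phi :: real
    assume "\<exists>k::int. \<bar>phi - real_of_int k * pi\<bar> \<le> phi0"
    then obtain k :: int where k: "\<bar>phi - real_of_int k * pi\<bar> \<le> phi0" ..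
    interpret strip_model M phi C by (rule model[OF k])
    have 2: "AE om in Prob. (SUP n::int. sqnorm (absX_pow p (upow (U_op M om phi) n psi))) < \<infinity>"
      if "p \<ge> 0" "in_l2 (strip M) psi" "finite {mu. psi mu \<noteq> 0}" for p psi
      by (rule moments_bounded[OF that])
    have 3: "\<exists>c>0. \<exists>g>0. \<forall>mu \<in> strip M. \<forall>nu \<in> strip M.
         (\<integral>\<^sup>+ om. (SUP f \<in> {f. continuous_on circle f \<and> (\<forall>z\<in>circle. cmod (f z) \<le> 1)}.
                      ennreal (cmod (fcalc (U_op M om phi) f (e nu) mu))) \<partial>Prob)
         \<le> ennreal (c * exp (- g * enorm (fst mu - fst nu, snd mu - snd nu)))"
    proof (intro exI conjI ballI)
      show "0 < 2 * (8 * pi * C\<^sup>2 + 1)" by (intro mult_pos_pos add_nonneg_pos) auto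
      show "0 < (ln 2 / 3 :: real)" by simp
    qed (rule dynamical_localization)
    show "(AE om in Prob. pure_point (strip M) (U_op M om phi))
    \<and> (\<forall>p::real. \<forall>psi. p \<ge> 0 \<longrightarrow> in_l2 (strip M) psi \<longrightarrow> finite {mu. psi mu \<noteq> 0} \<longrightarrow>
         (AE om in Prob. (SUP n::int. sqnorm (absX_pow p (upow (U_op M om phi) n psi))) < \<infinity>))
    \<and> (\<exists>c>0. \<exists>g>0. \<forall>mu \<in> strip M. \<forall>nu \<in> strip M.
         (\<integral>\<^sup>+ om. (SUP f \<in> {f. continuous_on circle f \<and> (\<forall>z\<in>circle. cmod (f z) \<le> 1)}.
                      ennreal (cmod (fcalc (U_op M om phi) f (e nu) mu))) \<partial>Prob)
         \<le> ennreal (c * exp (- g * enorm (fst mu - fst nu, snd mu - snd nu))))"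
      using AE_pure_point 2 3 by blast
  qed
qed

end
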